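(* Let $Q$ be a finite quiver with vertex set $I$ and arrow set $\Omega$, $\mathbb F$ a field of characteristic $0$ with elements $t_\alpha,q\in\mathbb F^*$ ($\alpha\in\Omega$), and $R\subset\mathbb F$ the subring generated by all $t_\alpha^{\pm1},q^{\pm1}$. Assume that $q$ is not a root of unity and that $t_\alpha\notin q^{\mathbb Z}$ for every loop $\alpha\in\Omega$. Then the integral shuffle algebra $\mathcal S^+\subset\mathcal V^+$ coincides with the $R$-subalgebra of the big shuffle algebra $\mathcal V^+$ generated by the elements $$e_{\mathbf n,g}=g(z_{i1},\dots,z_{in_i})_{i\in I}\prod_{i\in I}\prod_{1\le a,b\le n_i}\Big(1-\frac{z_{ia}}{z_{ib}q}\Big)$$ as $\mathbf n=(n_i)_{i\in I}$ ranges over $\mathbb N^I$ and $g$ ranges over $R[z_{i1}^{\pm1},\dots,z_{in_i}^{\pm1}]^{\rm sym}_{i\in I}$.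
   Context: $\mathbb N$ contains $0$; "sym" means Laurent polynomials symmetric in $z_{i1},\dots,z_{in_i}$ for each $i\in I$ separately. The big shuffle algebra is $\mathcal V^+=\bigoplus_{\mathbf n\in\mathbb N^I}R[z_{i1}^{\pm1},\dots,z_{in_i}^{\pm1}]_{i\in I}^{\rm sym}$ with product, for $E$ of degree $\mathbf n$ and $E'$ of degree $\mathbf n'$, $$E*E'=\mathrm{Sym}\Big[\frac{E(z_{i1},\dots,z_{in_i})E'(z_{i,n_i+1},\dots,z_{i,n_i+n_i'})}{\prod_in_i!\,n_i'!}\prod_{i,j\in I}\prod_{1\le a\le n_i}\prod_{n_j<b\le n_j+n_j'}\zeta_{ij}\Big(\frac{z_{ia}}{z_{jb}}\Big)\Big],$$ where $\mathrm{Sym}$ is the sum over all $\prod_i(n_i+n_i')!$ permutations of $z_{i1},\dots,z_{i,n_i+n'_i}$ for each $i$, and $$\zeta_{ij}(x)=\Big(\frac{1-xq^{-1}}{1-x}\Big)^{\delta_{ij}}\prod_{(\alpha:i\to j)\in\Omega}(1-xt_\alpha)\prod_{(\alpha:j\to i)\in\Omega}\Big(1-\frac{t_\alpha}{xq}\Big).$$ The integral shuffle algebra $\mathcal S^+\subset\mathcal V^+$ is the span of homogeneous $E(z_{i1},\dots,z_{in_i})_{i\in I}$ such that for every $I$-composition $P=\{n_i=n_i^{(1)}+\dots+n_i^{(d_i)}\}_{i\in I}$ (positive parts), the specialization $$\mathrm{Spec}_P(E)=E\big(x_{i1},x_{i1}q,\dots,x_{i1}q^{n_i^{(1)}-1},\dots,x_{id_i},x_{id_i}q,\dots,x_{id_i}q^{n_i^{(d_i)}-1}\big)_{i\in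 I}$$ is divisible in $R[x_{i1}^{\pm1},\dots,x_{id_i}^{\pm1}]_{i\in I}$ by $$\prod_{i\in I}\prod_{a=1}^{d_i}\Big[(1-q^{-1})(1-q^{-2})\cdots(1-q^{-n_i^{(a)}})\Big]\prod_{(\alpha:i\to j)\in\Omega}\ \prod_{1\le a\le d_i,\,1\le b\le d_j}\ \prod_{c\in\mathbb Z}\Big(1-\frac{x_{ia}t_\alpha}{x_{jb}q^c}\Big)^{\chi_{n_i^{(a)},n_j^{(b)}}(c)},$$ where for $n,n'\ge1$, $\chi_{n,n'}(c)=\max\big(0,\min(n+c-1,\;n'-c,\;\min(n,n')-\delta_{nn'})\big)$; i.e. $\chi_{n,n'}$ vanishes for $c\le -n+1$ and $c\ge n'$, has slopes $+1$, then $0$ at the plateau value $\min(n,n')-\delta_{nn'}$, then $-1$. *)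

theory Defs
  imports
    "Graph_Theory.Digraph"
    "HOL-Library.Poly_Mapping"
    "HOL-Library.Groups_Big_Fun"
    "HOL-Combinatorics.Permutations"
    "HOL-Computational_Algebra.Polynomial_Factorial"
begin

section \<open>Laurent polynomials and rational functions\<close>

text \<open>
  The variable \<open>Var i a\<close> stands for $z_{ia}$ (or $x_{ia}$), with $a \ge 1$.
  Laurent polynomials form the monoid algebra of the free abelian group on the variables,
  so multiplication is the convolution of \<^typ>\<open>'a \<Rightarrow>\<^sub>0 'b\<close>.  The linear order on
  variables is an arbitrary one: its only purpose is to make the library's integral domain
  instance for this algebra available, and hence its fraction field.
\<close>

datatype 'i var = Var 'i nat

instantiation var :: (type) linorder
begin

definition less_eq_var :: "'a var \<Rightarrow> 'a var \<Rightarrow> bool"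
  where "(x::'a var) \<le> y \<longleftrightarrow> (x, y) \<in> (SOME r. linear_order_on UNIV r)"

definition less_var :: "'a var \<Rightarrow> 'a var \<Rightarrow> bool"
  where "(x::'a var) < y \<longleftrightarrow> x \<le> y \<and> x \<noteq> y"

instance
proof -
  have "\<exists>r :: 'a var rel. linear_order_on UNIV r"
    using well_ordering[where 'a = "'a var"] by (metis well_order_on_def)
  then have "linear_order_on UNIV (SOME r :: 'a var rel. linear_order_on UNIV r)"
    by (rule someI_ex)
  then have "linear_order_on UNIV {(x :: 'a var, y). x \<le> y}"
    by (simp add: less_eq_var_def)
  then have refl: "x \<le> x" and trans: "x \<le> y \<Longrightarrow> y \<le> z \<Longrightarrow> x \<le> z"
    and antisym: "x \<le> y \<Longrightarrow> y \<le> x \<Longrightarrow> x = y" and total: "x = y \<or> x \<le> y \<or> y \<le> x"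
    for x y z :: "'a var"
    unfolding linear_order_on_def partial_order_on_def preorder_on_def
    by (auto dest: refl_onD transD antisymD simp: total_on_def)
  show "OFCLASS('a var, linorder_class)"
  proof
    fix x y z :: "'a var"
    show "x < y \<longleftrightarrow> x \<le> y \<and> \<not> y \<le> x"
      using antisym refl by (metis less_var_def)
    show "x \<le> x" by (rule refl)
    show "x \<le> z" if "x \<le> y" "y \<le> z" using that by (rule trans)
    show "x = y" if "x \<le> y" "y \<le> x" using that by (rule antisym)
    show "x \<le> y \<or> y \<le> x" using total[of x y] refl[of x] by metis
  qed
qed

end

type_synonym ('i, 'k) laurent = "('i var \<Rightarrow>\<^sub>0 int) \<Rightarrow>\<^sub>0 'k"
type_synonym ('i, 'k) ratfun = "('i, 'k) laurent fract"

definition lconst :: "'k \<Rightarrow> ('i, 'k::idom) laurent"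
  where "lconst c = Poly_Mapping.single 0 c"

definition lvar :: "'i \<Rightarrow> nat \<Rightarrow> int \<Rightarrow> ('i, 'k::idom) laurent"
  \<comment> \<open>the monomial $z_{ia}^k$\<close>
  where "lvar i a k = Poly_Mapping.single (Poly_Mapping.single (Var i a) k) 1"

definition rconst :: "'k \<Rightarrow> ('i, 'k::idom) ratfun"
  where "rconst c = to_fract (lconst c)"

definition rvar :: "'i \<Rightarrow> nat \<Rightarrow> ('i, 'k::idom) ratfun"
  where "rvar i a = to_fract (lvar i a 1)"

definition lsubst :: "('i var \<Rightarrow> ('i, 'k) ratfun) \<Rightarrow> ('i, 'k::idom) laurent \<Rightarrow> ('i, 'k) ratfun"
  \<comment> \<open>substitution of nonzero rational functions for the variables\<close>
  where "lsubst s E =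
    (\<Sum>m\<in>Poly_Mapping.keys E. rconst (Poly_Mapping.lookup E m) *
       (\<Prod>v\<in>Poly_Mapping.keys m. s v powi Poly_Mapping.lookup m v))"

section \<open>Shuffle algebras of a quiver\<close>

definition is_subring :: "'k::comm_ring_1 set \<Rightarrow> bool"
  where "is_subring S \<longleftrightarrow> 1 \<in> S \<and> (\<forall>x\<in>S. \<forall>y\<in>S. x - y \<in> S \<and> x * y \<in> S)"

definition composition :: "nat \<Rightarrow> nat list \<Rightarrow> bool"
  where "composition n p \<longleftrightarrow> (\<forall>k\<in>set p. 0 < k) \<and> sum_list p = n"

definition chi :: "nat \<Rightarrow> nat \<Rightarrow> int \<Rightarrow> nat"
  where "chi n n' c =
    nat (max 0 (min (int n + c - 1) (min (int n' - c) (int (min n n') - of_bool (n = n')))))"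

definition perm_families :: "('i \<Rightarrow> nat) \<Rightarrow> ('i \<Rightarrow> nat \<Rightarrow> nat) set"
  where "perm_families n = {\<sigma>. \<forall>i. \<sigma> i permutes {1..n i}}"

text \<open>
  A graded vector is a finitely supported family of Laurent polynomials, indexed by degrees
  $\mathbf n \in \mathbb N^I$; \<open>Poly_Mapping.single n E\<close> is \<open>E\<close> placed in degree \<open>n\<close>.
  A degree is a function on the whole type of vertices that vanishes outside of $I$.
\<close>

type_synonym ('i, 'k) graded = "('i \<Rightarrow> nat) \<Rightarrow>\<^sub>0 ('i, 'k) laurent"

definition gscale :: "'k \<Rightarrow> ('i, 'k) graded \<Rightarrow> ('i, 'k::idom) graded"
  where "gscale c F = Poly_Mapping.map (\<lambda>E. lconst c * E) F"

context
  fixes Q :: "('i, 'e) pre_digraph"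
    and t :: "'e \<Rightarrow> 'k::field_char_0"
    and q :: 'k
begin

definition degrees :: "('i \<Rightarrow> nat) set"
  where "degrees = {n. \<forall>i. i \<notin> verts Q \<longrightarrow> n i = 0}"

definition coeff_ring :: "'k set"
  where "coeff_ring =
    is_subring hull ((\<Union>\<alpha>\<in>arcs Q. {t \<alpha>, inverse (t \<alpha>)}) \<union> {q, inverse q})"

definition laurent_ring :: "('i \<Rightarrow> nat) \<Rightarrow> ('i, 'k) laurent set"
  \<comment> \<open>$R[z_{i1}^{\pm1}, \dots, z_{in_i}^{\pm1}]_{i\in I}$\<close>
  where "laurent_ring n =
    {E. range (Poly_Mapping.lookup E) \<subseteq> coeff_ring \<and>
        (\<forall>m\<in>Poly_Mapping.keys E. Poly_Mapping.keys m \<subseteq> {Var i a | i a. i \<in> verts Q \<and> a \<in> {1..n i}})}"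

definition sym_laurent :: "('i \<Rightarrow> nat) \<Rightarrow> ('i, 'k) laurent set"
  where "sym_laurent n =
    {E \<in> laurent_ring n.
       \<forall>\<sigma>\<in>perm_families n. lsubst (\<lambda>v. case v of Var i a \<Rightarrow> rvar i (\<sigma> i a)) E = to_fract E}"

definition zeta :: "'i \<Rightarrow> 'i \<Rightarrow> ('i, 'k) ratfun \<Rightarrow> ('i, 'k) ratfun"
  where "zeta i j x =
    ((1 - x * rconst (inverse q)) / (1 - x)) ^ of_bool (i = j) *
    (\<Prod>\<alpha>\<in>{\<alpha>\<in>arcs Q. tail Q \<alpha> = i \<and> head Q \<alpha> = j}. 1 - x * rconst (t \<alpha>)) *
    (\<Prod>\<alpha>\<in>{\<alpha>\<in>arcs Q. tail Q \<alpha> = j \<and> head Q \<alpha> = i}. 1 - rconst (t \<alpha>) / (x * rconst q))"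

text \<open>
  The symmetrization is a sum in the field of rational functions: the summand of \<open>\<sigma>\<close> is the
  expression under $\mathrm{Sym}$ with each $z_{ia}$ replaced by $z_{i\sigma_i(a)}$.  The simple
  poles along $z_{ia} = z_{ib}$ cancel in the sum, so it is a Laurent polynomial, which is
  unique since \<^const>\<open>to_fract\<close> is injective.
\<close>

definition shuffle_sym ::
    "('i \<Rightarrow> nat) \<Rightarrow> ('i \<Rightarrow> nat) \<Rightarrow> ('i, 'k) laurent \<Rightarrow> ('i, 'k) laurent \<Rightarrow> ('i, 'k) ratfun"
  where "shuffle_sym n n' E E' =
    (\<Sum>\<sigma>\<in>perm_families (\<lambda>i. n i + n' i).
       lsubst (\<lambda>v. case v of Var i a \<Rightarrow> rvar i (\<sigma> i a)) E *
       lsubst (\<lambda>v. case v of Var i a \<Rightarrow> rvar i (\<sigma> i (n i + a))) E' /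
       of_nat (\<Prod>i\<in>verts Q. fact (n i) * fact (n' i)) *
       (\<Prod>i\<in>verts Q. \<Prod>j\<in>verts Q. \<Prod>a\<in>{1..n i}. \<Prod>b\<in>{n j<..n j + n' j}.
          zeta i j (rvar i (\<sigma> i a) / rvar j (\<sigma> j b))))"

definition shuffle_homog ::
    "('i \<Rightarrow> nat) \<Rightarrow> ('i \<Rightarrow> nat) \<Rightarrow> ('i, 'k) laurent \<Rightarrow> ('i, 'k) laurent \<Rightarrow> ('i, 'k) laurent"
  where "shuffle_homog n n' E E' = (THE P. to_fract P = shuffle_sym n n' E E')"

definition shuffle_mult :: "('i, 'k) graded \<Rightarrow> ('i, 'k) graded \<Rightarrow> ('i, 'k) graded"
  where "shuffle_mult F F' =
    (\<Sum>n\<in>Poly_Mapping.keys F. \<Sum>n'\<in>Poly_Mapping.keys F'.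
       Poly_Mapping.single (\<lambda>i. n i + n' i)
         (shuffle_homog n n' (Poly_Mapping.lookup F n) (Poly_Mapping.lookup F' n')))"

definition shuffle_one :: "('i, 'k) graded"
  where "shuffle_one = Poly_Mapping.single (\<lambda>i. 0) 1"

definition big_shuffle :: "('i, 'k) graded set"
  where "big_shuffle =
    {F. Poly_Mapping.keys F \<subseteq> degrees \<and> (\<forall>n\<in>degrees. Poly_Mapping.lookup F n \<in> sym_laurent n)}"

definition is_submodule :: "('i, 'k) graded set \<Rightarrow> bool"
  where "is_submodule M \<longleftrightarrow> M \<subseteq> big_shuffle \<and> 0 \<in> M \<and>
    (\<forall>F\<in>M. \<forall>F'\<in>M. F + F' \<in> M) \<and> (\<forall>c\<in>coeff_ring. \<forall>F\<in>M. gscale c F \<in> M)"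

definition is_subalgebra :: "('i, 'k) graded set \<Rightarrow> bool"
  where "is_subalgebra A \<longleftrightarrow>
    is_submodule A \<and> shuffle_one \<in> A \<and> (\<forall>F\<in>A. \<forall>F'\<in>A. shuffle_mult F F' \<in> A)"

subsection \<open>The integral shuffle algebra\<close>

text \<open>
  \<open>P i\<close> is the list $n_i^{(1)}, \dots, n_i^{(d_i)}$.  The $a$-th variable of colour \<open>i\<close> is
  specialized to the $a$-th entry of the list
  $x_{i1}, x_{i1}q, \dots, x_{i1}q^{n_i^{(1)}-1}, \dots, x_{id_i}, \dots, x_{id_i}q^{n_i^{(d_i)}-1}$.
\<close>

definition spec :: "('i \<Rightarrow> nat list) \<Rightarrow> ('i, 'k) laurent \<Rightarrow> ('i, 'k) ratfun"
  where "spec P E =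
    lsubst (\<lambda>v. case v of Var i a \<Rightarrow>
      concat (map (\<lambda>b. map (\<lambda>c. rvar i b * rconst (q ^ c)) [0..<P i ! (b - 1)])
        [1..<Suc (length (P i))]) ! (a - 1)) E"

definition spec_divisor :: "('i \<Rightarrow> nat list) \<Rightarrow> ('i, 'k) ratfun"
  where "spec_divisor P =
    (\<Prod>i\<in>verts Q. \<Prod>a\<in>{1..length (P i)}. \<Prod>k\<in>{1..P i ! (a - 1)}. 1 - rconst (inverse q ^ k)) *
    (\<Prod>\<alpha>\<in>arcs Q. let i = tail Q \<alpha>; j = head Q \<alpha> in
       \<Prod>a\<in>{1..length (P i)}. \<Prod>b\<in>{1..length (P j)}. \<Prod>c::int.
         (1 - rvar i a * rconst (t \<alpha>) / (rvar j b * rconst (q powi c)))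
           ^ chi (P i ! (a - 1)) (P j ! (b - 1)) c)"

definition spec_divisible :: "('i \<Rightarrow> nat list) \<Rightarrow> ('i, 'k) laurent \<Rightarrow> bool"
  where "spec_divisible P E \<longleftrightarrow>
    (\<exists>H\<in>laurent_ring (\<lambda>i. length (P i)). spec P E = spec_divisor P * to_fract H)"

definition integral_shuffle :: "('i, 'k) graded set"
  where "integral_shuffle =
    is_submodule hull
      {Poly_Mapping.single n E | n E. n \<in> degrees \<and> E \<in> sym_laurent n \<and>
         (\<forall>P. (\<forall>i. composition (n i) (P i)) \<longrightarrow> spec_divisible P E)}"

subsection \<open>The generators\<close>

definition e_gen :: "('i \<Rightarrow> nat) \<Rightarrow> ('i, 'k) laurent \<Rightarrow> ('i, 'k) graded"
  where "e_gen n g = Poly_Mapping.single n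
    (g * (\<Prod>i\<in>verts Q. \<Prod>a\<in>{1..n i}. \<Prod>b\<in>{1..n i}.
       1 - lvar i a 1 * lvar i b (-1) * lconst (inverse q)))"

end

end

theory Submission
  imports Defs
begin

text \<open>
  Write $e_{\mathbf n, g}$ for the generators.  Specialize a product $E * E'$ to segments
  $x, xq, \dots, xq^{n-1}$.  Since $\zeta_{ii}(q) = 0$, only those terms survive in which every segment is
  cut into an initial part, given to $E$, and a final part, given to $E'$.  The divisors of the two parts
  and the $\zeta$-factors between them multiply up to a multiple of the divisor of the whole segments,
  and the spurious denominators $1 - q^c x_{ia}/x_{ib}$ are coprime to it because $t_\alpha \notin q^{\mathbb Z}$ for
  loops.  So the integral shuffle algebra is closed under products; it contains the generators
  because $e_{\mathbf n, g}$ vanishes as soon as one segment has length at least $2$.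

  Conversely, order the specializations by the weight $\sum n (n + 1)$ over all segments, and let $E$ be
  an integral element whose specializations of weight greater than $s$ vanish.  Merging two overlapping or adjacent
  segments into their union and intersection increases the weight, so a specialization of weight $s$ has, besides its divisor,
  a simple zero along each $x_{ia} = q^l x_{ib}$ where this merging is possible.  Now take the product of generators
  $e_{\mathbf m_1, g_1} * e_{\mathbf m_2, g_2} * \cdots$, where $\mathbf m_k$ counts the segments of length at least $k$.  Each
  segment meets each factor at most once and in increasing order, so the specializations of weight greater than $s$
  vanish, as do those of weight $s$ belonging to other partitions, and the remaining one equals
  exactly the divisor times the forced linear factors times $\prod_k g_k(x_{ia} q^{k-1})$.
  Products of Laurent polynomials, symmetric in the variables of the segments of length at least $k$ for the various $k$,
  span all Laurent polynomials that are symmetric in the variables of segments of equal length, so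
  a combination of such products of generators has the same leading specialization as $E$.  Subtract and iterate.
\<close>

text \<open>About the ring \<open>R\<close> nothing is known beyond its unit generators: it need not
  have unique factorization, and the constants 1 - q^(-k) in the divisor need not be invertible in
  it. This shapes every step. Division is only ever by linear forms z_ia - q^c z_ib, whose
  coefficients are units, and being coprime to such a form is replaced by not vanishing at the
  generic point of its hyperplane. The expansion of block-symmetric polynomials in products of orbit
  sums has to be unitriangular. The leading specialization of a product of generators has to match
  the divisor and the forced factors exactly, constants included; a mere multiple, which is enough
  for closure under products, would not do. It is exact because cutting a single point off each
  segment turns the inequality between the multiplicities \<open>chi\<close> into an equality. The
  weight n(n + 1) comes from the same cutting: a segment of length n that gives one point to the
  first factor loses weight 2n, so the total loss is at most twice the degree of the product, with
  equality exactly when every nonempty segment gives a point.\<close>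

abbreviation keys where "keys \<equiv> Poly_Mapping.keys"
abbreviation lookup where "lookup \<equiv> Poly_Mapping.lookup"
abbreviation single where "single \<equiv> Poly_Mapping.single"

section \<open>Evaluation of Laurent polynomials\<close>

lemma single_eq_single_iff: "single k a = single k b \<longleftrightarrow> a = b"
  by (metis lookup_single_eq)

lemma single_eq_0_iff: "single k a = 0 \<longleftrightarrow> a = 0"
  by (metis lookup_single_eq lookup_zero single_zero)

lemma rconst_simps [simp]:
  "rconst 0 = 0" "rconst 1 = 1" "rconst (a + b) = rconst a + rconst b"
  "rconst (a - b) = rconst a - rconst b" "rconst (- a) = - rconst a"
  "rconst (a * b) = rconst a * rconst b"
  by (simp_all add: rconst_def lconst_def single_add single_diff single_uminus mult_single
      flip: to_fract_mult to_fract_add to_fract_diff to_fract_uminus)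

lemma rconst_eq_iff [simp]: "rconst a = rconst b \<longleftrightarrow> a = b"
  by (simp add: rconst_def lconst_def single_eq_single_iff)

lemma rconst_eq_0_iff [simp]: "rconst a = 0 \<longleftrightarrow> a = 0"
  using rconst_eq_iff[of a 0] by simp

lemma rconst_power: "rconst (a ^ n) = rconst a ^ n"
  by (induction n) auto

lemma rconst_inverse: "rconst (inverse a) = inverse (rconst (a :: 'k::field))"
proof (cases "a = 0")
  case False
  then have "rconst a * rconst (inverse a) = 1"
    by (simp flip: rconst_simps(6))
  then show ?thesis by (metis inverse_unique)
qed simp

lemma rconst_powi: "rconst (a powi n) = rconst (a :: 'k::field) powi n"
  by (simp add: power_int_def rconst_power rconst_inverse)

definition mon :: "('i var \<Rightarrow> ('i, 'k::idom) ratfun) \<Rightarrow> ('i var \<Rightarrow>\<^sub>0 int) \<Rightarrow> ('i, 'k) ratfun"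
  where "mon s m = (\<Prod>v\<in>keys m. s v powi lookup m v)"

lemma lsubst_mon:
  "lsubst s E = (\<Sum>m\<in>keys E. rconst (lookup E m) * mon s m)"
  by (simp add: lsubst_def mon_def)

lemma mon_superset:
  assumes "finite S" "keys m \<subseteq> S"
  shows "mon s m = (\<Prod>v\<in>S. s v powi lookup m v)"
  unfolding mon_def by (rule prod.mono_neutral_left) (use assms in \<open>auto simp: in_keys_iff\<close>)

lemma mon_0 [simp]: "mon s 0 = 1"
  by (simp add: mon_def)

lemma mon_single [simp]: "mon s (single v k) = s v powi k"
  by (simp add: mon_def)

lemma mon_add:
  assumes "\<And>v. s v \<noteq> 0"
  shows "mon s (m + m') = mon s m * mon s m'"
proof -
  let ?S = "keys m \<union> keys m'"
  have "mon s (m + m') = (\<Prod>v\<in>?S. s v powi lookup (m + m') v)"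
    by (rule mon_superset) (simp_all add: keys_add)
  also have "\<dots> = (\<Prod>v\<in>?S. s v powi lookup m v) * (\<Prod>v\<in>?S. s v powi lookup m' v)"
    using assms by (simp add: lookup_add power_int_add prod.distrib)
  also have "\<dots> = mon s m * mon s m'"
    by (simp add: mon_superset[of ?S])
  finally show ?thesis .
qed

lemma lsubst_superset:
  assumes "finite S" "keys E \<subseteq> S"
  shows "lsubst s E = (\<Sum>m\<in>S. rconst (lookup E m) * mon s m)"
  unfolding lsubst_mon by (rule sum.mono_neutral_left) (use assms in \<open>auto simp: in_keys_iff\<close>)

lemma lsubst_0 [simp]: "lsubst s 0 = 0"
  by (simp add: lsubst_mon)

lemma lsubst_single [simp]: "lsubst s (single m c) = rconst c * mon s m"
  by (simp add: lsubst_mon)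

lemma lsubst_add [simp]: "lsubst s (E + E') = lsubst s E + lsubst s E'"
proof -
  let ?S = "keys E \<union> keys E'"
  have "lsubst s (E + E') = (\<Sum>m\<in>?S. rconst (lookup (E + E') m) * mon s m)"
    by (rule lsubst_superset) (simp_all add: keys_add)
  also have "\<dots> = lsubst s E + lsubst s E'"
    by (simp add: lookup_add ring_distribs sum.distrib lsubst_superset[of ?S])
  finally show ?thesis .
qed

lemma lsubst_sum: "lsubst s (\<Sum>x\<in>A. f x) = (\<Sum>x\<in>A. lsubst s (f x))"
  by (induction A rule: infinite_finite_induct) auto

lemma poly_mapping_sum_single:
  "(\<Sum>m\<in>keys E. single m (lookup E m)) = E"
  by (rule poly_mapping_eqI)
    (simp add: lookup_sum lookup_single when_def in_keys_iff)

lemma lsubst_mult: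
  assumes "\<And>v. s v \<noteq> 0"
  shows "lsubst s (E * E') = lsubst s E * lsubst s E'"
proof -
  have "E * E' = (\<Sum>m\<in>keys E. \<Sum>m'\<in>keys E'.
     single (m + m') (lookup E m * lookup E' m'))"
    by (subst (1 2) poly_mapping_sum_single[symmetric]) (simp add: sum_product mult_single)
  then have "lsubst s (E * E') = (\<Sum>m\<in>keys E. \<Sum>m'\<in>keys E'.
     rconst (lookup E m) * mon s m * (rconst (lookup E' m') * mon s m'))"
    by (simp add: lsubst_sum mon_add[OF assms] mult_ac)
  then show ?thesis
    by (simp add: lsubst_mon sum_product)
qed

lemma to_fract_single_powi:
  "to_fract (single (single v k) (1::'k::idom)) =
   to_fract (single (single (v :: 'i var) (1::int)) 1) powi k"
proof -
  let ?X = "\<lambda>k. to_fract (single (single v k) (1::'k))"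
  have add: "?X (a + b) = ?X a * ?X b" for a b
    by (simp add: single_add mult_single flip: to_fract_mult)
  have nat: "?X (int n) = ?X 1 ^ n" for n
    by (induction n) (simp_all add: add)
  have "?X (- int n) * ?X (int n) = 1" for n
    by (simp flip: add)
  then have "?X (- int n) = inverse (?X 1 ^ n)" for n
    using nat by (metis inverse_unique mult.commute)
  then show ?thesis
    using nat[of "nat k"] \<open>\<And>n. ?X (- int n) = inverse (?X 1 ^ n)\<close>[of "nat (- k)"]
    by (cases "k \<ge> 0") (auto simp: power_int_def power_inverse)
qed

lemma to_fract_single_mon:
  "to_fract (single m (1::'k::idom)) = mon (case_var rvar) m"
proof -
  have sum: "to_fract (single (\<Sum>v\<in>A. f v) (1::'k)) = (\<Prod>v\<in>A. to_fract (single (f v) 1))"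
    for f :: "'i var \<Rightarrow> 'i var \<Rightarrow>\<^sub>0 int" and A
  proof (induction A rule: infinite_finite_induct)
    case (insert x F)
    have "single (f x + sum f F) (1::'k) = single (f x) 1 * single (sum f F) 1"
      by (simp add: mult_single)
    with insert show ?case by simp
  qed auto
  have "to_fract (single m (1::'k)) =
    (\<Prod>v\<in>keys m. to_fract (single (single v (lookup m v)) (1::'k)))"
    using sum[of "\<lambda>v. single v (lookup m v)" "keys m"]
    by (simp add: poly_mapping_sum_single)
  also have "\<dots> = mon (case_var rvar) m"
    unfolding mon_def
    by (intro prod.cong refl, subst to_fract_single_powi) (simp add: rvar_def lvar_def split: var.split)
  finally show ?thesis .
qed

lemma lsubst_rvar: "lsubst (case_var rvar) E = to_fract E"
proof -
  have *: "to_fract (single m c) = rconst c * mon (case_var rvar) m" for m and c :: 'b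
    by (simp add: rconst_def lconst_def mult_single flip: to_fract_single_mon to_fract_mult)
  show ?thesis
    by (subst (2) poly_mapping_sum_single[symmetric]) (simp add: lsubst_mon *)
qed

lemma rvar_nonzero [simp]: "rvar i a \<noteq> 0"
  by (simp add: rvar_def lvar_def single_eq_0_iff)

text \<open>One-term Laurent polynomials are compared by their supports. The later genericity claims
  (the points of a specialization are distinct, a linear form or an arrow factor does not vanish)
  reduce to this.\<close>

lemma rconst_rvar_eq_iff:
  assumes "c \<noteq> 0"
  shows "rconst c * rvar i a = rconst c' * rvar j b \<longleftrightarrow> i = j \<and> a = b \<and> c = c'"
proof -
  have *: "rconst c * rvar i a = to_fract (single (single (Var i a) 1) c)" for c i a
    by (simp add: rconst_def rvar_def lconst_def lvar_def mult_single flip: to_fract_mult)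
  have "single (single (Var i a) (1::int)) c = single (single (Var j b) 1) c'
      \<longleftrightarrow> i = j \<and> a = b \<and> c = c'" (is "?l = ?r \<longleftrightarrow> _")
  proof
    assume eq: "?l = ?r"
    then have "keys ?l = keys ?r" by simp
    then have keq: "single (Var i a) (1::int) = single (Var j b) 1"
      using assms by (auto split: if_splits)
    then have "keys (single (Var i a) (1::int)) = keys (single (Var j b) (1::int))"
      by simp
    then have "i = j \<and> a = b" by simp
    with eq show "i = j \<and> a = b \<and> c = c'"
      by (auto simp: single_eq_single_iff)
  qed auto
  then show ?thesis by (simp add: *)
qed

abbreviation evl :: "('i \<Rightarrow> nat \<Rightarrow> ('i, 'k::idom) ratfun) \<Rightarrow> ('i, 'k) laurent \<Rightarrow> ('i, 'k) ratfun"
  where "evl p \<equiv> lsubst (case_var p)"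

lemma evl_mult:
  assumes "\<And>i a. p i a \<noteq> 0"
  shows "evl p (E * E') = evl p E * evl p E'"
  by (rule lsubst_mult) (use assms in \<open>auto split: var.split\<close>)

section \<open>The coefficient ring, and Laurent polynomials as functions of points\<close>

locale quiver_shuffle =
  fixes Q :: "('i, 'e) pre_digraph" and t :: "'e \<Rightarrow> 'k::field_char_0" and q :: 'k
  assumes fin: "fin_digraph Q"
    and t_nz: "\<And>\<alpha>. \<alpha> \<in> arcs Q \<Longrightarrow> t \<alpha> \<noteq> 0"
    and q_nz: "q \<noteq> 0"
    and q_power: "\<And>n::nat. n > 0 \<Longrightarrow> q ^ n \<noteq> 1"
    and loops: "\<And>\<alpha>. \<alpha> \<in> arcs Q \<Longrightarrow> tail Q \<alpha> = head Q \<alpha> \<Longrightarrow> t \<alpha> \<notin> range (\<lambda>k::int. q powi k)"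
begin

abbreviation R where "R \<equiv> coeff_ring Q t q"
abbreviation LR where "LR \<equiv> laurent_ring Q t q"
abbreviation SL where "SL \<equiv> sym_laurent Q t q"
abbreviation V where "V \<equiv> verts Q"

lemma finV: "finite V" and finA: "finite (arcs Q)"
  using fin by (auto simp: fin_digraph_def fin_digraph_axioms_def)

lemma tail_V: "\<alpha> \<in> arcs Q \<Longrightarrow> tail Q \<alpha> \<in> V" and head_V: "\<alpha> \<in> arcs Q \<Longrightarrow> head Q \<alpha> \<in> V"
  using fin by (auto simp: fin_digraph_def wf_digraph_def)

lemma R_subring: "is_subring R"
  unfolding coeff_ring_def
  by (rule hull_in) (auto simp: is_subring_def)

lemma R_1: "1 \<in> R" and R_diff: "a \<in> R \<Longrightarrow> b \<in> R \<Longrightarrow> a - b \<in> R" and R_mult: "a \<in> R \<Longrightarrow> b \<in> R \<Longrightarrow> a * b \<in> R"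
  using R_subring by (auto simp: is_subring_def)

lemma R_0: "0 \<in> R" using R_diff[OF R_1 R_1] by simp

lemma R_uminus: "a \<in> R \<Longrightarrow> - a \<in> R" using R_diff[OF R_0, of a] by simp

lemma R_add: "a \<in> R \<Longrightarrow> b \<in> R \<Longrightarrow> a + b \<in> R" using R_diff[of a "- b"] R_uminus by simp

lemma R_power: "a \<in> R \<Longrightarrow> a ^ n \<in> R"
  by (induction n) (auto intro: R_1 R_mult)

lemma R_gens: "q \<in> R" "inverse q \<in> R" "\<alpha> \<in> arcs Q \<Longrightarrow> t \<alpha> \<in> R" "\<alpha> \<in> arcs Q \<Longrightarrow> inverse (t \<alpha>) \<in> R"
  unfolding coeff_ring_def by (auto intro!: hull_inc)

lemma R_q_powi: "q powi k \<in> R"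
  by (simp add: power_int_def R_power R_gens)

lemma q_powi_nz [simp]: "q powi k \<noteq> 0"
  using q_nz by simp

lemma q_powi_eq_1_iff: "q powi k = 1 \<longleftrightarrow> k = 0"
  using q_power[of "nat k"] q_power[of "nat (- k)"] q_nz
  by (cases "k = 0"; cases "k > 0") (auto simp: power_int_def power_inverse)

lemma q_powi_eq_iff [simp]: "q powi k = q powi l \<longleftrightarrow> k = l"
proof -
  have "q powi k = q powi l \<longleftrightarrow> q powi (k - l) = 1"
    using q_nz by (simp add: power_int_diff)
  then show ?thesis by (simp add: q_powi_eq_1_iff)
qed

definition lvars :: "('i \<Rightarrow> nat) \<Rightarrow> 'i var set"
  where "lvars n = {Var i a | i a. i \<in> V \<and> a \<in> {1..n i}}"

lemma LR_iff: "E \<in> LR n \<longleftrightarrow> (\<forall>m. lookup E m \<in> R) \<and> (\<forall>m\<in>keys E. keys m \<subseteq> lvars n)"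
  by (auto simp: laurent_ring_def lvars_def)

lemma LR_single: "c \<in> R \<Longrightarrow> keys m \<subseteq> lvars n \<Longrightarrow> single m c \<in> LR n"
  by (auto simp: LR_iff lookup_single when_def R_0 split: if_splits)

lemma LR_0: "0 \<in> LR n" by (simp add: LR_iff R_0)

lemma LR_add: "E \<in> LR n \<Longrightarrow> E' \<in> LR n \<Longrightarrow> E + E' \<in> LR n"
  using keys_add[of E E'] by (auto simp: LR_iff lookup_add R_add dest!: subsetD)

lemma LR_sum: "(\<And>x. x \<in> A \<Longrightarrow> f x \<in> LR n) \<Longrightarrow> sum f A \<in> LR n"
  by (induction A rule: infinite_finite_induct) (auto intro: LR_add LR_0)

lemma LR_mult:
  assumes "E \<in> LR n" "E' \<in> LR n"
  shows "E * E' \<in> LR n"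
proof -
  have "E * E' = (\<Sum>m\<in>keys E. \<Sum>m'\<in>keys E'.
     single (m + m') (lookup E m * lookup E' m'))"
    by (subst (1 2) poly_mapping_sum_single[symmetric]) (simp add: sum_product mult_single)
  also have "\<dots> \<in> LR n"
    using assms by (intro LR_sum LR_single order.trans[OF keys_add]) (auto simp: LR_iff R_mult)
  finally show ?thesis .
qed

text \<open>Laurent polynomials over \<open>R\<close> are handled as functions of a point with nonzero coordinates.
  An identity between them only has to be checked at the generic point \<open>rvar\<close>, and then holds
  at every specialization.\<close>

definition lfun :: "('i \<Rightarrow> nat) \<Rightarrow> (('i \<Rightarrow> nat \<Rightarrow> ('i, 'k) ratfun) \<Rightarrow> ('i, 'k) ratfun) \<Rightarrow> bool"
  where "lfun n f \<longleftrightarrow> (\<exists>F\<in>LR n. \<forall>p. (\<forall>i a. p i a \<noteq> 0) \<longrightarrow> f p = evl p F)"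

lemma lfunE:
  assumes "lfun n f"
  obtains F where "F \<in> LR n" "\<And>p. (\<And>i a. p i a \<noteq> 0) \<Longrightarrow> f p = evl p F"
  using assms by (auto simp: lfun_def)

lemma lfun_evl: "E \<in> LR n \<Longrightarrow> lfun n (\<lambda>p. evl p E)"
  by (auto simp: lfun_def)

lemma lfun_cong: "(\<And>p. (\<And>i a. p i a \<noteq> 0) \<Longrightarrow> f p = g p) \<Longrightarrow> lfun n f \<longleftrightarrow> lfun n g"
  by (auto simp: lfun_def)

lemma lfun_const: "c \<in> R \<Longrightarrow> lfun n (\<lambda>p. rconst c)"
  unfolding lfun_def by (rule bexI[of _ "single 0 c"]) (auto intro: LR_single)

lemma lfun_0: "lfun n (\<lambda>p. 0)" and lfun_1: "lfun n (\<lambda>p. 1)"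
  using lfun_const[OF R_0] lfun_const[OF R_1] by simp_all

lemma lfun_add: "lfun n f \<Longrightarrow> lfun n g \<Longrightarrow> lfun n (\<lambda>p. f p + g p)"
  unfolding lfun_def by (metis LR_add lsubst_add)

lemma lfun_mult: "lfun n f \<Longrightarrow> lfun n g \<Longrightarrow> lfun n (\<lambda>p. f p * g p)"
  unfolding lfun_def by (metis LR_mult evl_mult)

lemma lfun_uminus: "lfun n f \<Longrightarrow> lfun n (\<lambda>p. - f p)"
  using lfun_mult[OF lfun_const[OF R_uminus[OF R_1]], of n f] by simp

lemma lfun_diff: "lfun n f \<Longrightarrow> lfun n g \<Longrightarrow> lfun n (\<lambda>p. f p - g p)"
  using lfun_add[of n f "\<lambda>p. - g p"] lfun_uminus by simp

lemma lfun_sum: "(\<And>x. x \<in> A \<Longrightarrow> lfun n (f x)) \<Longrightarrow> lfun n (\<lambda>p. \<Sum>x\<in>A. f x p)"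
  by (induction A rule: infinite_finite_induct) (auto intro: lfun_add lfun_0)

lemma lfun_prod: "(\<And>x. x \<in> A \<Longrightarrow> lfun n (f x)) \<Longrightarrow> lfun n (\<lambda>p. \<Prod>x\<in>A. f x p)"
  by (induction A rule: infinite_finite_induct) (auto intro: lfun_mult lfun_1)

lemma lfun_power: "lfun n f \<Longrightarrow> lfun n (\<lambda>p. f p ^ k)"
  by (induction k) (auto intro: lfun_mult lfun_1)

lemma lfun_var_powi:
  assumes "i \<in> V" "a \<in> {1..n i}"
  shows "lfun n (\<lambda>p. p i a powi k)"
  unfolding lfun_def
  by (rule bexI[of _ "single (single (Var i a) k) 1"])
    (use assms in \<open>auto intro!: LR_single R_1 simp: lvars_def split: if_splits\<close>)

lemma lfun_var: "i \<in> V \<Longrightarrow> a \<in> {1..n i} \<Longrightarrow> lfun n (\<lambda>p. p i a)"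
  using lfun_var_powi[of i a n 1] by simp

lemma lfun_var_inverse: "i \<in> V \<Longrightarrow> a \<in> {1..n i} \<Longrightarrow> lfun n (\<lambda>p. inverse (p i a))"
  using lfun_var_powi[of i a n "-1"] by (simp add: power_int_minus)

lemma lfun_divide_var: "lfun n f \<Longrightarrow> i \<in> V \<Longrightarrow> a \<in> {1..n i} \<Longrightarrow> lfun n (\<lambda>p. f p / p i a)"
  unfolding divide_inverse by (intro lfun_mult lfun_var_inverse)

lemma lfun_q_powi: "lfun n (\<lambda>p. rconst (q powi k))"
  by (intro lfun_const R_q_powi)

lemma lfun_eqI:
  assumes "lfun n f" "lfun n' g" "f rvar = g rvar" "\<And>i a. p i a \<noteq> 0"
  shows "f p = g p"
proof -
  from assms(1) obtain F where F: "F \<in> LR n" "\<And>p. (\<And>i a. p i a \<noteq> 0) \<Longrightarrow> f p = evl p F"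
    by (rule lfunE) blast
  from assms(2) obtain G where G: "G \<in> LR n'" "\<And>p. (\<And>i a. p i a \<noteq> 0) \<Longrightarrow> g p = evl p G"
    by (rule lfunE) blast
  have "F = G" using assms(3) F(2)[of rvar] G(2)[of rvar] by (simp add: lsubst_rvar)
  then show ?thesis using F(2)[of p] G(2)[of p] assms(4) by simp
qed

text \<open>Coordinates may be identified and multiplied by powers of q; since q and its inverse lie
  in \<open>R\<close>, the new coefficients do as well. The specializations to segments are of this
  shape.\<close>

lemma lfun_subst:
  assumes "lfun m f"
    and "\<And>i a. i \<in> V \<Longrightarrow> a \<in> {1..m i} \<Longrightarrow> r i a \<in> {1..n i}"
  shows "lfun n (\<lambda>p. f (\<lambda>i a. rconst (q powi e i a) * p i (r i a)))"
proof -
  from assms(1) obtain F where F: "F \<in> LR m" "\<And>p. (\<And>i a. p i a \<noteq> 0) \<Longrightarrow> f p = evl p F"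
    by (rule lfunE) blast
  let ?p' = "\<lambda>p i a. rconst (q powi e i a) * p i (r i a)"
  have *: "lfun n (\<lambda>p. evl (?p' p) F)"
    unfolding lsubst_mon mon_def
  proof (intro lfun_sum lfun_mult lfun_prod lfun_const)
    show "lookup F x \<in> R" for x using F by (simp add: LR_iff)
    fix x v assume x: "x \<in> keys F" "v \<in> keys x"
    obtain i a where v: "v = Var i a" by (cases v)
    have "i \<in> V" "a \<in> {1..m i}" using F(1) x v by (auto simp: LR_iff lvars_def)
    then show "lfun n (\<lambda>p. (case v of Var i a \<Rightarrow> ?p' p i a) powi lookup x v)"
      using assms(2)[of i a]
      by (simp add: v power_int_mult_distrib power_int_mult[symmetric] lfun_mult lfun_var_powi lfun_q_powi flip: rconst_powi)
  qed
  show ?thesis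
    by (subst lfun_cong[of _ "\<lambda>p. evl (?p' p) F"]) (use F(2) * q_nz in auto)
qed

lemma lfun_rename:
  assumes "lfun m f" and "\<And>i a. i \<in> V \<Longrightarrow> a \<in> {1..m i} \<Longrightarrow> r i a \<in> {1..n i}"
  shows "lfun n (\<lambda>p. f (\<lambda>i a. p i (r i a)))"
  using lfun_subst[OF assms, where e = "\<lambda>_ _. 0"] by simp

lemma lfun_local:
  assumes "lfun n f" "\<And>i a. i \<in> V \<Longrightarrow> a \<in> {1..n i} \<Longrightarrow> p i a = p' i a"
    "\<And>i a. p i a \<noteq> 0" "\<And>i a. p' i a \<noteq> 0"
  shows "f p = f p'"
proof -
  from assms(1) obtain F where F: "F \<in> LR n" "\<And>p. (\<And>i a. p i a \<noteq> 0) \<Longrightarrow> f p = evl p F"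
    by (rule lfunE) blast
  have "mon (case_var p) m = mon (case_var p') m" if "m \<in> keys F" for m
    unfolding mon_def using F(1) that assms(2)
    by (intro prod.cong refl) (force simp: LR_iff lvars_def split: var.splits)
  then have "evl p F = evl p' F" by (simp add: lsubst_mon)
  then show ?thesis using F(2) assms(3,4) by simp
qed

subsection \<open>Divisibility by linear forms\<close>

lemma lfun_powi_diff:
  assumes "i \<in> V" "a \<in> {1..n i}" "b \<in> {1..n i}"
  shows "\<exists>g. lfun n g \<and> (\<forall>p. (\<forall>i a. p i a \<noteq> 0) \<longrightarrow>
    p i a powi k - (rconst (q powi c) * p i b) powi k = (p i a - rconst (q powi c) * p i b) * g p)"
proof -
  let ?y = "\<lambda>p :: 'i \<Rightarrow> nat \<Rightarrow> ('i, 'k) ratfun. rconst (q powi c) * p i b"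
  define h where "h m p = (\<Sum>j<m. ?y p ^ (m - Suc j) * p i a ^ j)" for m :: nat and p :: "'i \<Rightarrow> nat \<Rightarrow> ('i, 'k) ratfun"
  have h: "p i a ^ m - ?y p ^ m = (p i a - ?y p) * h m p" for m p
    unfolding h_def by (rule power_diff_sumr2)
  have lh: "lfun n (h m)" for m
    unfolding h_def[abs_def] by (intro lfun_sum lfun_mult lfun_power lfun_var lfun_q_powi assms)
  show ?thesis
  proof (cases "k \<ge> 0")
    case True
    then show ?thesis using h lh by (intro exI[of _ "h (nat k)"]) (auto simp: power_int_def)
  next
    case False
    \<comment> \<open>With m = -k > 0 one has x^k - y^k = -(x^m - y^m) x^k y^k, which reduces a
      negative exponent to a positive one.\<close>
    let ?g = "\<lambda>p. - (h (nat (- k)) p * p i a powi k * (rconst (q powi (c * k)) * p i b powi k))"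
    have "p i a powi k - ?y p powi k = (p i a - ?y p) * ?g p" if "\<forall>i a. p i a \<noteq> 0" for p
    proof -
      have nz: "?y p \<noteq> 0" "p i a \<noteq> 0" using that q_nz by auto
      have yk: "?y p powi k = rconst (q powi (c * k)) * p i b powi k"
        by (simp add: power_int_mult_distrib power_int_mult rconst_powi)
      let ?m = "nat (- k)"
      have pk: "x powi k = inverse (x ^ ?m)" for x :: "('i,'k) ratfun"
        using False by (simp add: power_int_def power_inverse)
      have "p i a powi k - ?y p powi k = - (p i a ^ ?m - ?y p ^ ?m) * p i a powi k * ?y p powi k"
        using nz by (simp add: pk field_simps)
      also have "\<dots> = (p i a - ?y p) * ?g p"
        unfolding h yk by (simp add: algebra_simps)
      finally show ?thesis .
    qed
    moreover have "lfun n ?g"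
      by (intro lfun_uminus lfun_mult lh lfun_var_powi lfun_q_powi assms)
    ultimately show ?thesis by blast
  qed
qed

text \<open>The generic point of the hyperplane z_ia = q^c z_ib: the coordinate z_ia is eliminated
  and all others stay independent. Vanishing there is the test for divisibility by the linear
  form.\<close>

definition generic_point :: "'i \<Rightarrow> nat \<Rightarrow> nat \<Rightarrow> int \<Rightarrow> 'i \<Rightarrow> nat \<Rightarrow> ('i, 'k) ratfun"
  where "generic_point i a b c = (\<lambda>j d. if j = i \<and> d = a then rconst (q powi c) * rvar i b else rvar j d)"

lemma generic_point_nz [simp]: "generic_point i a b c j d \<noteq> 0"
  using q_nz by (simp add: generic_point_def)

text \<open>\<open>sp\<close> retracts onto the hyperplane. \<open>f (sp p)\<close> vanishes
  identically because it vanishes at the generic point, so f is the sum of its coefficients times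
  the differences of the monomials at p and at \<open>sp p\<close>, and each difference is a
  multiple of the form with quotient over \<open>R\<close>.\<close>

lemma lfun_dvd_linear:
  assumes f: "lfun n f" and ab: "i \<in> V" "a \<in> {1..n i}" "b \<in> {1..n i}" "a \<noteq> b"
    and z: "f (generic_point i a b c) = 0"
  shows "\<exists>g. lfun n g \<and> (\<forall>p. (\<forall>i a. p i a \<noteq> 0) \<longrightarrow> f p = (p i a - rconst (q powi c) * p i b) * g p)"
proof -
  from f obtain F where F: "F \<in> LR n" "\<And>p. (\<And>i a. p i a \<noteq> 0) \<Longrightarrow> f p = evl p F"
    by (rule lfunE) blast
  define sp where "sp p = (\<lambda>j d. if j = i \<and> d = a then rconst (q powi c) * p i b else p j d)"
    for p :: "'i \<Rightarrow> nat \<Rightarrow> ('i,'k) ratfun"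
  have sp_nz: "sp p j d \<noteq> 0" if "\<forall>i a. p i a \<noteq> 0" for p j d using that q_nz by (auto simp: sp_def)
  have lsp: "lfun n (\<lambda>p. f (sp p))"
  proof -
    have "sp = (\<lambda>p j d. rconst (q powi (if j = i \<and> d = a then c else 0)) * p j (if j = i \<and> d = a then b else d))"
      by (auto simp: sp_def fun_eq_iff)
    moreover have "lfun n (\<lambda>p. f ((\<lambda>p j d. rconst (q powi (if j = i \<and> d = a then c else 0)) * p j (if j = i \<and> d = a then b else d)) p))"
      using ab by (intro lfun_subst[OF f]) auto
    ultimately show ?thesis by metis
  qed
  have spz: "f (sp p) = 0" if "\<forall>i a. p i a \<noteq> 0" for p
    by (rule lfun_eqI[OF lsp lfun_0[of n]]) (use that z in \<open>auto simp: sp_def generic_point_def[abs_def]\<close>)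
  have "\<forall>m\<in>keys F. \<exists>g. lfun n g \<and> (\<forall>p. (\<forall>i a. p i a \<noteq> 0) \<longrightarrow>
     mon (case_var p) m - mon (case_var (sp p)) m = (p i a - rconst (q powi c) * p i b) * g p)"
  proof
    fix m assume m: "m \<in> keys F"
    let ?S = "insert (Var i a) (keys m)"
    let ?T = "keys m - {Var i a}"
    let ?k = "lookup m (Var i a)"
    obtain g where g: "lfun n g" "\<And>p. (\<forall>i a. p i a \<noteq> 0) \<Longrightarrow>
       p i a powi ?k - (rconst (q powi c) * p i b) powi ?k = (p i a - rconst (q powi c) * p i b) * g p"
      using lfun_powi_diff[of i a n b ?k c] ab by auto
    let ?h = "\<lambda>p. (\<Prod>v\<in>?T. case_var p v powi lookup m v)"
    have mon_p: "mon (case_var p) m = p i a powi ?k * ?h p" for p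
      by (subst mon_superset[of ?S]) (auto simp: prod.insert_remove)
    have "mon (case_var p) m - mon (case_var (sp p)) m = (p i a - rconst (q powi c) * p i b) * (g p * ?h p)"
      if nz: "\<forall>i a. p i a \<noteq> 0" for p
    proof -
      have "?h (sp p) = ?h p"
        by (intro prod.cong refl) (auto simp: sp_def split: var.splits)
      moreover have "sp p i a = rconst (q powi c) * p i b" by (simp add: sp_def)
      ultimately show ?thesis using g(2)[OF nz] by (simp add: mon_p flip: left_diff_distrib mult.assoc)
    qed
    moreover have "lfun n (\<lambda>p. g p * ?h p)"
    proof (intro lfun_mult g lfun_prod)
      fix v assume "v \<in> ?T"
      with F(1) m show "lfun n (\<lambda>p. case_var p v powi lookup m v)"
        by (cases v) (force simp: LR_iff lvars_def intro!: lfun_var_powi)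
    qed
    ultimately show "\<exists>g. lfun n g \<and> (\<forall>p. (\<forall>i a. p i a \<noteq> 0) \<longrightarrow>
     mon (case_var p) m - mon (case_var (sp p)) m = (p i a - rconst (q powi c) * p i b) * g p)" by (intro exI conjI) auto
  qed
  then obtain g where g: "\<And>m. m \<in> keys F \<Longrightarrow> lfun n (g m)"
    "\<And>m p. m \<in> keys F \<Longrightarrow> (\<forall>i a. p i a \<noteq> 0) \<Longrightarrow> mon (case_var p) m - mon (case_var (sp p)) m = (p i a - rconst (q powi c) * p i b) * g m p"
    by metis
  let ?G = "\<lambda>p. \<Sum>m\<in>keys F. rconst (lookup F m) * g m p"
  have "lfun n ?G"
    using F(1) by (intro lfun_sum lfun_mult lfun_const g) (auto simp: LR_iff)
  moreover have "f p = (p i a - rconst (q powi c) * p i b) * ?G p" if nz: "\<forall>i a. p i a \<noteq> 0" for p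
  proof -
    have "f p = f p - f (sp p)" using spz[OF nz] by simp
    also have "\<dots> = (\<Sum>m\<in>keys F. rconst (lookup F m) * (mon (case_var p) m - mon (case_var (sp p)) m))"
      using F(2)[of p] F(2)[of "sp p"] sp_nz[OF nz] nz
      by (simp add: lsubst_mon sum_subtractf right_diff_distrib)
    also have "\<dots> = (p i a - rconst (q powi c) * p i b) * ?G p"
      using g(2)[OF _ nz] by (simp add: sum_distrib_left mult_ac)
    finally show ?thesis .
  qed
  ultimately show ?thesis by blast
qed

lemma linear_form_nz:
  assumes "a \<noteq> b"
  shows "rvar i a - rconst (q powi c) * rvar i b \<noteq> (0 :: ('i, 'k) ratfun)"
  using rconst_rvar_eq_iff[of "1::'k" i a "q powi c" i b] assms by simp

text \<open>The factor l may vanish at the point p of interest. Cancelling takes place at the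
  generic point, where l is a nonzero element of a field, and the result is transported to
  p.\<close>

lemma lfun_cancel:
  assumes "lfun n l" "lfun n f" "lfun n g" "l rvar \<noteq> 0"
    and "\<And>p. (\<And>i a. p i a \<noteq> 0) \<Longrightarrow> l p * f p = l p * g p" and "\<And>i a. p i a \<noteq> 0"
  shows "f p = g p"
  by (rule lfun_eqI[OF assms(2,3)]) (use assms(4) assms(5)[of rvar] assms(6) in auto)

text \<open>No integrality is lost: the coefficients of the quotient stay in \<open>R\<close>, because the linear
  forms have unit coefficients.\<close>

lemma lfun_dvd_linear_prod:
  assumes "finite X"
    and forms: "\<And>x. x \<in> X \<Longrightarrow> i x \<in> V \<and> a x \<in> {1..n (i x)} \<and> b x \<in> {1..n (i x)} \<and> a x \<noteq> b x"
    and C: "lfun n C" "\<And>x. x \<in> X \<Longrightarrow> C (generic_point (i x) (a x) (b x) (c x)) \<noteq> 0"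
    and "lfun n F" "lfun n G"
    and eq: "\<And>p. (\<And>i a. p i a \<noteq> 0) \<Longrightarrow>
      F p * (\<Prod>x\<in>X. p (i x) (a x) - rconst (q powi c x) * p (i x) (b x)) = C p * G p"
  shows "\<exists>H. lfun n H \<and> (\<forall>p. (\<forall>i a. p i a \<noteq> 0) \<longrightarrow>
      G p = (\<Prod>x\<in>X. p (i x) (a x) - rconst (q powi c x) * p (i x) (b x)) * H p)"
  using assms(1,2,4,6,7)
proof (induction X arbitrary: G rule: finite_induct)
  case empty
  then show ?case by auto
next
  case (insert x X)
  let ?l = "\<lambda>x p. p (i x) (a x) - rconst (q powi c x) * p (i x) (b x)"
  let ?pt = "generic_point (i x) (a x) (b x) (c x)"
  have x: "i x \<in> V" "a x \<in> {1..n (i x)}" "b x \<in> {1..n (i x)}" "a x \<noteq> b x"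
    using insert.prems(1)[of x] by auto
  have ll: "lfun n (?l x)"
    by (intro lfun_diff lfun_mult lfun_var lfun_q_powi x)
  \<comment> \<open>At the generic point of the hyperplane of x the left side of the hypothesis
    vanishes and \<open>C\<close> does not, so \<open>G\<close> vanishes and the form of x splits
    off. After cancelling it, the hypothesis holds for \<open>X\<close> alone. Forms may repeat, as
    \<open>X\<close> is only an index set.\<close>
  have "?l x ?pt = 0" using x by (simp add: generic_point_def)
  then have "C ?pt * G ?pt = 0"
    using insert.prems(4)[of ?pt] insert.hyps by simp
  then have "G ?pt = 0" using insert.prems(2)[of x] by simp
  from lfun_dvd_linear[OF insert.prems(3) x this] obtain g
    where g: "lfun n g" "\<And>p. \<forall>i a. p i a \<noteq> 0 \<Longrightarrow> G p = ?l x p * g p" by blast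
  have cancel: "F p * (\<Prod>x\<in>X. ?l x p) = C p * g p" if "\<And>i a. p i a \<noteq> 0" for p
  proof (rule lfun_cancel[OF ll _ _ _ _ that])
    show "lfun n (\<lambda>p. F p * (\<Prod>x\<in>X. ?l x p))"
      using insert.prems(1) by (intro lfun_mult lfun_prod lfun_diff lfun_var lfun_q_powi \<open>lfun n F\<close>) auto
    show "lfun n (\<lambda>p. C p * g p)" by (intro lfun_mult C g)
    show "?l x rvar \<noteq> 0" using linear_form_nz x by blast
    show "?l x p * (F p * (\<Prod>x\<in>X. ?l x p)) = ?l x p * (C p * g p)" if "\<And>i a. p i a \<noteq> 0" for p
    proof -
      have "F p * (?l x p * (\<Prod>x\<in>X. ?l x p)) = C p * G p"
        using insert.prems(4)[where p = p, OF that] insert.hyps by simp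
      then show ?thesis using g(2)[of p] that by (simp add: mult_ac)
    qed
  qed
  from insert.IH[OF _ _ g(1) cancel] insert.prems obtain H
    where H: "lfun n H" "\<And>p. \<forall>i a. p i a \<noteq> 0 \<Longrightarrow> g p = (\<Prod>x\<in>X. ?l x p) * H p" by (auto 4 3)
  show ?case
    using insert.hyps H g(2) by (intro exI[of _ H]) (simp add: mult.assoc)
qed

end

section \<open>Evaluation of symmetric Laurent polynomials at indexed points\<close>

text \<open>The points at which a symmetric Laurent polynomial is evaluated are indexed by arbitrary
  finite sets \<open>J i\<close>; by symmetry the chosen enumeration of \<open>J i\<close> is immaterial.\<close>

definition enum_bij :: "nat \<Rightarrow> 'b set \<Rightarrow> nat \<Rightarrow> 'b"
  where "enum_bij n J = (SOME f. bij_betw f {1..n} J)"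

lemma enum_bij: "finite J \<Longrightarrow> card J = n \<Longrightarrow> bij_betw (enum_bij n J) {1..n} J"
  unfolding enum_bij_def using ex_bij_betw_nat_finite_1[of J] by (metis someI_ex)

definition evJ :: "('i \<Rightarrow> nat) \<Rightarrow> ('i, 'k::idom) laurent \<Rightarrow> ('i \<Rightarrow> 'b set) \<Rightarrow> ('i \<Rightarrow> 'b \<Rightarrow> ('i, 'k) ratfun) \<Rightarrow> ('i, 'k) ratfun"
  where "evJ n E J p = evl (\<lambda>i a. p i (enum_bij (n i) (J i) a)) E"

definition idx :: "('i \<Rightarrow> nat) \<Rightarrow> ('i \<Rightarrow> 'b set) \<Rightarrow> bool"
  where "idx n J \<longleftrightarrow> (\<forall>i. finite (J i) \<and> card (J i) = n i)"

lemma idx_enum: "idx n J \<Longrightarrow> bij_betw (enum_bij (n i) (J i)) {1..n i} (J i)"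
  using enum_bij[of "J i" "n i"] by (simp add: idx_def del: One_nat_def)

lemma enum_mem: "idx n J \<Longrightarrow> Suc 0 \<le> a \<Longrightarrow> a \<le> n i \<Longrightarrow> enum_bij (n i) (J i) a \<in> J i"
  using idx_enum[of n J i] by (auto simp: bij_betw_def)

definition Subs :: "('i \<Rightarrow> nat) \<Rightarrow> ('i \<Rightarrow> 'b set) \<Rightarrow> ('i \<Rightarrow> 'b set) set"
  where "Subs n J = {A. \<forall>i. A i \<subseteq> J i \<and> card (A i) = n i}"

lemma Subs_idx:
  assumes "idx (\<lambda>i. n i + n' i) J" "A \<in> Subs n J"
  shows "idx n A" "idx n' (\<lambda>i. J i - A i)"
proof -
  have *: "A i \<subseteq> J i" "card (A i) = n i" "finite (J i)" "card (J i) = n i + n' i" for i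
    using assms by (auto simp: Subs_def idx_def)
  then show "idx n A" unfolding idx_def by (meson finite_subset)
  have "card (J i - A i) = n' i" for i
    using *[of i] finite_subset[of "A i" "J i"] by (subst card_Diff_subset) auto
  then show "idx n' (\<lambda>i. J i - A i)" using * by (auto simp: idx_def)
qed

text \<open>Composing with one fixed permutation that carries {1..n} to B matches the permutations
  preserving {1..n} with those sending it to B. So all classes have the same size, and fact N is
  divided equally among them.\<close>

lemma card_permutes_image:
  assumes "B \<subseteq> {1..N}" "card B = n" "n \<le> N"
  shows "card {s. s permutes {1..N} \<and> s ` {1..n} = B} = fact n * fact (N - n)"
proof -
  let ?F = "\<lambda>B. {s. s permutes {1..N} \<and> s ` {1..n} = B}"
  have card_eq: "card (?F B) = card (?F {1..n})" if "B \<subseteq> {1..N}" "card B = n" for B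
  proof -
    have "finite B" using that by (auto intro: finite_subset)
    have g: "bij_betw (enum_bij n B) {1..n} B"
      by (rule enum_bij) (use \<open>finite B\<close> that in auto)
    have "card ({1..N} - {1..n}) = card ({1..N} - B)"
      using that \<open>finite B\<close> assms(3) by (simp add: card_Diff_subset)
    then obtain g' where g': "bij_betw g' ({1..N} - {1..n}) ({1..N} - B)"
      using finite_same_card_bij[of "{1..N} - {1..n}" "{1..N} - B"] by auto
    define s where "s x = (if x \<in> {1..n} then enum_bij n B x else if x \<in> {1..N} then g' x else x)" for x
    have "bij_betw s ({1..n} \<union> ({1..N} - {1..n})) (B \<union> ({1..N} - B))"
    proof (rule bij_betw_combine)
      show "bij_betw s {1..n} B"
        by (rule bij_betw_cong[THEN iffD1, OF _ g]) (simp add: s_def)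
      show "bij_betw s ({1..N} - {1..n}) ({1..N} - B)"
        by (rule bij_betw_cong[THEN iffD1, OF _ g']) (auto simp: s_def)
    qed auto
    moreover have "{1..n} \<union> ({1..N} - {1..n}) = {1..N}" "B \<union> ({1..N} - B) = {1..N}"
      using assms(3) that by auto
    ultimately have s: "s permutes {1..N}"
      using assms(3) by (intro bij_imp_permutes) (auto simp: s_def)
    have sB: "s ` {1..n} = B"
      using g by (simp add: s_def bij_betw_def)
    have "bij_betw ((\<circ>) s) (?F {1..n}) (?F B)"
    proof (rule bij_betwI[where g = "(\<circ>) (inv s)"])
      show "(\<circ>) s \<in> ?F {1..n} \<rightarrow> ?F B"
      proof
        fix r assume r: "r \<in> ?F {1..n}"
        have "(s \<circ> r) ` {1..n} = s ` (r ` {1..n})" by (rule image_comp[symmetric])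
        then show "s \<circ> r \<in> ?F B" using s sB r by (simp add: permutes_compose)
      qed
      show "(\<circ>) (inv s) \<in> ?F B \<rightarrow> ?F {1..n}"
      proof
        fix r assume r: "r \<in> ?F B"
        have "(inv s \<circ> r) ` {1..n} = inv s ` (r ` {1..n})" by (rule image_comp[symmetric])
        also have "\<dots> = inv s ` s ` {1..n}" using r sB by simp
        also have "\<dots> = {1..n}" using permutes_inj[OF s] by (simp add: image_inv_f_f)
        finally show "inv s \<circ> r \<in> ?F {1..n}" using r s by (simp add: permutes_compose permutes_inv)
      qed
    qed (use permutes_inv_o[OF s] in \<open>simp_all add: o_assoc\<close>)
    then show ?thesis by (simp add: bij_betw_same_card)
  qed
  have "fact N = card {s. s permutes {1..N}}"
    by (simp add: card_permutations)
  also have "{s. s permutes {1..N}} = (\<Union>B\<in>{B. B \<subseteq> {1..N} \<and> card B = n}. ?F B)"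
  proof -
    have "s ` {1..n} \<subseteq> {1..N} \<and> card (s ` {1..n}) = n" if "s permutes {1..N}" for s
      using image_mono[of "{1..n}" "{1..N}" s] permutes_image[OF that] permutes_inj_on[OF that, of "{1..n}"] assms(3)
      by (auto simp: card_image)
    then show ?thesis by blast
  qed
  also have "card \<dots> = (\<Sum>B\<in>{B. B \<subseteq> {1..N} \<and> card B = n}. card (?F B))"
    by (rule card_UN_disjoint) (auto intro: finite_subset[OF _ finite_permutations[of "{1..N}"]])
  also have "\<dots> = (N choose n) * card (?F {1..n})"
    using card_eq by (simp add: n_subsets)
  finally have "fact n * fact (N - n) * (N choose n) = (N choose n) * card (?F {1..n})"
    using binomial_fact_lemma[OF assms(3)] by simp
  then have "card (?F {1..n}) = fact n * fact (N - n)"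
    using assms(3) by simp
  then show ?thesis using card_eq[OF assms(1,2)] by simp
qed

lemma of_nat_ratfun_nz: "n \<noteq> 0 \<Longrightarrow> of_nat n \<noteq> (0 :: ('i, 'k::field_char_0) ratfun)"
proof -
  have "of_nat n = (rconst (of_nat n) :: ('i, 'k) ratfun)"
    by (induction n) auto
  then show "n \<noteq> 0 \<Longrightarrow> ?thesis" by simp
qed

text \<open>Used to see that an antisymmetric Laurent polynomial vanishes on the diagonal.\<close>

lemma ratfun_eq_uminus_iff: "x = - x \<longleftrightarrow> x = (0 :: ('i, 'k::field_char_0) ratfun)"
proof
  assume "x = - x"
  then have "x + x = 0" using add.right_inverse[of x] by argo
  then have "of_nat 2 * x = 0" by (simp only: of_nat_numeral mult_2)
  then show "x = 0" using of_nat_ratfun_nz[of 2] by (metis mult_eq_0_iff zero_neq_numeral)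
qed auto

context quiver_shuffle
begin

lemma SL_LR: "E \<in> SL n \<Longrightarrow> E \<in> LR n"
  by (simp add: sym_laurent_def)

lemma SL_evl:
  assumes "E \<in> SL n" "\<sigma> \<in> perm_families n" "\<And>i a. p i a \<noteq> 0"
  shows "evl (\<lambda>i a. p i (\<sigma> i a)) E = evl p E"
proof (rule lfun_eqI[where f = "\<lambda>p. evl (\<lambda>i a. p i (\<sigma> i a)) E" and g = "\<lambda>p. evl p E"])
  show "lfun n (\<lambda>p. evl (\<lambda>i a. p i (\<sigma> i a)) E)"
    using assms(2) by (intro lfun_rename[OF lfun_evl[OF SL_LR[OF assms(1)]]])
      (simp add: perm_families_def permutes_in_image del: atLeastAtMost_iff)
  show "lfun n (\<lambda>p. evl p E)" by (intro lfun_evl SL_LR assms)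
  show "evl (\<lambda>i a. rvar i (\<sigma> i a)) E = evl rvar E"
    using assms(1,2) by (auto simp: sym_laurent_def lsubst_rvar)
qed (use assms(3) in auto)

lemma SL_I:
  assumes "E \<in> LR n" "\<And>\<sigma>. \<sigma> \<in> perm_families n \<Longrightarrow> evl (\<lambda>i a. rvar i (\<sigma> i a)) E = evl rvar E"
  shows "E \<in> SL n"
  using assms by (auto simp: sym_laurent_def lsubst_rvar)

lemma evJ_eq:
  assumes "E \<in> SL n" "\<And>i. bij_betw (f i) {1..n i} (J i)" "\<And>i x. p i x \<noteq> 0"
  shows "evJ n E J p = evl (\<lambda>i a. p i (f i a)) E"
proof -
  have "idx n J" using assms(2) unfolding idx_def
    by (metis bij_betw_finite bij_betw_same_card card_atLeastAtMost diff_Suc_1 finite_atLeastAtMost)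
  let ?g = "\<lambda>i. enum_bij (n i) (J i)"
  have g: "bij_betw (?g i) {1..n i} (J i)" for i using \<open>idx n J\<close> by (rule idx_enum)
  \<comment> \<open>The two enumerations of \<open>J i\<close> differ by a permutation of the
    indices, to which the symmetry of \<open>E\<close> applies.\<close>
  define \<sigma> where "\<sigma> i a = (if a \<in> {1..n i} then inv_into {1..n i} (f i) (?g i a) else a)" for i a
  have f\<sigma>: "f i (\<sigma> i a) = ?g i a" if "a \<in> {1..n i}" for i a
  proof -
    have "?g i a \<in> f i ` {1..n i}" using that g[of i] assms(2)[of i] by (auto simp: bij_betw_def)
    then show ?thesis using that by (simp add: \<sigma>_def f_inv_into_f)
  qed
  have "bij_betw (\<sigma> i) {1..n i} {1..n i}" for i
  proof -
    have "bij_betw (inv_into {1..n i} (f i) \<circ> ?g i) {1..n i} {1..n i}"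
      using g[of i] bij_betw_inv_into[OF assms(2)[of i]] by (rule bij_betw_trans)
    then show ?thesis by (rule bij_betw_cong[THEN iffD1, rotated]) (simp add: \<sigma>_def)
  qed
  then have "\<sigma> \<in> perm_families n"
    unfolding perm_families_def by (auto intro!: bij_imp_permutes simp: \<sigma>_def)
  from SL_evl[OF assms(1) this, of "\<lambda>i a. p i (f i a)"] assms(3)
  have "evl (\<lambda>i a. p i (f i (\<sigma> i a))) E = evl (\<lambda>i a. p i (f i a)) E" by simp
  moreover have "evl (\<lambda>i a. p i (?g i a)) E = evl (\<lambda>i a. p i (f i (\<sigma> i a))) E"
    by (rule lfun_local[where f = "\<lambda>p. evl p E", OF lfun_evl[OF SL_LR[OF assms(1)]]])
      (use f\<sigma> assms(3) in auto)
  ultimately show ?thesis by (simp add: evJ_def)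
qed

lemma evJ_cong:
  assumes "E \<in> SL n" "idx n J" "\<And>i x. i \<in> V \<Longrightarrow> x \<in> J i \<Longrightarrow> p i x = p' i x" "\<And>i x. p i x \<noteq> 0" "\<And>i x. p' i x \<noteq> 0"
  shows "evJ n E J p = evJ n E J p'"
  unfolding evJ_def
  by (rule lfun_local[where f = "\<lambda>p. evl p E", OF lfun_evl[OF SL_LR[OF assms(1)]]])
    (use assms enum_mem[OF assms(2)] in auto)

lemma evJ_reindex:
  assumes "E \<in> SL n" "idx n J'" "\<And>i. bij_betw (h i) (J' i) (J i)"
    and "\<And>i x. i \<in> V \<Longrightarrow> x \<in> J' i \<Longrightarrow> p' i x = p i (h i x)"
    and "\<And>i x. p i x \<noteq> 0" "\<And>i x. p' i x \<noteq> 0"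
  shows "evJ n E J' p' = evJ n E J p"
proof -
  have "evJ n E J' p' = evJ n E J' (\<lambda>i x. p i (h i x))"
    by (rule evJ_cong) (use assms in auto)
  also have "\<dots> = evl (\<lambda>i a. p i (h i (enum_bij (n i) (J' i) a))) E"
    by (simp add: evJ_def)
  also have "\<dots> = evl (\<lambda>i a. p i ((h i \<circ> enum_bij (n i) (J' i)) a)) E" by simp
  also have "\<dots> = evJ n E J p"
    by (rule evJ_eq[symmetric, OF assms(1) bij_betw_trans[OF idx_enum[OF assms(2)] assms(3)] assms(5)])
  finally show ?thesis .
qed

lemma evJ_id:
  assumes "E \<in> SL n" "\<And>i a. p i a \<noteq> 0"
  shows "evJ n E (\<lambda>i. {1..n i}) p = evl p E"
  using evJ_eq[OF assms(1), of "\<lambda>i a. a" "\<lambda>i. {1..n i}" p] assms(2) by (auto simp: bij_betw_def)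

lemma lfun_evJ:
  assumes "E \<in> SL n" "idx n J" "\<And>i x. i \<in> V \<Longrightarrow> x \<in> J i \<Longrightarrow> r i x \<in> {1..m i}"
  shows "lfun m (\<lambda>y. evJ n E J (\<lambda>i x. rconst (q powi e i x) * y i (r i x)))"
  unfolding evJ_def
  by (rule lfun_subst[OF lfun_evl[OF SL_LR[OF assms(1)]]])
    (use assms(3) enum_mem[OF assms(2)] in auto)

lemma evJ_mult:
  assumes "\<And>i x. p i x \<noteq> 0"
  shows "evJ n (E * E') J p = evJ n E J p * evJ n E' J p"
  by (simp add: evJ_def evl_mult assms)

section \<open>The shuffle product as a sum over sets of points\<close>

abbreviation ze where "ze \<equiv> zeta Q t q"

text \<open>In \<open>shuf\<close> the symmetrization is a sum over the sets \<open>A i\<close> of variables that are given to the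
  first factor.  It agrees with the value of the product wherever the points of each colour
  are distinct, which holds at all specializations used below.\<close>

definition shuf_term ::
    "('i \<Rightarrow> nat) \<Rightarrow> ('i \<Rightarrow> nat) \<Rightarrow> ('i, 'k) laurent \<Rightarrow> ('i, 'k) laurent \<Rightarrow> ('i \<Rightarrow> 'b set) \<Rightarrow> ('i \<Rightarrow> 'b set) \<Rightarrow>
      ('i \<Rightarrow> 'b \<Rightarrow> ('i, 'k) ratfun) \<Rightarrow> ('i, 'k) ratfun"
  where "shuf_term n n' E E' A B p = evJ n E A p * evJ n' E' B p *
    (\<Prod>i\<in>V. \<Prod>j\<in>V. \<Prod>a\<in>A i. \<Prod>b\<in>B j. ze i j (p i a / p j b))"

definition shuf ::
    "('i \<Rightarrow> nat) \<Rightarrow> ('i \<Rightarrow> nat) \<Rightarrow> ('i, 'k) laurent \<Rightarrow> ('i, 'k) laurent \<Rightarrow> ('i \<Rightarrow> 'b set) \<Rightarrow>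
      ('i \<Rightarrow> 'b \<Rightarrow> ('i, 'k) ratfun) \<Rightarrow> ('i, 'k) ratfun"
  where "shuf n n' E E' J p = (\<Sum>A\<in>Subs n J. shuf_term n n' E E' A (\<lambda>i. J i - A i) p)"

lemma shuf_reindex:
  assumes E: "E \<in> SL n" "E' \<in> SL n'" and J': "idx (\<lambda>i. n i + n' i) J'"
    and h: "\<And>i. bij_betw (h i) (J' i) (J i)"
    and p: "\<And>i x. i \<in> V \<Longrightarrow> x \<in> J' i \<Longrightarrow> p' i x = p i (h i x)"
    and nz: "\<And>i x. p i x \<noteq> 0" "\<And>i x. p' i x \<noteq> 0"
  shows "shuf n n' E E' J' p' = shuf n n' E E' J p"
  unfolding shuf_def
proof (rule sum.reindex_bij_witness[where j = "\<lambda>A i. h i ` A i" and i = "\<lambda>A i. inv_into (J' i) (h i) ` A i"])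
  have inj: "inj_on (h i) (J' i)" and im: "h i ` J' i = J i" for i
    using h[of i] by (auto simp: bij_betw_def)
  have fin: "finite (J' i)" for i using J' by (simp add: idx_def)
  {
    fix A assume "A \<in> Subs n J'"
    then have A: "A i \<subseteq> J' i" "card (A i) = n i" for i by (auto simp: Subs_def)
    have injA: "inj_on (h i) (A i)" for i using inj A(1) inj_on_subset by blast
    show "(\<lambda>i. inv_into (J' i) (h i) ` h i ` A i) = A"
      using inv_into_image_cancel[OF inj A(1)] by auto
    show "(\<lambda>i. h i ` A i) \<in> Subs n J"
      using A im injA by (fastforce simp: Subs_def card_image)
    have diff: "J i - h i ` A i = h i ` (J' i - A i)" for i
      using inj_on_image_set_diff[OF inj[of i] _ A(1)[of i], of "J' i"] im[of i] by auto
    have idx: "idx n A" "idx n' (\<lambda>i. J' i - A i)" using Subs_idx[OF J' \<open>A \<in> Subs n J'\<close>] .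
    have "evJ n E A p' = evJ n E (\<lambda>i. h i ` A i) p"
      by (rule evJ_reindex[OF E(1) idx(1)]) (use p A(1) nz injA in \<open>auto simp: bij_betw_def\<close>)
    moreover have "evJ n' E' (\<lambda>i. J' i - A i) p' = evJ n' E' (\<lambda>i. J i - h i ` A i) p"
      unfolding diff
      by (rule evJ_reindex[OF E(2) idx(2)]) (use p nz inj_on_subset[OF inj] in \<open>auto simp: bij_betw_def\<close>)
    moreover have "(\<Prod>i\<in>V. \<Prod>j\<in>V. \<Prod>a\<in>A i. \<Prod>b\<in>J' j - A j. ze i j (p' i a / p' j b)) =
      (\<Prod>i\<in>V. \<Prod>j\<in>V. \<Prod>a\<in>h i ` A i. \<Prod>b\<in>J j - h j ` A j. ze i j (p i a / p j b))"
      unfolding diff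
    proof (intro prod.cong refl)
      fix i j assume ij: "i \<in> V" "j \<in> V"
      have "(\<Prod>a\<in>h i ` A i. \<Prod>b\<in>h j ` (J' j - A j). ze i j (p i a / p j b)) =
        (\<Prod>a\<in>A i. \<Prod>b\<in>J' j - A j. ze i j (p i (h i a) / p j (h j b)))"
        using inj_on_subset[OF inj[of j], of "J' j - A j"] injA[of i] by (simp add: prod.reindex)
      also have "\<dots> = (\<Prod>a\<in>A i. \<Prod>b\<in>J' j - A j. ze i j (p' i a / p' j b))"
        using p ij A(1)[of i] by (intro prod.cong refl) (auto dest: subsetD)
      finally show "(\<Prod>a\<in>A i. \<Prod>b\<in>J' j - A j. ze i j (p' i a / p' j b)) =
        (\<Prod>a\<in>h i ` A i. \<Prod>b\<in>h j ` (J' j - A j). ze i j (p i a / p j b))" ..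
    qed
    ultimately show "shuf_term n n' E E' (\<lambda>i. h i ` A i) (\<lambda>i. J i - h i ` A i) p =
      shuf_term n n' E E' A (\<lambda>i. J' i - A i) p'"
      by (simp add: shuf_term_def)
  }
  {
    fix A assume "A \<in> Subs n J"
    then have A: "A i \<subseteq> J i" "card (A i) = n i" for i by (auto simp: Subs_def)
    show "(\<lambda>i. h i ` inv_into (J' i) (h i) ` A i) = A"
      using image_inv_into_cancel[OF im A(1)] by auto
    have "inv_into (J' i) (h i) ` A i \<subseteq> J' i" for i
      using A(1)[of i] im[of i] inv_into_into[of _ "h i" "J' i"] by auto
    moreover have "card (inv_into (J' i) (h i) ` A i) = n i" for i
      using A im[of i] inj_on_inv_into[of "A i" "h i" "J' i"] by (simp add: card_image)
    ultimately show "(\<lambda>i. inv_into (J' i) (h i) ` A i) \<in> Subs n J'" by (auto simp: Subs_def)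
  }
qed

lemma degrees_D: "n \<in> degrees Q \<Longrightarrow> i \<notin> V \<Longrightarrow> n i = 0"
  by (auto simp: degrees_def)

lemma degrees_add: "n \<in> degrees Q \<Longrightarrow> n' \<in> degrees Q \<Longrightarrow> (\<lambda>i. n i + n' i) \<in> degrees Q"
  by (auto simp: degrees_def)

lemma finite_perm_families:
  assumes "n \<in> degrees Q"
  shows "finite (perm_families n)"
proof (rule finite_subset)
  show "perm_families n \<subseteq> {f. \<forall>i. (i \<in> V \<longrightarrow> f i \<in> (\<Union>i\<in>V. {s. s permutes {1..n i}})) \<and> (i \<notin> V \<longrightarrow> f i = id)}"
  proof
    fix \<sigma> assume "\<sigma> \<in> perm_families n"
    then have *: "\<sigma> i permutes {1..n i}" for i by (simp add: perm_families_def)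
    then have "\<sigma> i = id" if "i \<notin> V" for i
      using *[of i] degrees_D[OF assms that] by simp
    with * show "\<sigma> \<in> {f. \<forall>i. (i \<in> V \<longrightarrow> f i \<in> (\<Union>i\<in>V. {s. s permutes {1..n i}})) \<and> (i \<notin> V \<longrightarrow> f i = id)}"
      by blast
  qed
qed (intro finite_set_of_finite_funs finite_UN_I finite_permutations finV finite_atLeastAtMost)

lemma finite_Subs:
  assumes "n \<in> degrees Q" "n' \<in> degrees Q" "idx (\<lambda>i. n i + n' i) J"
  shows "finite (Subs n J)"
proof (rule finite_subset)
  have fin: "finite (J i)" and "card (J i) = n i + n' i" for i using assms(3) by (auto simp: idx_def)
  then have J0: "J i = {}" if "i \<notin> V" for i using degrees_D that assms by (metis add_0 card_0_eq)
  show "Subs n J \<subseteq> {f. \<forall>i. (i \<in> V \<longrightarrow> f i \<in> Pow (\<Union>i\<in>V. J i)) \<and> (i \<notin> V \<longrightarrow> f i = {})}"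
    using J0 by (fastforce simp: Subs_def)
  show "finite {f. \<forall>i. (i \<in> V \<longrightarrow> f i \<in> Pow (\<Union>i\<in>V. J i)) \<and> (i \<notin> V \<longrightarrow> f i = {})}"
    by (intro finite_set_of_finite_funs) (use fin finV in auto)
qed

text \<open>This fibre size is the factorial denominator in the definition of the product. Off the
  vertex set the degrees are 0, so a family is the identity there and only finitely many factors
  count.\<close>

lemma card_perm_families_image:
  assumes n: "n \<in> degrees Q" "n' \<in> degrees Q" and A: "A \<in> Subs n (\<lambda>i. {1..n i + n' i})"
  shows "card {\<sigma> \<in> perm_families (\<lambda>i. n i + n' i). (\<lambda>i. \<sigma> i ` {1..n i}) = A} = (\<Prod>i\<in>V. fact (n i) * fact (n' i))"
proof -
  let ?F = "\<lambda>i. {s. s permutes {1..n i + n' i} \<and> s ` {1..n i} = A i}"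
  let ?S = "{\<sigma> \<in> perm_families (\<lambda>i. n i + n' i). (\<lambda>i. \<sigma> i ` {1..n i}) = A}"
  have A0: "A i = {}" if "i \<notin> V" for i
    using A degrees_D[OF n(1) that] degrees_D[OF n(2) that] by (fastforce simp: Subs_def)
  have "bij_betw (\<lambda>\<sigma>. restrict \<sigma> V) ?S (PiE V ?F)"
  proof (rule bij_betwI[where g = "\<lambda>f i. if i \<in> V then f i else id"])
    show "(\<lambda>\<sigma>. restrict \<sigma> V) \<in> ?S \<rightarrow> PiE V ?F"
      by (auto simp: perm_families_def)
    show "(\<lambda>f i. if i \<in> V then f i else id) \<in> PiE V ?F \<rightarrow> ?S"
    proof
      fix f assume f: "f \<in> PiE V ?F"
      have "(if i \<in> V then f i else id) permutes {1..n i + n' i}" for i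
        using f by (auto simp: PiE_def Pi_def permutes_id)
      moreover have "(if i \<in> V then f i else id) ` {1..n i} = A i" for i
        using f A0[of i] degrees_D[OF n(1), of i] by (auto simp: PiE_def Pi_def)
      ultimately show "(\<lambda>i. if i \<in> V then f i else id) \<in> ?S"
        by (auto simp: perm_families_def)
    qed
    fix \<sigma> assume "\<sigma> \<in> ?S"
    then have *: "\<sigma> i permutes {1..n i + n' i}" for i by (simp add: perm_families_def)
    then have "\<sigma> i = id" if "i \<notin> V" for i
      using *[of i] degrees_D[OF n(1) that] degrees_D[OF n(2) that] by simp
    then show "(\<lambda>i. if i \<in> V then restrict \<sigma> V i else id) = \<sigma>" by auto
  qed (auto simp: PiE_def extensional_def fun_eq_iff restrict_def)
  then have "card ?S = card (PiE V ?F)" by (rule bij_betw_same_card)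
  also have "\<dots> = (\<Prod>i\<in>V. card (?F i))" using finV by (rule card_PiE)
  also have "\<dots> = (\<Prod>i\<in>V. fact (n i) * fact (n' i))"
    using A by (intro prod.cong refl) (subst card_permutes_image, auto simp: Subs_def)
  finally show ?thesis .
qed

text \<open>By the symmetry of \<open>E\<close> and \<open>E'\<close> the summand of a family of
  permutations depends only on the images of {1..n i}; grouping by these images cancels the
  factorials.\<close>

lemma shuffle_sym_shuf:
  assumes n: "n \<in> degrees Q" "n' \<in> degrees Q" and E: "E \<in> SL n" "E' \<in> SL n'"
  shows "shuffle_sym Q t q n n' E E' = shuf n n' E E' (\<lambda>i. {1..n i + n' i}) rvar"
proof -
  let ?N = "\<lambda>i. n i + n' i"
  let ?J = "\<lambda>i. {1..?N i}"
  let ?A = "\<lambda>\<sigma> i. \<sigma> i ` {1..n i}"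
  let ?C = "\<Prod>i\<in>V. fact (n i) * fact (n' i) :: nat"
  let ?T = "\<lambda>A. shuf_term n n' E E' A (\<lambda>i. ?J i - A i) rvar"
  have J: "idx ?N ?J" by (simp add: idx_def)
  have tm: "lsubst (\<lambda>v. case v of Var i a \<Rightarrow> rvar i (\<sigma> i a)) E *
       lsubst (\<lambda>v. case v of Var i a \<Rightarrow> rvar i (\<sigma> i (n i + a))) E' / of_nat ?C *
       (\<Prod>i\<in>V. \<Prod>j\<in>V. \<Prod>a\<in>{1..n i}. \<Prod>b\<in>{n j<..n j + n' j}. ze i j (rvar i (\<sigma> i a) / rvar j (\<sigma> j b)))
     = ?T (?A \<sigma>) / of_nat ?C" and mem: "?A \<sigma> \<in> Subs n ?J"
    if \<sigma>: "\<sigma> \<in> perm_families ?N" for \<sigma>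
  proof -
    have perm: "\<sigma> i permutes {1..?N i}" for i using \<sigma> by (simp add: perm_families_def)
    have inj: "inj (\<sigma> i)" for i using perm permutes_inj by blast
    have B: "\<sigma> i ` {n i<..n i + n' i} = ?J i - ?A \<sigma> i" for i
    proof -
      have "{n i<..n i + n' i} = ?J i - {1..n i}" by auto
      moreover have "\<sigma> i ` ?J i = ?J i" using perm permutes_image by blast
      ultimately show ?thesis using inj[of i] by (simp add: image_set_diff)
    qed
    have "?A \<sigma> i \<subseteq> \<sigma> i ` {1..?N i}" for i by (rule image_mono) auto
    then show "?A \<sigma> \<in> Subs n ?J"
      using inj_on_subset[OF inj] unfolding permutes_image[OF perm] by (auto simp: Subs_def card_image)
    have "evJ n E (?A \<sigma>) rvar = evl (\<lambda>i a. rvar i (\<sigma> i a)) E"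
      by (rule evJ_eq[OF E(1)]) (use inj_on_subset[OF inj] in \<open>auto simp: bij_betw_def\<close>)
    moreover have "evJ n' E' (\<lambda>i. ?J i - ?A \<sigma> i) rvar = evl (\<lambda>i a. rvar i (\<sigma> i (n i + a))) E'"
    proof (rule evJ_eq[OF E(2)])
      fix i
      have "(+) (n i) ` {1..n' i} = {n i<..n i + n' i}"
        by (simp add: image_add_atLeastAtMost) auto
      then have "bij_betw ((+) (n i)) {1..n' i} {n i<..n i + n' i}" by (auto simp: bij_betw_def)
      moreover have "bij_betw (\<sigma> i) {n i<..n i + n' i} (?J i - ?A \<sigma> i)"
        using B[of i] inj_on_subset[OF inj] by (auto simp: bij_betw_def)
      ultimately show "bij_betw (\<lambda>a. \<sigma> i (n i + a)) {1..n' i} (?J i - ?A \<sigma> i)"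
        using bij_betw_trans[of "(+) (n i)" _ _ "\<sigma> i"] by (simp add: o_def)
    qed auto
    moreover have "(\<Prod>i\<in>V. \<Prod>j\<in>V. \<Prod>a\<in>?A \<sigma> i. \<Prod>b\<in>?J j - ?A \<sigma> j. ze i j (rvar i a / rvar j b)) =
       (\<Prod>i\<in>V. \<Prod>j\<in>V. \<Prod>a\<in>{1..n i}. \<Prod>b\<in>{n j<..n j + n' j}. ze i j (rvar i (\<sigma> i a) / rvar j (\<sigma> j b)))"
      unfolding B[symmetric] using inj_on_subset[OF inj] by (simp add: prod.reindex)
    ultimately show "lsubst (\<lambda>v. case v of Var i a \<Rightarrow> rvar i (\<sigma> i a)) E *
       lsubst (\<lambda>v. case v of Var i a \<Rightarrow> rvar i (\<sigma> i (n i + a))) E' / of_nat ?C *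
       (\<Prod>i\<in>V. \<Prod>j\<in>V. \<Prod>a\<in>{1..n i}. \<Prod>b\<in>{n j<..n j + n' j}. ze i j (rvar i (\<sigma> i a) / rvar j (\<sigma> j b)))
     = ?T (?A \<sigma>) / of_nat ?C"
      by (simp add: shuf_term_def)
  qed
  have C: "of_nat ?C \<noteq> (0 :: ('i, 'k) ratfun)"
    by (rule of_nat_ratfun_nz) (use finV in simp)
  have "shuffle_sym Q t q n n' E E' = (\<Sum>\<sigma>\<in>perm_families ?N. ?T (?A \<sigma>) / of_nat ?C)"
    unfolding shuffle_sym_def by (rule sum.cong) (use tm in simp_all)
  also have "\<dots> = (\<Sum>A\<in>Subs n ?J. \<Sum>\<sigma>\<in>{\<sigma>\<in>perm_families ?N. ?A \<sigma> = A}. ?T (?A \<sigma>) / of_nat ?C)"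
  proof (rule sum.group[symmetric])
    show "finite (perm_families ?N)" by (intro finite_perm_families degrees_add n)
    show "finite (Subs n ?J)" by (rule finite_Subs[OF n J])
    show "?A ` perm_families ?N \<subseteq> Subs n ?J" using mem by blast
  qed
  also have "\<dots> = (\<Sum>A\<in>Subs n ?J. ?T A)"
  proof (rule sum.cong[OF refl])
    fix A assume A: "A \<in> Subs n ?J"
    have "(\<Sum>\<sigma>\<in>{\<sigma>\<in>perm_families ?N. ?A \<sigma> = A}. ?T (?A \<sigma>) / of_nat ?C) =
      (\<Sum>\<sigma>\<in>{\<sigma>\<in>perm_families ?N. ?A \<sigma> = A}. ?T A / of_nat ?C)"
      by (rule sum.cong) auto
    also have "\<dots> = ?T A"
      using C card_perm_families_image[OF n A] by simp
    finally show "(\<Sum>\<sigma>\<in>{\<sigma>\<in>perm_families ?N. ?A \<sigma> = A}. ?T (?A \<sigma>) / of_nat ?C) = ?T A" .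
  qed
  finally show ?thesis by (simp add: shuf_def)
qed

lemma prod_arcs:
  "(\<Prod>i\<in>V. \<Prod>j\<in>V. \<Prod>\<alpha>\<in>{\<alpha>\<in>arcs Q. tail Q \<alpha> = i \<and> head Q \<alpha> = j}. h i j \<alpha>) =
   (\<Prod>\<alpha>\<in>arcs Q. h (tail Q \<alpha>) (head Q \<alpha>) \<alpha> :: 'c::comm_monoid_mult)"
proof -
  have "(\<Prod>i\<in>V. \<Prod>j\<in>V. \<Prod>\<alpha>\<in>{\<alpha>\<in>arcs Q. tail Q \<alpha> = i \<and> head Q \<alpha> = j}. h i j \<alpha>) =
    (\<Prod>i\<in>V. \<Prod>j\<in>V. \<Prod>\<alpha>\<in>arcs Q. if tail Q \<alpha> = i \<and> head Q \<alpha> = j then h i j \<alpha> else 1)"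
    by (simp add: prod.inter_filter finA)
  also have "\<dots> = (\<Prod>i\<in>V. \<Prod>\<alpha>\<in>arcs Q. \<Prod>j\<in>V. if tail Q \<alpha> = i \<and> head Q \<alpha> = j then h i j \<alpha> else 1)"
    by (intro prod.cong refl prod.swap)
  also have "\<dots> = (\<Prod>\<alpha>\<in>arcs Q. \<Prod>i\<in>V. \<Prod>j\<in>V. if tail Q \<alpha> = i \<and> head Q \<alpha> = j then h i j \<alpha> else 1)"
    by (rule prod.swap)
  also have "\<dots> = (\<Prod>\<alpha>\<in>arcs Q. \<Prod>i\<in>V. if i = tail Q \<alpha> then h i (head Q \<alpha>) \<alpha> else 1)"
  proof (intro prod.cong refl)
    fix i \<alpha> assume "\<alpha> \<in> arcs Q"
    have "(\<Prod>j\<in>V. if tail Q \<alpha> = i \<and> head Q \<alpha> = j then h i j \<alpha> else 1) =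
      (\<Prod>j\<in>V. if j = head Q \<alpha> then (if i = tail Q \<alpha> then h i j \<alpha> else 1) else 1)"
      by (rule prod.cong) auto
    then show "(\<Prod>j\<in>V. if tail Q \<alpha> = i \<and> head Q \<alpha> = j then h i j \<alpha> else 1) = (if i = tail Q \<alpha> then h i (head Q \<alpha>) \<alpha> else 1)"
      using head_V[OF \<open>\<alpha> \<in> arcs Q\<close>] finV by simp
  qed
  also have "\<dots> = (\<Prod>\<alpha>\<in>arcs Q. h (tail Q \<alpha>) (head Q \<alpha>) \<alpha>)"
    using tail_V finV by simp
  finally show ?thesis .
qed

text \<open>Both occurrences of one arrow in the product of all zeta factors: from tail to head and
  from head to tail. For a loop both come from the same zeta.\<close>

definition arrow_part :: "('i \<Rightarrow> 'b set) \<Rightarrow> ('i \<Rightarrow> 'b set) \<Rightarrow> ('i \<Rightarrow> 'b \<Rightarrow> ('i, 'k) ratfun) \<Rightarrow> 'e \<Rightarrow> ('i, 'k) ratfun"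
  where "arrow_part A B p \<alpha> =
    (\<Prod>a\<in>A (tail Q \<alpha>). \<Prod>b\<in>B (head Q \<alpha>). 1 - p (tail Q \<alpha>) a / p (head Q \<alpha>) b * rconst (t \<alpha>)) *
    (\<Prod>a\<in>A (head Q \<alpha>). \<Prod>b\<in>B (tail Q \<alpha>). 1 - rconst (t \<alpha>) / (p (head Q \<alpha>) a / p (tail Q \<alpha>) b * rconst q))"

lemma zeta_prod:
  "(\<Prod>i\<in>V. \<Prod>j\<in>V. \<Prod>a\<in>A i. \<Prod>b\<in>B j. ze i j (p i a / p j b)) =
   (\<Prod>i\<in>V. \<Prod>a\<in>A i. \<Prod>b\<in>B i. (1 - p i a / p i b * rconst (inverse q)) / (1 - p i a / p i b)) *
   (\<Prod>\<alpha>\<in>arcs Q. arrow_part A B p \<alpha>)"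
proof -
  let ?k = "\<lambda>i j a b. (1 - p i a / p j b * rconst (inverse q)) / (1 - p i a / p j b)"
  have 1: "(\<Prod>i\<in>V. \<Prod>j\<in>V. \<Prod>a\<in>A i. \<Prod>b\<in>B j. ?k i j a b ^ of_bool (i = j)) =
    (\<Prod>i\<in>V. \<Prod>a\<in>A i. \<Prod>b\<in>B i. ?k i i a b)"
  proof (rule prod.cong[OF refl])
    fix i assume "i \<in> V"
    have "(\<Prod>j\<in>V. \<Prod>a\<in>A i. \<Prod>b\<in>B j. ?k i j a b ^ of_bool (i = j)) =
      (\<Prod>j\<in>V. if j = i then (\<Prod>a\<in>A i. \<Prod>b\<in>B j. ?k i j a b) else 1)"
      by (rule prod.cong) auto
    then show "(\<Prod>j\<in>V. \<Prod>a\<in>A i. \<Prod>b\<in>B j. ?k i j a b ^ of_bool (i = j)) = (\<Prod>a\<in>A i. \<Prod>b\<in>B i. ?k i i a b)"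
      using \<open>i \<in> V\<close> finV by simp
  qed
  have swap: "(\<Prod>a\<in>X. \<Prod>b\<in>Y. \<Prod>\<alpha>\<in>Z. h a b \<alpha>) = (\<Prod>\<alpha>\<in>Z. \<Prod>a\<in>X. \<Prod>b\<in>Y. h a b \<alpha>)"
    for X :: "'b set" and Y :: "'c set" and Z :: "'e set" and h :: "_ \<Rightarrow> _ \<Rightarrow> _ \<Rightarrow> ('i, 'k) ratfun"
  proof -
    have "(\<Prod>a\<in>X. \<Prod>b\<in>Y. \<Prod>\<alpha>\<in>Z. h a b \<alpha>) = (\<Prod>a\<in>X. \<Prod>\<alpha>\<in>Z. \<Prod>b\<in>Y. h a b \<alpha>)"
      by (intro prod.cong refl prod.swap)
    also have "\<dots> = (\<Prod>\<alpha>\<in>Z. \<Prod>a\<in>X. \<Prod>b\<in>Y. h a b \<alpha>)" by (rule prod.swap)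
    finally show ?thesis .
  qed
  have 2: "(\<Prod>i\<in>V. \<Prod>j\<in>V. \<Prod>a\<in>A i. \<Prod>b\<in>B j. \<Prod>\<alpha>\<in>{\<alpha>\<in>arcs Q. tail Q \<alpha> = i \<and> head Q \<alpha> = j}. 1 - p i a / p j b * rconst (t \<alpha>)) =
    (\<Prod>\<alpha>\<in>arcs Q. \<Prod>a\<in>A (tail Q \<alpha>). \<Prod>b\<in>B (head Q \<alpha>). 1 - p (tail Q \<alpha>) a / p (head Q \<alpha>) b * rconst (t \<alpha>))"
    unfolding swap by (rule prod_arcs)
  have 3: "(\<Prod>i\<in>V. \<Prod>j\<in>V. \<Prod>a\<in>A i. \<Prod>b\<in>B j. \<Prod>\<alpha>\<in>{\<alpha>\<in>arcs Q. tail Q \<alpha> = j \<and> head Q \<alpha> = i}. 1 - rconst (t \<alpha>) / (p i a / p j b * rconst q)) =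
    (\<Prod>\<alpha>\<in>arcs Q. \<Prod>a\<in>A (head Q \<alpha>). \<Prod>b\<in>B (tail Q \<alpha>). 1 - rconst (t \<alpha>) / (p (head Q \<alpha>) a / p (tail Q \<alpha>) b * rconst q))"
    unfolding swap by (subst prod.swap) (rule prod_arcs)
  show ?thesis
    unfolding zeta_def prod.distrib 1 2 3 arrow_part_def by (simp only: mult.assoc)
qed

end

section \<open>The shuffle product is a Laurent polynomial\<close>

lemma rvar_eq_iff [simp]: "rvar i a = (rvar j b :: ('i, 'k::idom) ratfun) \<longleftrightarrow> i = j \<and> a = b"
  using rconst_rvar_eq_iff[of "1::'k" i a 1 j b] by simp

context quiver_shuffle
begin

definition pairs :: "('i \<Rightarrow> 'b set) \<Rightarrow> ('i \<times> 'b \<times> 'b) set"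
  where "pairs J = (SIGMA i:V. {(a, b). a \<in> J i \<and> b \<in> J i \<and> a \<noteq> b})"

lemma finite_pairs: "(\<And>i. finite (J i)) \<Longrightarrow> finite (pairs J)"
  unfolding pairs_def by (intro finite_SigmaI finV) (auto intro: finite_subset[of _ "J _ \<times> J _"])

definition delta :: "('i \<Rightarrow> 'b set) \<Rightarrow> ('i \<Rightarrow> 'b \<Rightarrow> ('i, 'k) ratfun) \<Rightarrow> ('i, 'k) ratfun"
  where "delta J p = (\<Prod>(i, a, b)\<in>pairs J. p i b - p i a)"

definition across :: "('i \<Rightarrow> 'b set) \<Rightarrow> ('i \<Rightarrow> 'b set) \<Rightarrow> ('i \<times> 'b \<times> 'b) set"
  where "across A B = (SIGMA i:V. A i \<times> B i)"

text \<open>This is \<open>delta\<close> times the summand of \<open>A\<close>, where for pairs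
  across \<open>A\<close> the difference has been cancelled against the denominator of zeta. In this
  form it still makes sense where points coincide.\<close>

definition numer ::
    "('i \<Rightarrow> nat) \<Rightarrow> ('i \<Rightarrow> nat) \<Rightarrow> ('i, 'k) laurent \<Rightarrow> ('i, 'k) laurent \<Rightarrow> ('i \<Rightarrow> 'b set) \<Rightarrow> ('i \<Rightarrow> 'b set) \<Rightarrow>
      ('i \<Rightarrow> 'b \<Rightarrow> ('i, 'k) ratfun) \<Rightarrow> ('i, 'k) ratfun"
  where "numer n n' E E' J A p = evJ n E A p * evJ n' E' (\<lambda>i. J i - A i) p *
    (\<Prod>(i, a, b)\<in>across A (\<lambda>i. J i - A i). p i b - p i a * rconst (inverse q)) *
    (\<Prod>(i, a, b)\<in>pairs J - across A (\<lambda>i. J i - A i). p i b - p i a) *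
    (\<Prod>\<alpha>\<in>arcs Q. arrow_part A (\<lambda>i. J i - A i) p \<alpha>)"

lemma prod_across:
  assumes "\<And>i. finite (A i)" "\<And>i. finite (B i)"
  shows "(\<Prod>i\<in>V. \<Prod>a\<in>A i. \<Prod>b\<in>B i. f i a b) = (\<Prod>(i, a, b)\<in>across A B. f i a b)"
  using assms finV by (simp add: across_def prod.cartesian_product prod.Sigma split_def)

lemma numer_eq:
  assumes "idx (\<lambda>i. n i + n' i) J" "A \<in> Subs n J" "\<And>i x. p i x \<noteq> 0" "\<And>i. inj_on (p i) (J i)"
  shows "numer n n' E E' J A p = delta J p * shuf_term n n' E E' A (\<lambda>i. J i - A i) p"
proof -
  let ?B = "\<lambda>i. J i - A i"
  let ?X = "across A ?B"
  have fin: "finite (J i)" and A: "A i \<subseteq> J i" for i using assms by (auto simp: idx_def Subs_def)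
  have finA: "finite (A i)" for i using fin A finite_subset by blast
  have X: "?X \<subseteq> pairs J" using A by (auto simp: across_def pairs_def)
  have "delta J p = (\<Prod>(i, a, b)\<in>?X. p i b - p i a) * (\<Prod>(i, a, b)\<in>pairs J - ?X. p i b - p i a)"
    unfolding delta_def by (subst prod.subset_diff[OF X finite_pairs[OF fin]]) (simp add: mult.commute)
  moreover have "(\<Prod>(i, a, b)\<in>?X. p i b - p i a) *
     (\<Prod>i\<in>V. \<Prod>a\<in>A i. \<Prod>b\<in>?B i. (1 - p i a / p i b * rconst (inverse q)) / (1 - p i a / p i b)) =
     (\<Prod>(i, a, b)\<in>?X. p i b - p i a * rconst (inverse q))"
  proof -
    have "(\<Prod>(i, a, b)\<in>?X. p i b - p i a) *
     (\<Prod>(i, a, b)\<in>?X. (1 - p i a / p i b * rconst (inverse q)) / (1 - p i a / p i b)) =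
     (\<Prod>x\<in>?X. (case x of (i, a, b) \<Rightarrow> p i b - p i a) *
       (case x of (i, a, b) \<Rightarrow> (1 - p i a / p i b * rconst (inverse q)) / (1 - p i a / p i b)))"
      by (simp add: prod.distrib)
    also have "\<dots> = (\<Prod>(i, a, b)\<in>?X. p i b - p i a * rconst (inverse q))"
    proof (rule prod.cong[OF refl], clarify)
      fix i a b assume "(i, a, b) \<in> ?X"
      then have "p i a \<noteq> p i b"
        using assms(4)[of i] A[of i] by (auto simp: across_def inj_on_def)
      then show "(p i b - p i a) * ((1 - p i a / p i b * rconst (inverse q)) / (1 - p i a / p i b)) =
          p i b - p i a * rconst (inverse q)"
        using assms(3)[of i b] by (simp add: divide_simps)
    qed
    finally show ?thesis
      using finA fin by (subst prod_across) auto
  qed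
  ultimately show ?thesis
    unfolding numer_def shuf_term_def zeta_prod by (simp add: mult_ac)
qed

lemma lfun_numer:
  assumes J: "idx (\<lambda>i. n i + n' i) J" "A \<in> Subs n J" and E: "E \<in> SL n" "E' \<in> SL n'"
    and r: "\<And>i x. i \<in> V \<Longrightarrow> x \<in> J i \<Longrightarrow> r i x \<in> {1..m i}"
  shows "lfun m (\<lambda>y. numer n n' E E' J A (\<lambda>i x. rconst (q powi e i x) * y i (r i x)))"
proof -
  have A: "A i \<subseteq> J i" for i using J by (auto simp: Subs_def)
  have v: "lfun m (\<lambda>y. rconst (q powi e i x) * y i (r i x))" if "i \<in> V" "x \<in> J i" for i x
    by (intro lfun_mult lfun_q_powi lfun_var r that)
  have d: "lfun m (\<lambda>y. f y / (rconst (q powi e i x) * y i (r i x)))" if "i \<in> V" "x \<in> J i" "lfun m f" for i x f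
  proof -
    have "(\<lambda>y. f y / (rconst (q powi e i x) * y i (r i x))) = (\<lambda>y. rconst (q powi (- e i x)) * (f y / y i (r i x)))"
      by (simp add: fun_eq_iff power_int_minus rconst_inverse divide_inverse mult_ac)
    then show ?thesis by (auto intro!: lfun_mult lfun_q_powi lfun_divide_var r that)
  qed
  have d2: "lfun m (\<lambda>y. rconst (t \<alpha>) / (rconst (q powi e i x) * y i (r i x) / (rconst (q powi e j z) * y j (r j z)) * rconst q))"
    if "i \<in> V" "x \<in> J i" "j \<in> V" "z \<in> J j" "\<alpha> \<in> arcs Q" for i x j z \<alpha>
  proof -
    have "(\<lambda>y :: 'i \<Rightarrow> nat \<Rightarrow> ('i, 'k) ratfun. rconst (t \<alpha>) / (rconst (q powi e i x) * y i (r i x) / (rconst (q powi e j z) * y j (r j z)) * rconst q)) =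
      (\<lambda>y. rconst (t \<alpha>) * rconst (inverse q) * (rconst (q powi e j z) * y j (r j z)) / (rconst (q powi e i x) * y i (r i x)))"
      by (simp add: fun_eq_iff rconst_inverse divide_inverse mult_ac)
    moreover have "lfun m (\<lambda>y. rconst (t \<alpha>) * rconst (inverse q) * (rconst (q powi e j z) * y j (r j z)) / (rconst (q powi e i x) * y i (r i x)))"
      by (intro d lfun_mult[OF _ v] lfun_mult[OF lfun_const lfun_const] R_gens that)
    ultimately show ?thesis by (simp only:)
  qed
  have arr: "lfun m (\<lambda>y. arrow_part A (\<lambda>i. J i - A i) (\<lambda>i x. rconst (q powi e i x) * y i (r i x)) \<alpha>)"
    if \<alpha>: "\<alpha> \<in> arcs Q" for \<alpha>
    unfolding arrow_part_def
    by (intro lfun_mult lfun_prod lfun_diff lfun_1 d2 d v lfun_const R_gens tail_V[OF \<alpha>] head_V[OF \<alpha>] \<alpha>)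
      (use A in auto)
  have 1: "lfun m (\<lambda>y. evJ n E A (\<lambda>i x. rconst (q powi e i x) * y i (r i x)))"
    by (rule lfun_evJ[OF E(1) Subs_idx(1)[OF J]]) (use A r in blast)
  have 2: "lfun m (\<lambda>y. evJ n' E' (\<lambda>i. J i - A i) (\<lambda>i x. rconst (q powi e i x) * y i (r i x)))"
    by (rule lfun_evJ[OF E(2) Subs_idx(2)[OF J]]) (use r in blast)
  show ?thesis
    unfolding numer_def split_def
    by (intro lfun_mult[OF lfun_mult[OF lfun_mult[OF lfun_mult[OF 1 2]]]] lfun_prod lfun_diff v lfun_mult lfun_const R_gens arr)
      (auto simp: across_def pairs_def dest: subsetD[OF A])
qed

text \<open>To see that the simple poles of the symmetrization cancel, it is multiplied by \<open>delta\<close>, the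
  product over all ordered pairs and hence symmetric: no signs have to be tracked.  The price is
  that the numerator must be shown to vanish to second order along every diagonal.\<close>

lemma shuf_numer_dvd_square:
  fixes n n' :: "'i \<Rightarrow> nat"
  assumes n: "n \<in> degrees Q" "n' \<in> degrees Q" and E: "E \<in> SL n" "E' \<in> SL n'"
  defines "N \<equiv> \<lambda>i. n i + n' i"
  defines "J \<equiv> \<lambda>i. {1..n i + n' i}"
  defines "M \<equiv> \<lambda>p. \<Sum>A\<in>Subs n J. numer n n' E E' J A p"
  assumes ab: "(i, a, b) \<in> pairs J"
  shows "\<exists>H. lfun N H \<and> (\<forall>p. (\<forall>i a. p i a \<noteq> 0) \<longrightarrow> M p = (p i a - p i b) ^ 2 * H p)"
proof -
  have idxJ: "idx (\<lambda>i. n i + n' i) J" by (simp add: J_def idx_def)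
  have i: "i \<in> V" "a \<in> {1..N i}" "b \<in> {1..N i}" "a \<noteq> b"
    using ab by (auto simp: pairs_def J_def N_def)
  have lM: "lfun N M"
  proof -
    have "lfun N (\<lambda>y. numer n n' E E' J A y)" if "A \<in> Subs n J" for A
      using lfun_numer[OF idxJ that E, of "\<lambda>i x. x" N "\<lambda>_ _. 0"] by (auto simp: J_def N_def)
    then show ?thesis unfolding M_def by (intro lfun_sum)
  qed
  let ?gp = "generic_point i a b 0"
  have gp: "?gp i a = ?gp i b" using i by (simp add: generic_point_def)
  have "numer n n' E E' J A ?gp = 0" if "A \<in> Subs n J" for A
  proof -
    have fin: "finite (pairs J - across A (\<lambda>i. J i - A i))"
      by (intro finite_Diff finite_pairs) (simp add: J_def)
    \<comment> \<open>An ordered pair and its reverse cannot both lead from \<open>A\<close> to its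
      complement, so one of them keeps its factor p_b - p_a, which is zero here.\<close>
    have "(i, a, b) \<in> pairs J - across A (\<lambda>i. J i - A i) \<or> (i, b, a) \<in> pairs J - across A (\<lambda>i. J i - A i)"
      using ab by (auto simp: pairs_def across_def)
    then have "(\<Prod>(i, a, b)\<in>pairs J - across A (\<lambda>i. J i - A i). ?gp i b - ?gp i a) = 0"
      using fin gp by (subst prod_zero_iff) (auto intro: bexI[of _ "(i, a, b)"] bexI[of _ "(i, b, a)"])
    then show ?thesis by (simp add: numer_def)
  qed
  then have "M ?gp = 0" by (simp add: M_def)
  from lfun_dvd_linear[OF lM i this] obtain M1
    where M1: "lfun N M1" "\<And>p. \<forall>i a. p i a \<noteq> 0 \<Longrightarrow> M p = (p i a - p i b) * M1 p" by auto
  let ?\<tau> = "\<lambda>j d. if j = i then Transposition.transpose a b d else d"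
  let ?p\<tau> = "\<lambda>p j d. p j (?\<tau> j d)"
  have \<tau>: "bij_betw (?\<tau> j) (J j) (J j)" for j
    using i bij_betw_transpose_iff[of a "J i" b] by (cases "j = i") (auto simp: J_def N_def bij_betw_def)
  have \<tau>in: "?\<tau> j d \<in> {1..N j}" if "d \<in> {1..N j}" for j d
    using \<tau>[of j] that by (auto simp: bij_betw_def J_def N_def)
  \<comment> \<open>Only where the points of each colour are distinct is \<open>M\<close> known to
    be the product of \<open>delta\<close> and \<open>shuf\<close>, both symmetric. The generic
    point is such a place, and \<open>lfun_eqI\<close> later extends the symmetry to all
    points.\<close>
  have sym_rvar: "M (?p\<tau> rvar) = M rvar"
  proof -
    have M: "M p = delta J p * shuf n n' E E' J p" if "\<And>i x. p i x \<noteq> 0" "\<And>i. inj_on (p i) (J i)" for p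
      using that numer_eq[OF idxJ] by (simp add: M_def shuf_def sum_distrib_left)
    have mem: "(j, ?\<tau> j c, ?\<tau> j d) \<in> pairs J" if "(j, c, d) \<in> pairs J" for j c d
      using that \<tau>in[of c j] \<tau>in[of d j] by (auto simp: pairs_def J_def N_def transpose_eq_iff)
    have d: "delta J (?p\<tau> rvar) = delta J rvar"
      unfolding delta_def
    proof (rule prod.reindex_bij_witness[where i = "\<lambda>(j, c, d). (j, ?\<tau> j c, ?\<tau> j d)" and j = "\<lambda>(j, c, d). (j, ?\<tau> j c, ?\<tau> j d)"])
    qed (use mem mem[of i] in \<open>auto split: if_splits\<close>)
    have s: "shuf n n' E E' J (?p\<tau> rvar) = shuf n n' E E' J rvar"
      by (rule shuf_reindex[OF E idxJ \<tau>]) auto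
    show ?thesis
    proof -
      have "Transposition.transpose a b x = Transposition.transpose a b y \<longleftrightarrow> x = y" for x y
        by (metis transpose_involutory)
      then have "inj_on (\<lambda>d. rvar j (?\<tau> j d) :: ('i, 'k) ratfun) (J j)" for j
        by (simp add: inj_on_def)
      then have "M (?p\<tau> rvar) = delta J (?p\<tau> rvar) * shuf n n' E E' J (?p\<tau> rvar)"
        by (intro M) auto
      also have "\<dots> = delta J rvar * shuf n n' E E' J rvar" by (simp only: d s)
      also have "\<dots> = M rvar" by (rule M[symmetric]) (auto simp: inj_on_def)
      finally show ?thesis .
    qed
  qed
  have lM\<tau>: "lfun N (\<lambda>p. M (?p\<tau> p))"
    by (rule lfun_rename[OF lM \<tau>in])
  have lM1\<tau>: "lfun N (\<lambda>p. M1 (?p\<tau> p))"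
    by (rule lfun_rename[OF M1(1) \<tau>in])
  \<comment> \<open>\<open>M\<close> is symmetric under the transposition and the linear form
    changes sign, so the quotient \<open>M1\<close> is antisymmetric. On the diagonal it equals its
    own negative: this is the second zero.\<close>
  have anti: "M1 p = - M1 (?p\<tau> p)" if "\<And>i a. p i a \<noteq> 0" for p
  proof (rule lfun_cancel[where l = "\<lambda>p. p i a - p i b", OF _ M1(1) lfun_uminus[OF lM1\<tau>] _ _ that])
    show "lfun N (\<lambda>p. p i a - p i b)" by (intro lfun_diff lfun_var i)
    show "rvar i a - rvar i b \<noteq> 0" using linear_form_nz[OF i(4), of i 0] by simp
    show "(p i a - p i b) * M1 p = (p i a - p i b) * - M1 (?p\<tau> p)" if "\<And>i a. p i a \<noteq> 0" for p
    proof -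
      have "M (?p\<tau> p) = M p"
        by (rule lfun_eqI[OF lM\<tau> lM sym_rvar]) (rule that)
      then have "(p i a - p i b) * M1 p = M (?p\<tau> p)"
        using M1(2)[of p] that by simp
      also have "\<dots> = (p i b - p i a) * M1 (?p\<tau> p)"
        using M1(2)[of "?p\<tau> p"] that by simp
      finally show ?thesis by (simp add: algebra_simps)
    qed
  qed
  have "?p\<tau> ?gp = ?gp"
    using gp by (auto simp: fun_eq_iff Transposition.transpose_def)
  then have "M1 ?gp = 0" using anti[of ?gp] by (simp add: ratfun_eq_uminus_iff)
  from lfun_dvd_linear[OF M1(1) i this] obtain M2
    where M2: "lfun N M2" "\<And>p. \<forall>i a. p i a \<noteq> 0 \<Longrightarrow> M1 p = (p i a - p i b) * M2 p" by auto
  show ?thesis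
    using M1(2) M2 by (intro exI[of _ M2]) (simp add: power2_eq_square mult.assoc)
qed

text \<open>The squares belonging to the unordered pairs, represented by a < b, are divided out of
  the numerator one by one. Their product is \<open>delta\<close> up to sign, so the last quotient
  is, up to the same sign, the symmetrization wherever the points are distinct.\<close>

lemma shuf_laurent:
  fixes n n' :: "'i \<Rightarrow> nat"
  assumes n: "n \<in> degrees Q" "n' \<in> degrees Q" and E: "E \<in> SL n" "E' \<in> SL n'"
  shows "\<exists>F. lfun (\<lambda>i. n i + n' i) F \<and> (\<forall>p. (\<forall>i a. p i a \<noteq> 0) \<longrightarrow> (\<forall>i. inj_on (p i) {1..n i + n' i}) \<longrightarrow>
    shuf n n' E E' (\<lambda>i. {1..n i + n' i}) p = F p)"
proof -
  let ?N = "\<lambda>i. n i + n' i"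
  let ?J = "\<lambda>i. {1..n i + n' i}"
  let ?M = "\<lambda>p. \<Sum>A\<in>Subs n ?J. numer n n' E E' ?J A p"
  let ?D = "{(i, a, b) \<in> pairs ?J. a < b}"
  have idxJ: "idx (\<lambda>i. n i + n' i) ?J" by (simp add: idx_def)
  have finD: "finite ?D" by (rule finite_subset[OF _ finite_pairs[of ?J]]) auto
  have lM: "lfun ?N ?M"
  proof (rule lfun_sum)
    fix A assume "A \<in> Subs n ?J"
    from lfun_numer[OF idxJ this E, of "\<lambda>i x. x" ?N "\<lambda>_ _. 0"]
    show "lfun ?N (\<lambda>p. numer n n' E E' ?J A p)" by simp
  qed
  have "\<exists>G. lfun ?N G \<and> (\<forall>p. (\<forall>i a. p i a \<noteq> 0) \<longrightarrow> ?M p = (\<Prod>(i, a, b)\<in>X. (p i a - p i b) ^ 2) * G p)"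
    if "finite X" "X \<subseteq> ?D" for X
    using that
  proof (induction X rule: finite_induct)
    case empty
    then show ?case using lM by auto
  next
    case (insert x X)
    then obtain G where G: "lfun ?N G" "\<And>p. \<forall>i a. p i a \<noteq> 0 \<Longrightarrow> ?M p = (\<Prod>(i, a, b)\<in>X. (p i a - p i b) ^ 2) * G p"
      by auto
    obtain i a b where x: "x = (i, a, b)" by (cases x)
    have iab: "(i, a, b) \<in> pairs ?J" "a < b" using insert.prems x by auto
    obtain H where H: "lfun ?N H" "\<And>p. \<forall>i a. p i a \<noteq> 0 \<Longrightarrow> ?M p = (p i a - p i b) ^ 2 * H p"
      using shuf_numer_dvd_square[OF n E iab(1)] by auto
    have 1: "lfun ?N (\<lambda>p. \<Prod>(i, a, b)\<in>X. (p i a - p i b) ^ 2)"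
      unfolding split_def
      by (intro lfun_prod lfun_power lfun_diff lfun_var) (use insert.prems in \<open>auto simp: pairs_def\<close>)
    \<comment> \<open>Different pairs with a < b have different diagonals, so the squares split off
      earlier do not vanish at the generic point of the new diagonal.\<close>
    have 2: "(\<Prod>(i, a, b)\<in>X. (generic_point i' a' b' 0 i a - generic_point i' a' b' 0 i b) ^ 2) \<noteq> 0"
      if i': "i' = i" "a' = a" "b' = b" for i' a' b'
    proof -
      have "generic_point i' a' b' 0 j c \<noteq> generic_point i' a' b' 0 j d" if "(j, c, d) \<in> X" for j c d
        using that insert.prems insert.hyps x iab i' by (auto simp: generic_point_def)
      then show ?thesis using insert.hyps by (subst prod_zero_iff) auto
    qed
    \<comment> \<open>The index set {0, Suc 0} repeats the same linear form, which makes the divisor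
      its square.\<close>
    have "\<exists>K. lfun ?N K \<and> (\<forall>p. (\<forall>i a. p i a \<noteq> 0) \<longrightarrow>
      G p = (\<Prod>x\<in>{0, Suc 0}. p i a - rconst (q powi 0) * p i b) * K p)"
    proof (rule lfun_dvd_linear_prod[where C = "\<lambda>p. \<Prod>(i, a, b)\<in>X. (p i a - p i b) ^ 2" and F = H and i = "\<lambda>_. i" and a = "\<lambda>_. a" and b = "\<lambda>_. b"])
      show "H p * (\<Prod>x\<in>{0, Suc 0}. p i a - rconst (q powi 0) * p i b) = (\<Prod>(i, a, b)\<in>X. (p i a - p i b) ^ 2) * G p"
        if "\<And>i a. p i a \<noteq> 0" for p
        using G(2)[of p] H(2)[of p] that by (simp add: power2_eq_square mult_ac)
    qed (use iab G H 1 2 in \<open>auto simp: pairs_def\<close>)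
    then obtain K where K: "lfun ?N K" "\<And>p. \<forall>i a. p i a \<noteq> 0 \<Longrightarrow> G p = (p i a - p i b) ^ 2 * K p"
      by (auto simp: power2_eq_square)
    show ?case
      using insert.hyps G K x by (intro exI[of _ K]) (simp add: mult_ac)
  qed
  from this[OF finD subset_refl] obtain G
    where G: "lfun ?N G" "\<And>p. \<forall>i a. p i a \<noteq> 0 \<Longrightarrow> ?M p = (\<Prod>(i, a, b)\<in>?D. (p i a - p i b) ^ 2) * G p"
    by auto
  have dl: "delta ?J p = (-1) ^ card ?D * (\<Prod>(i, a, b)\<in>?D. (p i a - p i b) ^ 2)" for p
  proof -
    let ?s = "\<lambda>(i, a, b). (i, b, a)"
    have P: "pairs ?J = ?D \<union> ?s ` ?D"
      by (auto simp: pairs_def image_iff)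
    have "delta ?J p = (\<Prod>(i, a, b)\<in>?D. p i b - p i a) * (\<Prod>(i, a, b)\<in>?s ` ?D. p i b - p i a)"
      unfolding delta_def by (subst P, rule prod.union_disjoint) (use finD in auto)
    also have "(\<Prod>(i, a, b)\<in>?s ` ?D. p i b - p i a) = (\<Prod>(i, a, b)\<in>?D. p i a - p i b)"
      by (subst prod.reindex) (auto simp: inj_on_def intro!: prod.cong)
    also have "(\<Prod>(i, a, b)\<in>?D. p i b - p i a) * (\<Prod>(i, a, b)\<in>?D. p i a - p i b) =
      (\<Prod>(i, a, b)\<in>?D. (-1) * (p i a - p i b) ^ 2)"
      unfolding prod.distrib[symmetric] by (intro prod.cong) (auto simp: power2_eq_square algebra_simps)
    also have "\<dots> = (-1) ^ card ?D * (\<Prod>(i, a, b)\<in>?D. (p i a - p i b) ^ 2)"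
      by (simp add: split_def prod.distrib[symmetric] flip: prod_constant)
    finally show ?thesis .
  qed
  show ?thesis
  proof (intro exI[of _ "\<lambda>p. rconst ((-1) ^ card ?D) * G p"] conjI allI impI)
    show "lfun ?N (\<lambda>p. rconst ((-1) ^ card ?D) * G p)"
      by (intro lfun_mult lfun_const R_power R_uminus R_1 G)
    fix p :: "'i \<Rightarrow> nat \<Rightarrow> ('i, 'k) ratfun" assume nz: "\<forall>i a. p i a \<noteq> 0" and inj: "\<forall>i. inj_on (p i) (?J i)"
    have M: "?M p = delta ?J p * shuf n n' E E' ?J p"
      unfolding shuf_def sum_distrib_left
      by (intro sum.cong refl numer_eq[OF idxJ]) (use nz inj in auto)
    have "p i a \<noteq> p i b" if "(i, a, b) \<in> ?D" for i a b
      using inj_onD[OF inj[rule_format, of i], of a b] that by (auto simp: pairs_def)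
    then have "(\<Prod>(i, a, b)\<in>?D. (p i a - p i b) ^ 2) \<noteq> 0"
      using finD by (subst prod_zero_iff) auto
    moreover have "(\<Prod>(i, a, b)\<in>?D. (p i a - p i b) ^ 2) * ((-1) ^ card ?D * shuf n n' E E' ?J p) =
      (\<Prod>(i, a, b)\<in>?D. (p i a - p i b) ^ 2) * G p"
      using M G(2)[OF nz] dl[of p] by (simp add: mult_ac)
    ultimately have e: "(-1) ^ card ?D * shuf n n' E E' ?J p = G p"
      by (rule mult_left_cancel[THEN iffD1])
    have "G p * (-1) ^ card ?D = (-1) ^ card ?D * (-1) ^ card ?D * shuf n n' E E' ?J p"
      by (simp only: e[symmetric] mult_ac)
    also have "(-1) ^ card ?D * (-1) ^ card ?D = (1 :: ('i, 'k) ratfun)"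
      unfolding power_mult_distrib[symmetric] minus_mult_minus mult_1_left power_one ..
    finally have "G p * (-1) ^ card ?D = shuf n n' E E' ?J p" by (simp only: mult_1_left)
    moreover have "rconst ((-1) ^ k) = (-1 :: ('i, 'k) ratfun) ^ k" for k
      by (simp add: rconst_power)
    ultimately show "shuf n n' E E' ?J p = rconst ((-1) ^ card ?D) * G p"
      by (simp only: mult.commute)
  qed
qed

text \<open>The Laurent polynomial of \<open>shuf_laurent\<close> meets the description in the
  definition of the product, uniquely since \<open>to_fract\<close> is injective. In the second part
  the points of a colour are distinct because the summands of \<open>shuf\<close> have poles where
  points coincide.\<close>

theorem shuffle_homog_props:
  fixes J :: "'i \<Rightarrow> 'b set"
  assumes n: "n \<in> degrees Q" "n' \<in> degrees Q" and E: "E \<in> SL n" "E' \<in> SL n'"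
  shows "shuffle_homog Q t q n n' E E' \<in> SL (\<lambda>i. n i + n' i)" (is "?P \<in> SL ?N")
    and "idx (\<lambda>i. n i + n' i) J \<Longrightarrow> (\<And>i x. p i x \<noteq> 0) \<Longrightarrow> (\<And>i. inj_on (p i) (J i)) \<Longrightarrow>
      evJ (\<lambda>i. n i + n' i) (shuffle_homog Q t q n n' E E') J p = shuf n n' E E' J p"
proof -
  let ?J = "\<lambda>i. {1..n i + n' i}"
  obtain F where F: "lfun ?N F" "\<And>p. (\<And>i a. p i a \<noteq> 0) \<Longrightarrow> (\<And>i. inj_on (p i) (?J i)) \<Longrightarrow> shuf n n' E E' ?J p = F p"
    using shuf_laurent[OF n E] by auto
  from F(1) obtain P where P: "P \<in> LR ?N" "\<And>p. (\<And>i a. p i a \<noteq> 0) \<Longrightarrow> F p = evl p P"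
    by (rule lfunE) blast
  have ev: "evl p P = shuf n n' E E' ?J p" if "\<And>i a. p i a \<noteq> 0" "\<And>i. inj_on (p i) (?J i)" for p
    using F(2)[of p] P(2)[of p] that by simp
  have idxJ: "idx ?N ?J" by (simp add: idx_def)
  have eq: "?P = P"
    unfolding shuffle_homog_def
  proof (rule the_equality)
    show eq: "to_fract P = shuffle_sym Q t q n n' E E'"
      using ev[of rvar] by (simp add: shuffle_sym_shuf[OF n E] lsubst_rvar inj_on_def)
    show "\<And>P'. to_fract P' = shuffle_sym Q t q n n' E E' \<Longrightarrow> P' = P"
      using eq by (metis to_fract_eq_iff)
  qed
  have SP: "P \<in> SL ?N"
  proof (rule SL_I[OF P(1)])
    fix \<sigma> assume "\<sigma> \<in> perm_families ?N"
    then have \<sigma>: "\<sigma> i permutes ?J i" for i by (simp add: perm_families_def)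
    have "evl (\<lambda>i a. rvar i (\<sigma> i a)) P = shuf n n' E E' ?J (\<lambda>i a. rvar i (\<sigma> i a))"
    proof (rule ev)
      show "inj_on (\<lambda>a. rvar i (\<sigma> i a) :: ('i, 'k) ratfun) (?J i)" for i
        using permutes_inj[OF \<sigma>[of i]] by (simp add: inj_on_def inj_def)
    qed auto
    also have "\<dots> = shuf n n' E E' ?J rvar"
      by (rule shuf_reindex[OF E idxJ permutes_imp_bij[OF \<sigma>]]) auto
    also have "\<dots> = evl rvar P"
      by (rule ev[symmetric]) (auto simp: inj_on_def)
    finally show "evl (\<lambda>i a. rvar i (\<sigma> i a)) P = evl rvar P" .
  qed
  with eq show "?P \<in> SL ?N" by simp
  assume J: "idx ?N J" and p: "\<And>i x. p i x \<noteq> 0" "\<And>i. inj_on (p i) (J i)"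
  let ?f = "\<lambda>i. enum_bij (?N i) (J i)"
  have f: "bij_betw (?f i) (?J i) (J i)" for i using J by (rule idx_enum)
  have "evJ ?N ?P J p = evl (\<lambda>i a. p i (?f i a)) P" by (simp add: evJ_def eq)
  also have "\<dots> = shuf n n' E E' ?J (\<lambda>i a. p i (?f i a))"
  proof (rule ev)
    show "inj_on (\<lambda>a. p i (?f i a)) (?J i)" for i
      using comp_inj_on[of "?f i" "?J i" "p i"] f[of i] p(2)[of i] by (simp add: bij_betw_def o_def)
  qed (use p in auto)
  also have "\<dots> = shuf n n' E E' J p"
    by (rule shuf_reindex[OF E idxJ f]) (use p in auto)
  finally show "evJ ?N ?P J p = shuf n n' E E' J p" .
qed

end

section \<open>The multiplicity function \<open>chi\<close>\<close>

text \<open>On either side of the step from c = 0 to c = 1 only one slope and one plateau bound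
  matter. The correction for n = n' disappears because the active slope is then at most n - 1
  anyway.\<close>

lemma chi_pos: "c \<ge> 1 \<Longrightarrow> int (chi n n' c) = max 0 (min (int n) (int n' - c))"
  unfolding chi_def of_nat_min by (cases "n = n'") (auto simp: min_def max_def)

lemma chi_neg: "c \<le> 0 \<Longrightarrow> int (chi n n' c) = max 0 (min (int n') (int n + c - 1))"
  unfolding chi_def of_nat_min by (cases "n = n'") (auto simp: min_def max_def)

text \<open>For fixed c the entry u determines v, and the admissible u fill an interval.\<close>

lemma card_pairs_diff:
  "int (card {(u, v). a \<le> u \<and> u < b \<and> a' \<le> v \<and> v < b' \<and> int v - int u = c}) =
   max 0 (min (int b) (int b' - c) - max (int a) (int a' - c))"
proof -
  have "{(u, v). a \<le> u \<and> u < b \<and> a' \<le> v \<and> v < b' \<and> int v - int u = c} =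
     (\<lambda>u. (nat u, nat (u + c))) ` {max (int a) (int a' - c)..<min (int b) (int b' - c)}" (is "_ = ?f ` ?I")
    by (auto simp: image_iff intro!: bexI[of _ "int _"])
  moreover have "inj_on ?f ?I"
    by (auto simp: inj_on_def)
  ultimately show ?thesis by (simp only: card_image card_atLeastLessThan_int)
qed

text \<open>The inequality behind closure under the product. Two segments of lengths n and n' are
  cut after k and k' points. The second \<open>chi\<close> belongs to the final parts, whose
  starting points are shifted by k and k' powers of q. The two cardinalities count the arrow factors
  of zeta between the initial part of one segment and the final part of the other, in both
  directions; c - 1 reflects the extra q in the second kind of arrow factor. In each of the four
  sign cases all terms are explicit minima, and the claim is linear arithmetic.\<close>

lemma chi_split:
  assumes "k \<le> n" "k' \<le> n'"
  shows "chi n n' c \<le> chi k k' c + chi (n - k) (n' - k') (c - int k' + int k)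
    + card {(u, v). 0 \<le> u \<and> u < k \<and> k' \<le> v \<and> v < n' \<and> int v - int u = c}
    + card {(u, v). k \<le> u \<and> u < n \<and> 0 \<le> v \<and> v < k' \<and> int v - int u = c - 1}"
proof -
  have "int (chi n n' c) \<le> int (chi k k' c) + int (chi (n - k) (n' - k') (c - int k' + int k))
    + int (card {(u, v). 0 \<le> u \<and> u < k \<and> k' \<le> v \<and> v < n' \<and> int v - int u = c})
    + int (card {(u, v). k \<le> u \<and> u < n \<and> 0 \<le> v \<and> v < k' \<and> int v - int u = c - 1})"
  proof (cases "c \<ge> 1")
    case True
    show ?thesis
    proof (cases "c - int k' + int k \<ge> 1")
      case True' : True
      show ?thesis
        unfolding card_pairs_diff chi_pos[OF True] chi_pos[OF True'] using assms True True' by (simp add: of_nat_diff)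
    next
      case False
      then have "c - int k' + int k \<le> 0" by simp
      then show ?thesis
        unfolding card_pairs_diff chi_pos[OF True] chi_neg[OF \<open>c - int k' + int k \<le> 0\<close>] using assms True by (simp add: of_nat_diff)
    qed
  next
    case False
    then have F: "c \<le> 0" by simp
    show ?thesis
    proof (cases "c - int k' + int k \<ge> 1")
      case True' : True
      show ?thesis
        unfolding card_pairs_diff chi_neg[OF F] chi_pos[OF True'] using assms F True' by (simp add: of_nat_diff)
    next
      case False
      then have "c - int k' + int k \<le> 0" by simp
      then show ?thesis
        unfolding card_pairs_diff chi_neg[OF F] chi_neg[OF \<open>c - int k' + int k \<le> 0\<close>] using assms F by (simp add: of_nat_diff)
    qed
  qed
  then show ?thesis by linarith
qed

lemma chi_0 [simp]: "chi 0 n' c = 0" "chi n 0 c = 0"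
  by (auto simp: chi_def min_def max_def)

lemma chi_le_1: "n \<le> 1 \<Longrightarrow> n' \<le> 1 \<Longrightarrow> chi n n' c = 0"
  by (simp add: chi_def split: if_splits)

lemma chi_eq_0: "c \<le> - int n \<or> c \<ge> int n' \<Longrightarrow> chi n n' c = 0"
  by (auto simp: chi_def)

text \<open>The inner product over c of the divisor, with arbitrary factors w c. Keeping w abstract
  separates the bookkeeping of exponents from the arithmetic of the linear factors.\<close>

definition Dw :: "nat \<Rightarrow> nat \<Rightarrow> (int \<Rightarrow> 'c::comm_monoid_mult) \<Rightarrow> 'c"
  where "Dw n n' w = (\<Prod>c\<in>{- int n..int n'}. w c ^ chi n n' c)"

lemma Dw_superset:
  assumes "finite C" "{- int n<..<int n'} \<subseteq> C"
  shows "Dw n n' w = (\<Prod>c\<in>C. w c ^ chi n n' c)"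
proof -
  have "Dw n n' w = (\<Prod>c\<in>C \<union> {- int n..int n'}. w c ^ chi n n' c)"
    unfolding Dw_def
  proof (rule prod.mono_neutral_left)
    show "\<forall>c\<in>C \<union> {- int n..int n'} - {- int n..int n'}. w c ^ chi n n' c = 1"
    proof
      fix c assume "c \<in> C \<union> {- int n..int n'} - {- int n..int n'}"
      then have "c \<le> - int n \<or> c \<ge> int n'" by auto
      then show "w c ^ chi n n' c = 1" by (simp add: chi_eq_0)
    qed
  qed (use assms in auto)
  also have "\<dots> = (\<Prod>c\<in>C. w c ^ chi n n' c)"
  proof (rule prod.mono_neutral_right)
    show "\<forall>c\<in>C \<union> {- int n..int n'} - C. w c ^ chi n n' c = 1"
    proof
      fix c assume "c \<in> C \<union> {- int n..int n'} - C"
      then have "c \<notin> {- int n<..<int n'}" using assms(2) by blast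
      then have "c \<le> - int n \<or> c \<ge> int n'" by auto
      then show "w c ^ chi n n' c = 1" by (simp add: chi_eq_0)
    qed
  qed (use assms in auto)
  finally show ?thesis .
qed

lemma Dw_0 [simp]: "Dw 0 n' w = 1" "Dw n 0 w = 1"
  by (simp_all add: Dw_def)

lemma prod_pairs_diff:
  assumes "finite S" "finite C" "\<And>x. x \<in> S \<Longrightarrow> g x \<in> C"
  shows "(\<Prod>x\<in>S. w (g x)) = (\<Prod>c\<in>C. w c ^ card {x \<in> S. g x = c} :: 'c::comm_monoid_mult)"
proof -
  have "(\<Prod>x\<in>S. w (g x)) = (\<Prod>c\<in>C. \<Prod>x\<in>{x\<in>S. g x = c}. w (g x))"
    by (rule prod.group[symmetric]) (use assms in auto)
  also have "\<dots> = (\<Prod>c\<in>C. \<Prod>x\<in>{x\<in>S. g x = c}. w c)"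
    by (intro prod.cong) auto
  finally show ?thesis by simp
qed

text \<open>\<open>chi_split\<close> read as a statement about exponents. The surplus exponents are
  chosen before w, so the cofactor is one fixed monomial in the factors w c, hence a Laurent
  polynomial once these are.\<close>

lemma Dw_split:
  assumes "k \<le> n" "k' \<le> n'"
  shows "\<exists>\<delta>. \<forall>w :: int \<Rightarrow> 'c::comm_monoid_mult.
    Dw k k' w * Dw (n - k) (n' - k') (\<lambda>c. w (c + int k' - int k)) *
    (\<Prod>u<k. \<Prod>v\<in>{k'..<n'}. w (int v - int u)) * (\<Prod>v<k'. \<Prod>u\<in>{k..<n}. w (int v - int u + 1)) =
    Dw n n' w * (\<Prod>c\<in>{- int (n + n')..int (n + n')}. w c ^ \<delta> c)"
proof -
  let ?C = "{- int (n + n')..int (n + n')}"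
  let ?m1 = "\<lambda>c. card {(u, v). 0 \<le> u \<and> u < k \<and> k' \<le> v \<and> v < n' \<and> int v - int u = c}"
  let ?m2 = "\<lambda>c. card {(u, v). k \<le> u \<and> u < n \<and> 0 \<le> v \<and> v < k' \<and> int v - int u = c - 1}"
  let ?m = "\<lambda>c. chi k k' c + chi (n - k) (n' - k') (c - int k' + int k) + ?m1 c + ?m2 c"
  have "Dw k k' w * Dw (n - k) (n' - k') (\<lambda>c. w (c + int k' - int k)) *
    (\<Prod>u<k. \<Prod>v\<in>{k'..<n'}. w (int v - int u)) * (\<Prod>v<k'. \<Prod>u\<in>{k..<n}. w (int v - int u + 1)) =
    Dw n n' w * (\<Prod>c\<in>?C. w c ^ (?m c - chi n n' c))" for w :: "int \<Rightarrow> 'c"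
  proof -
    have 1: "Dw k k' w = (\<Prod>c\<in>?C. w c ^ chi k k' c)"
      by (rule Dw_superset) (use assms in auto)
    have 0: "Dw n n' w = (\<Prod>c\<in>?C. w c ^ chi n n' c)"
      by (rule Dw_superset) auto
    have "Dw (n - k) (n' - k') (\<lambda>c. w (c + int k' - int k)) =
      (\<Prod>c\<in>(\<lambda>c. c - int k' + int k) ` ?C. w (c + int k' - int k) ^ chi (n - k) (n' - k') c)"
    proof (rule Dw_superset)
      show "{- int (n - k)<..<int (n' - k')} \<subseteq> (\<lambda>c. c - int k' + int k) ` ?C"
        using assms by (auto intro!: image_eqI[of _ _ "_ + int k' - int k"])
    qed auto
    also have "\<dots> = (\<Prod>c\<in>?C. w c ^ chi (n - k) (n' - k') (c - int k' + int k))"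
      by (subst prod.reindex) (auto simp: inj_on_def)
    finally have 2: "Dw (n - k) (n' - k') (\<lambda>c. w (c + int k' - int k)) =
      (\<Prod>c\<in>?C. w c ^ chi (n - k) (n' - k') (c - int k' + int k))" .
    have "(\<Prod>u<k. \<Prod>v\<in>{k'..<n'}. w (int v - int u)) = (\<Prod>x\<in>{..<k} \<times> {k'..<n'}. w (int (snd x) - int (fst x)))"
      by (simp add: prod.cartesian_product split_def)
    also have "\<dots> = (\<Prod>c\<in>?C. w c ^ card {x \<in> {..<k} \<times> {k'..<n'}. int (snd x) - int (fst x) = c})"
      by (rule prod_pairs_diff) (use assms in auto)
    also have "\<dots> = (\<Prod>c\<in>?C. w c ^ ?m1 c)"
      by (intro prod.cong refl arg_cong2[where f = "(^)"] arg_cong[where f = card]) auto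
    finally have 3: "(\<Prod>u<k. \<Prod>v\<in>{k'..<n'}. w (int v - int u)) = (\<Prod>c\<in>?C. w c ^ ?m1 c)" .
    have "(\<Prod>v<k'. \<Prod>u\<in>{k..<n}. w (int v - int u + 1)) = (\<Prod>x\<in>{k..<n} \<times> {..<k'}. w (int (snd x) - int (fst x) + 1))"
      by (subst prod.swap) (simp add: prod.cartesian_product split_def)
    also have "\<dots> = (\<Prod>c\<in>?C. w c ^ card {x \<in> {k..<n} \<times> {..<k'}. int (snd x) - int (fst x) + 1 = c})"
      by (rule prod_pairs_diff) (use assms in auto)
    also have "\<dots> = (\<Prod>c\<in>?C. w c ^ ?m2 c)"
      by (intro prod.cong refl arg_cong2[where f = "(^)"] arg_cong[where f = card]) auto
    finally have 4: "(\<Prod>v<k'. \<Prod>u\<in>{k..<n}. w (int v - int u + 1)) = (\<Prod>c\<in>?C. w c ^ ?m2 c)" .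
    show ?thesis
      unfolding 0 1 2 3 4 prod.distrib[symmetric] power_add[symmetric]
      by (intro prod.cong refl arg_cong2[where f = "(^)"]) (use chi_split[OF assms] in simp)
  qed
  then show ?thesis by (intro exI[of _ "\<lambda>c. ?m c - chi n n' c"]) blast
qed

section \<open>Specialization to segments\<close>

text \<open>The pair \<open>(a, u)\<close> with \<open>u < len i a\<close> stands for the point $y_{ia} q^u$.  Unlike the parts of a
  composition, the lengths \<open>len i a\<close> may be \<open>0\<close>, so that segments can be shortened without renumbering.\<close>

definition seg :: "('i \<Rightarrow> nat) \<Rightarrow> ('i \<Rightarrow> nat \<Rightarrow> nat) \<Rightarrow> 'i \<Rightarrow> (nat \<times> nat) set"
  where "seg d len i = (SIGMA a:{1..d i}. {..<len i a})"

definition tot :: "('i \<Rightarrow> nat) \<Rightarrow> ('i \<Rightarrow> nat \<Rightarrow> nat) \<Rightarrow> 'i \<Rightarrow> nat"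
  where "tot d len i = (\<Sum>a\<in>{1..d i}. len i a)"

lemma finite_seg [simp]: "finite (seg d len i)"
  by (simp add: seg_def)

lemma idx_seg: "idx (tot d len) (seg d len)"
  by (simp add: idx_def seg_def tot_def)

lemma lsubst_cong:
  assumes "\<And>m v. m \<in> keys E \<Longrightarrow> v \<in> keys m \<Longrightarrow> s v = s' v"
  shows "lsubst s E = lsubst s' E"
  unfolding lsubst_mon mon_def using assms by (auto intro!: sum.cong prod.cong)

lemma down_closed_eq_lessThan:
  assumes "finite S" "\<And>u. Suc u \<in> S \<Longrightarrow> u \<in> S"
  shows "S = {..<card S}"
proof (cases "S = {}")
  case False
  have down: "u \<in> S" if "u + k \<in> S" for u k
    using that by (induction k) (auto intro: assms(2))
  have "S = {..Max S}"
  proof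
    show "{..Max S} \<subseteq> S"
    proof
      fix u assume "u \<in> {..Max S}"
      then have "u + (Max S - u) \<in> S" using Max_in[OF assms(1) False] by simp
      then show "u \<in> S" by (rule down)
    qed
  qed (use assms(1) in auto)
  then have "card S = Suc (Max S)" by (metis card_atMost)
  then show ?thesis using \<open>S = {..Max S}\<close> by (metis lessThan_Suc_atMost)
qed auto

lemma rconst_divide: "rconst (a / b) = rconst a / rconst (b :: 'k::field)"
  by (simp add: divide_inverse rconst_inverse)

context quiver_shuffle
begin

lemma q_power_eq_iff: "q ^ m = q ^ n \<longleftrightarrow> m = n"
  using q_powi_eq_iff[of "int m" "int n"] by simp

definition sp :: "('i \<Rightarrow> nat \<Rightarrow> ('i, 'k) ratfun) \<Rightarrow> 'i \<Rightarrow> nat \<times> nat \<Rightarrow> ('i, 'k) ratfun"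
  where "sp y = (\<lambda>i x. rconst (q powi int (snd x)) * y i (fst x))"

lemma sp_nz: "(\<And>i a. y i a \<noteq> 0) \<Longrightarrow> sp y i x \<noteq> 0"
  using q_nz by (simp add: sp_def)

lemma sp_div: "sp y i x / sp y j z = rconst (q powi (int (snd x) - int (snd z))) * (y i (fst x) / y j (fst z))"
  using q_nz by (simp add: sp_def power_int_diff rconst_divide rconst_power divide_simps)

lemma sp_rvar_inj: "inj_on (sp rvar i) J"
  using q_nz by (auto simp: inj_on_def sp_def rconst_rvar_eq_iff q_power_eq_iff)

definition SG :: "('i \<Rightarrow> nat) \<Rightarrow> ('i, 'k) laurent \<Rightarrow> ('i \<Rightarrow> nat) \<Rightarrow> ('i \<Rightarrow> nat \<Rightarrow> nat) \<Rightarrow>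
    ('i \<Rightarrow> nat \<Rightarrow> ('i, 'k) ratfun) \<Rightarrow> ('i, 'k) ratfun"
  where "SG n E d len y = evJ n E (seg d len) (sp y)"

lemma lfun_SG: "E \<in> SL (tot d len) \<Longrightarrow> lfun d (SG (tot d len) E d len)"
  unfolding SG_def[abs_def] sp_def
  by (rule lfun_evJ[OF _ idx_seg]) (auto simp: seg_def)

text \<open>Empty segments carry no points, so only the nonempty ones have to correspond.\<close>

lemma SG_reindex:
  assumes E: "E \<in> SL n" and n: "n = tot d' len'"
    and r: "\<And>i. bij_betw (r i) {b \<in> {1..d' i}. 0 < len' i b} {a \<in> {1..d i}. 0 < len i a}"
    and len: "\<And>i b. b \<in> {1..d' i} \<Longrightarrow> 0 < len' i b \<Longrightarrow> len' i b = len i (r i b)"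
    and y: "\<And>i a. y i a \<noteq> 0"
  shows "SG n E d' len' (\<lambda>i b. y i (r i b)) = SG n E d len y"
  unfolding SG_def
proof (rule evJ_reindex[where h = "\<lambda>i (b, u). (r i b, u)"])
  show "bij_betw (\<lambda>(b, u). (r i b, u)) (seg d' len' i) (seg d len i)" for i
  proof -
    let ?X = "{b \<in> {1..d' i}. 0 < len' i b}"
    have inj: "inj_on (r i) ?X" and im: "r i ` ?X = {a \<in> {1..d i}. 0 < len i a}"
      using r[of i] by (auto simp: bij_betw_def)
    have "inj_on (\<lambda>(b, u). (r i b, u)) (seg d' len' i)"
      using inj by (force simp: inj_on_def seg_def)
    moreover have "(\<lambda>(b, u). (r i b, u)) ` seg d' len' i = seg d len i" (is "?f ` _ = _")
    proof
      show "?f ` seg d' len' i \<subseteq> seg d len i"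
      proof
        fix x assume "x \<in> ?f ` seg d' len' i"
        then obtain b u where b: "b \<in> {1..d' i}" "u < len' i b" "x = (r i b, u)" by (auto simp: seg_def)
        then have "r i b \<in> {a \<in> {1..d i}. 0 < len i a}" using im by auto
        then show "x \<in> seg d len i" using b len[of b i] by (auto simp: seg_def)
      qed
      show "seg d len i \<subseteq> ?f ` seg d' len' i"
      proof
        fix x assume "x \<in> seg d len i"
        then obtain a u where a: "a \<in> {1..d i}" "u < len i a" "x = (a, u)" by (auto simp: seg_def)
        then have "a \<in> r i ` ?X" using im by auto
        then obtain b where b: "b \<in> ?X" "a = r i b" by blast
        then have "(b, u) \<in> seg d' len' i" using a len[of b i] by (auto simp: seg_def)
        then show "x \<in> ?f ` seg d' len' i" using a b by force
      qed
    qed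
    ultimately show ?thesis by (simp add: bij_betw_def)
  qed
  show "idx n (seg d' len')" using n by (simp add: idx_seg)
qed (use E y sp_nz[of y] sp_nz[of "\<lambda>i b. y i (r i b)"] in \<open>auto simp: sp_def\<close>)

definition Kc :: "nat \<Rightarrow> ('i, 'k) ratfun"
  where "Kc n = (\<Prod>k\<in>{1..n}. 1 - rconst (inverse q ^ k))"

definition aw :: "'e \<Rightarrow> ('i \<Rightarrow> nat \<Rightarrow> ('i, 'k) ratfun) \<Rightarrow> nat \<Rightarrow> nat \<Rightarrow> int \<Rightarrow> ('i, 'k) ratfun"
  where "aw \<alpha> y a b c = 1 - y (tail Q \<alpha>) a * rconst (t \<alpha>) / (y (head Q \<alpha>) b * rconst (q powi c))"

definition Dv :: "('i \<Rightarrow> nat) \<Rightarrow> ('i \<Rightarrow> nat \<Rightarrow> nat) \<Rightarrow> ('i \<Rightarrow> nat \<Rightarrow> ('i, 'k) ratfun) \<Rightarrow> ('i, 'k) ratfun"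
  where "Dv d len y = (\<Prod>i\<in>V. \<Prod>a\<in>{1..d i}. Kc (len i a)) *
    (\<Prod>\<alpha>\<in>arcs Q. \<Prod>a\<in>{1..d (tail Q \<alpha>)}. \<Prod>b\<in>{1..d (head Q \<alpha>)}.
       Dw (len (tail Q \<alpha>) a) (len (head Q \<alpha>) b) (aw \<alpha> y a b))"

lemma spec_divisor_Dv: "spec_divisor Q t q P = Dv (\<lambda>i. length (P i)) (\<lambda>i a. P i ! (a - 1)) rvar"
proof -
  have *: "(\<Prod>c::int. w c ^ chi n n' c) = Dw n n' w" for n n' and w :: "int \<Rightarrow> ('i, 'k) ratfun"
    unfolding Dw_def
  proof (rule Prod_any.expand_superset)
    show "{c. w c ^ chi n n' c \<noteq> 1} \<subseteq> {- int n..int n'}"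
    proof
      fix c assume "c \<in> {c. w c ^ chi n n' c \<noteq> 1}"
      then have "chi n n' c \<noteq> 0" by (metis (mono_tags) mem_Collect_eq power_0)
      then show "c \<in> {- int n..int n'}" using chi_eq_0[of c n n'] by force
    qed
  qed simp
  show ?thesis
    unfolding spec_divisor_def Dv_def Kc_def Let_def * aw_def ..
qed

lemma lfun_aw:
  assumes "\<alpha> \<in> arcs Q" "a \<in> {1..d (tail Q \<alpha>)}" "b \<in> {1..d (head Q \<alpha>)}"
  shows "lfun d (\<lambda>y. aw \<alpha> y a b c)"
proof -
  have "(\<lambda>y :: 'i \<Rightarrow> nat \<Rightarrow> ('i, 'k) ratfun. aw \<alpha> y a b c) =
    (\<lambda>y. 1 - rconst (q powi (- c)) * (y (tail Q \<alpha>) a * rconst (t \<alpha>)) / y (head Q \<alpha>) b)"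
    by (simp add: fun_eq_iff aw_def power_int_minus rconst_inverse divide_inverse mult_ac)
  moreover have "lfun d (\<lambda>y. 1 - rconst (q powi (- c)) * (y (tail Q \<alpha>) a * rconst (t \<alpha>)) / y (head Q \<alpha>) b)"
    by (intro lfun_diff lfun_1 lfun_divide_var lfun_mult lfun_q_powi lfun_var lfun_const R_gens tail_V head_V assms)
  ultimately show ?thesis by (simp only:)
qed

lemma Kc_R: "\<exists>c\<in>R. Kc n = rconst c"
proof -
  have "(\<Prod>k\<in>A. 1 - inverse q ^ k) \<in> R" for A
    by (induction A rule: infinite_finite_induct) (auto intro!: R_1 R_mult R_diff R_power R_gens simp del: power_inverse)
  moreover have "Kc n = rconst (\<Prod>k\<in>{1..n}. 1 - inverse q ^ k)"
  proof -
    have "(\<Prod>k\<in>A. 1 - rconst (inverse q ^ k)) = (rconst (\<Prod>k\<in>A. 1 - inverse q ^ k) :: ('i, 'k) ratfun)" for A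
      by (induction A rule: infinite_finite_induct) auto
    then show ?thesis by (simp add: Kc_def)
  qed
  ultimately show ?thesis by blast
qed

lemma lfun_Kc: "lfun d (\<lambda>y. Kc n)"
  using Kc_R[of n] lfun_const by auto

lemma Kc_nz: "Kc n \<noteq> 0"
proof -
  have "inverse q ^ k \<noteq> 1" if "k \<ge> 1" for k
    using q_power[of k] that by (simp add: power_inverse)
  then have "1 - rconst (inverse q ^ k) \<noteq> (0 :: ('i, 'k) ratfun)" if "k \<ge> 1" for k
    using that by (metis rconst_eq_iff rconst_simps(2) right_minus_eq)
  then show ?thesis by (simp add: Kc_def)
qed

lemma lfun_Dv: "lfun d (Dv d len)"
  unfolding Dv_def[abs_def] Dw_def
  by (intro lfun_mult lfun_prod lfun_power lfun_Kc lfun_aw) auto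

text \<open>The points are q-multiples of variables, possibly of the same variable. A zero would
  force the two variables to agree, making the arrow a loop whose parameter is a power of q; the
  hypothesis on loops excludes this.\<close>

lemma aw_nz:
  assumes "\<alpha> \<in> arcs Q" "\<And>i a. y i a = rconst (q powi e i a) * rvar i (r i a)"
  shows "aw \<alpha> y a b c \<noteq> 0"
proof
  let ?i = "tail Q \<alpha>" and ?j = "head Q \<alpha>"
  assume "aw \<alpha> y a b c = 0"
  then have "y ?i a * rconst (t \<alpha>) = y ?j b * rconst (q powi c)"
    using assms(2)[of ?j b] q_nz by (simp add: aw_def divide_simps split: if_splits)
  then have "rconst (t \<alpha> * q powi e ?i a) * rvar ?i (r ?i a) = rconst (q powi (e ?j b + c)) * rvar ?j (r ?j b)"
    using q_nz by (simp add: assms(2) power_int_add mult_ac)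
  then have "?i = ?j" and "t \<alpha> * q powi e ?i a = q powi (e ?j b + c)"
    using t_nz[OF assms(1)] q_nz by (subst (asm) rconst_rvar_eq_iff; simp)+
  then have "t \<alpha> = q powi (e ?j b + c - e ?i a)"
    using q_nz by (simp add: power_int_diff field_simps)
  then show False using loops[OF assms(1) \<open>?i = ?j\<close>] by blast
qed

lemma Dv_nz:
  assumes "\<And>i a. y i a = rconst (q powi e i a) * rvar i (r i a)"
  shows "Dv d len y \<noteq> 0"
  using aw_nz[OF _ assms] Kc_nz finV finA by (simp add: Dv_def Dw_def)

lemma Dv_rvar_nz: "Dv d len rvar \<noteq> 0"
  by (rule Dv_nz[where e = "\<lambda>_ _. 0" and r = "\<lambda>_ a. a"]) simp

text \<open>This is the form in which it is used that the divisor is coprime to all linear forms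
  z_ia - q^c z_ib.\<close>

lemma Dv_generic_nz: "Dv d len (generic_point i a b c) \<noteq> 0"
  by (rule Dv_nz[where e = "\<lambda>j x. if j = i \<and> x = a then c else 0" and r = "\<lambda>j x. if j = i \<and> x = a then b else x"])
    (simp add: generic_point_def)

lemma Dv_reindex:
  assumes r: "\<And>i. bij_betw (r i) {b \<in> {1..d' i}. 0 < len' i b} {a \<in> {1..d i}. 0 < len i a}"
    and len: "\<And>i b. b \<in> {1..d' i} \<Longrightarrow> 0 < len' i b \<Longrightarrow> len' i b = len i (r i b)"
  shows "Dv d' len' (\<lambda>i b. y i (r i b)) = Dv d len y"
proof -
  have drop: "(\<Prod>a\<in>{1..d i}. f a) = (\<Prod>a\<in>{a \<in> {1..d i}. 0 < len i a}. f a)"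
    if "\<And>a. len i a = 0 \<Longrightarrow> f a = 1" for d :: "'i \<Rightarrow> nat" and len :: "'i \<Rightarrow> nat \<Rightarrow> nat" and i and f :: "nat \<Rightarrow> ('i, 'k) ratfun"
    by (rule prod.mono_neutral_right) (use that in auto)
  have re: "(\<Prod>b\<in>{1..d' i}. g b) = (\<Prod>a\<in>{1..d i}. f a)"
    if "\<And>a. len i a = 0 \<Longrightarrow> f a = 1" "\<And>b. len' i b = 0 \<Longrightarrow> g b = 1"
      "\<And>b. b \<in> {1..d' i} \<Longrightarrow> 0 < len' i b \<Longrightarrow> g b = f (r i b)" for i and f g :: "nat \<Rightarrow> ('i, 'k) ratfun"
  proof -
    have "(\<Prod>b\<in>{1..d' i}. g b) = (\<Prod>b\<in>{b \<in> {1..d' i}. 0 < len' i b}. g b)"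
      using that by (intro drop) auto
    also have "\<dots> = (\<Prod>b\<in>{b \<in> {1..d' i}. 0 < len' i b}. f (r i b))"
      using that by (intro prod.cong) auto
    also have "\<dots> = (\<Prod>a\<in>{a \<in> {1..d i}. 0 < len i a}. f a)"
      by (rule prod.reindex_bij_betw[OF r])
    also have "\<dots> = (\<Prod>a\<in>{1..d i}. f a)"
      using that by (intro drop[symmetric]) auto
    finally show ?thesis .
  qed
  show ?thesis
    unfolding Dv_def
  proof (rule arg_cong2[where f = "(*)"]; rule prod.cong[OF refl])
    show "(\<Prod>b\<in>{1..d' i}. Kc (len' i b)) = (\<Prod>a\<in>{1..d i}. Kc (len i a))" for i
      by (rule re) (use len in \<open>auto simp: Kc_def\<close>)
    fix \<alpha>
    have inner: "(\<Prod>b'\<in>{1..d' (head Q \<alpha>)}. Dw (len' (tail Q \<alpha>) b) (len' (head Q \<alpha>) b') (aw \<alpha> (\<lambda>i b. y i (r i b)) b b')) =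
      (\<Prod>b'\<in>{1..d (head Q \<alpha>)}. Dw (len (tail Q \<alpha>) (r (tail Q \<alpha>) b)) (len (head Q \<alpha>) b') (aw \<alpha> y (r (tail Q \<alpha>) b) b'))"
      if "b \<in> {1..d' (tail Q \<alpha>)}" "0 < len' (tail Q \<alpha>) b" for b
      by (rule re) (use len that in \<open>auto simp: aw_def[abs_def]\<close>)
    show "(\<Prod>b\<in>{1..d' (tail Q \<alpha>)}. \<Prod>b'\<in>{1..d' (head Q \<alpha>)}. Dw (len' (tail Q \<alpha>) b) (len' (head Q \<alpha>) b') (aw \<alpha> (\<lambda>i b. y i (r i b)) b b')) =
      (\<Prod>a\<in>{1..d (tail Q \<alpha>)}. \<Prod>b'\<in>{1..d (head Q \<alpha>)}. Dw (len (tail Q \<alpha>) a) (len (head Q \<alpha>) b') (aw \<alpha> y a b'))"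
      by (rule re) (simp_all only: inner Dw_0 prod.neutral_const)
  qed
qed

text \<open>Integrality restated for all configurations of segments, with empty ones and any order
  allowed, and as an identity of functions of the point. In this form it applies directly to the two
  parts of cut segments.\<close>

definition Sdiv :: "('i \<Rightarrow> nat) \<Rightarrow> ('i, 'k) laurent \<Rightarrow> bool"
  where "Sdiv n E \<longleftrightarrow> (\<forall>d len. tot d len = n \<longrightarrow>
    (\<exists>H. lfun d H \<and> (\<forall>y. (\<forall>i a. y i a \<noteq> 0) \<longrightarrow> SG n E d len y = Dv d len y * H y)))"

definition Sn :: "('i \<Rightarrow> nat) \<Rightarrow> ('i, 'k) laurent set"
  where "Sn n = {E \<in> SL n. \<forall>P. (\<forall>i. composition (n i) (P i)) \<longrightarrow> spec_divisible Q t q P E}"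

lemma tot_composition:
  assumes "\<And>i. composition (n i) (P i)"
  shows "tot (\<lambda>i. length (P i)) (\<lambda>i a. P i ! (a - 1)) = n"
proof
  fix i
  have "tot (\<lambda>i. length (P i)) (\<lambda>i a. P i ! (a - 1)) i = (\<Sum>a<length (P i). P i ! a)"
    unfolding tot_def by (rule sum.reindex_bij_witness[where i = Suc and j = "\<lambda>a. a - 1"]) auto
  also have "\<dots> = n i" using assms[of i] by (simp add: composition_def sum_list_sum_nth atLeast0LessThan)
  finally show "tot (\<lambda>i. length (P i)) (\<lambda>i a. P i ! (a - 1)) i = n i" .
qed

lemma spec_SG:
  assumes E: "E \<in> SL n" and P: "\<And>i. composition (n i) (P i)"
  shows "spec q P E = SG n E (\<lambda>i. length (P i)) (\<lambda>i a. P i ! (a - 1)) rvar"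
proof -
  let ?d = "\<lambda>i. length (P i)" and ?len = "\<lambda>i a. P i ! (a - 1)"
  define L where "L i = concat (map (\<lambda>b. map (\<lambda>c. (b, c)) [0..<P i ! (b - 1)]) [1..<Suc (length (P i))])" for i
  have set: "set (L i) = seg ?d ?len i" for i
    by (auto simp: L_def seg_def)
  have dist: "distinct (L i)" for i
  proof -
    let ?f = "\<lambda>b. map (\<lambda>c. (b, c)) [0..<P i ! (b - 1)]"
    \<comment> \<open>\<open>distinct_concat\<close> asks for pairwise different blocks. Here the
      positivity of the parts of a composition enters: empty blocks would coincide.\<close>
    have "inj_on ?f (set [1..<Suc (length (P i))])"
    proof (rule inj_onI)
      fix b b' assume b: "b \<in> set [1..<Suc (length (P i))]" and eq: "?f b = ?f b'"
      from b have "P i ! (b - 1) \<in> set (P i)" by (intro nth_mem) auto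
      then have "0 < P i ! (b - 1)" using P by (auto simp: composition_def)
      then have "(b, 0) \<in> set (?f b)" by auto
      then have "(b, 0) \<in> set (?f b')" by (simp only: eq)
      then show "b = b'" by auto
    qed
    then show ?thesis
      unfolding L_def by (intro distinct_concat) (auto simp: distinct_map inj_on_def simp del: upt_Suc)
  qed
  have len: "length (L i) = n i" for i
  proof -
    have "card (seg ?d ?len i) = tot ?d ?len i" using idx_seg[of ?d ?len] by (simp add: idx_def)
    also have "\<dots> = n i" by (simp only: tot_composition[OF P])
    finally show ?thesis using distinct_card[OF dist[of i]] set[of i] by simp
  qed
  have "bij_betw (\<lambda>a. L i ! (a - 1)) {1..n i} (seg ?d ?len i)" for i
  proof -
    have "bij_betw (\<lambda>a. a - 1) {1..n i} {..<n i}"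
      by (rule bij_betwI[where g = Suc]) auto
    moreover have "bij_betw ((!) (L i)) {..<n i} (seg ?d ?len i)"
      by (rule bij_betw_nth) (use dist set len in auto)
    ultimately have "bij_betw ((!) (L i) \<circ> (\<lambda>a. a - 1)) {1..n i} (seg ?d ?len i)"
      by (rule bij_betw_trans)
    then show ?thesis by (simp add: o_def)
  qed
  from evJ_eq[OF E this, of "sp rvar"]
  have "SG n E ?d ?len rvar = evl (\<lambda>i a. sp rvar i (L i ! (a - 1))) E"
    by (simp add: SG_def sp_nz)
  also have "\<dots> = spec q P E"
    unfolding spec_def
  proof (rule lsubst_cong)
    fix m v assume mv: "m \<in> keys E" "v \<in> keys m"
    obtain i a where v: "v = Var i a" by (cases v)
    have a: "a - 1 < length (L i)"
      using SL_LR[OF E] mv v len by (force simp: LR_iff lvars_def)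
    have "concat (map (\<lambda>b. map (\<lambda>c. rvar i b * rconst (q ^ c)) [0..<P i ! (b - 1)]) [1..<Suc (length (P i))]) =
      map (\<lambda>x. rvar i (fst x) * rconst (q ^ snd x)) (L i)"
      by (simp add: L_def map_concat o_def)
    then show "(case v of Var i a \<Rightarrow> sp rvar i (L i ! (a - 1))) =
       (case v of Var i a \<Rightarrow> concat (map (\<lambda>b. map (\<lambda>c. rvar i b * rconst (q ^ c)) [0..<P i ! (b - 1)]) [1..<Suc (length (P i))]) ! (a - 1))"
      using a by (simp add: v sp_def mult.commute)
  qed
  finally show ?thesis ..
qed

text \<open>Sorting in descending order makes the resulting partition a canonical representative of
  the configuration, on which the induction on the weight relies.\<close>

lemma drop_empty_segments:
  fixes d :: "'i \<Rightarrow> nat" and len :: "'i \<Rightarrow> nat \<Rightarrow> nat"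
  obtains P r where "\<And>i. composition (tot d len i) (P i)" "\<And>i. sorted (rev (P i))"
    "\<And>i b. b \<in> {1..length (P i)} \<Longrightarrow> r i b \<in> {1..d i}"
    "\<And>i b. b \<in> {1..length (P i)} \<Longrightarrow> P i ! (b - 1) = len i (r i b)"
    "\<And>i. bij_betw (r i) {b \<in> {1..length (P i)}. 0 < P i ! (b - 1)} {a \<in> {1..d i}. 0 < len i a}"
proof -
  define L where "L i = rev (sort_key (len i) (filter (\<lambda>a. len i a > 0) [1..<Suc (d i)]))" for i
  define P where "P i = map (len i) (L i)" for i
  define r where "r i b = L i ! (b - 1)" for i b
  have set: "set (L i) = {a \<in> {1..d i}. 0 < len i a}" for i by (auto simp: L_def)
  have 1: "composition (tot d len i) (P i)" for i
  proof -
    have "distinct (L i)" by (simp add: L_def distinct_filter del: upt_Suc)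
    then have "sum_list (P i) = (\<Sum>a\<in>{a \<in> {1..d i}. 0 < len i a}. len i a)"
      by (simp only: P_def sum_list_distinct_conv_sum_set set)
    also have "\<dots> = tot d len i"
      unfolding tot_def by (rule sum.mono_neutral_left) auto
    finally show ?thesis by (auto simp: composition_def P_def L_def)
  qed
  have 2: "sorted (rev (P i))" for i
    by (simp add: P_def L_def rev_map del: upt_Suc)
  have rmem: "r i b \<in> set (L i)" if "b \<in> {1..length (P i)}" for i b
    using that unfolding r_def by (intro nth_mem) (auto simp: P_def)
  have 3: "P i ! (b - 1) = len i (r i b)" if "b \<in> {1..length (P i)}" for i b
    using that by (auto simp: P_def r_def)
  have 4: "bij_betw (r i) {b \<in> {1..length (P i)}. 0 < P i ! (b - 1)} {a \<in> {1..d i}. 0 < len i a}" for i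
  proof -
    have "{b \<in> {1..length (P i)}. 0 < P i ! (b - 1)} = {1..length (L i)}"
      using 3 rmem set by (auto simp: P_def)
    moreover have "bij_betw (r i) {1..length (L i)} (set (L i))"
    proof -
      have "bij_betw (\<lambda>a. a - 1) {1..length (L i)} {..<length (L i)}"
        by (rule bij_betwI[where g = Suc]) auto
      moreover have "bij_betw ((!) (L i)) {..<length (L i)} (set (L i))"
        by (rule bij_betw_nth) (simp_all add: L_def distinct_filter del: upt_Suc)
      ultimately have "bij_betw ((!) (L i) \<circ> (\<lambda>a. a - 1)) {1..length (L i)} (set (L i))"
        by (rule bij_betw_trans)
      then show ?thesis by (simp add: r_def[abs_def] o_def)
    qed
    ultimately show ?thesis using set by simp
  qed
  show thesis
    by (rule that[OF 1 2 _ 3 4]) (use rmem set in auto)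
qed

text \<open>A configuration is reduced to the composition formed by its nonempty segments, and the
  cofactor found there is pulled back by renaming variables. Conversely, evaluation at the generic
  point recovers the divisibility of \<open>spec\<close>.\<close>

lemma Sn_iff: "E \<in> Sn n \<longleftrightarrow> E \<in> SL n \<and> Sdiv n E"
proof
  assume "E \<in> Sn n"
  then have E: "E \<in> SL n" and div: "\<And>P. (\<And>i. composition (n i) (P i)) \<Longrightarrow> spec_divisible Q t q P E"
    by (auto simp: Sn_def)
  have "Sdiv n E"
    unfolding Sdiv_def
  proof (intro allI impI)
    fix d len assume n: "tot d len = n"
    obtain P r where P: "\<And>i. composition (tot d len i) (P i)"
      and r: "\<And>i b. b \<in> {1..length (P i)} \<Longrightarrow> r i b \<in> {1..d i}"
        "\<And>i b. b \<in> {1..length (P i)} \<Longrightarrow> P i ! (b - 1) = len i (r i b)"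
        "\<And>i. bij_betw (r i) {b \<in> {1..length (P i)}. 0 < P i ! (b - 1)} {a \<in> {1..d i}. 0 < len i a}"
      by (rule drop_empty_segments[of d len]) blast
    let ?d = "\<lambda>i. length (P i)" and ?len = "\<lambda>i a. P i ! (a - 1)"
    have P': "\<And>i. composition (n i) (P i)" using P n by simp
    have n': "tot ?d ?len = n" by (rule tot_composition[OF P'])
    from div[OF P'] obtain H where H: "H \<in> LR ?d" "spec q P E = spec_divisor Q t q P * to_fract H"
      by (auto simp: spec_divisible_def)
    have eq: "SG n E ?d ?len y = Dv ?d ?len y * evl y H" if "\<And>i a. y i a \<noteq> 0" for y
    proof (rule lfun_eqI[of ?d _ ?d "\<lambda>y. Dv ?d ?len y * evl y H"])
      show "lfun ?d (SG n E ?d ?len)" using lfun_SG[of E ?d ?len] E n' by simp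
      show "lfun ?d (\<lambda>y. Dv ?d ?len y * evl y H)" by (intro lfun_mult lfun_Dv lfun_evl H)
      show "SG n E ?d ?len rvar = Dv ?d ?len rvar * evl rvar H"
        using H(2) by (simp add: spec_SG[OF E P'] spec_divisor_Dv lsubst_rvar)
    qed (rule that)
    have "SG n E d len y = Dv d len y * evl (\<lambda>i b. y i (r i b)) H" if nz: "\<forall>i a. y i a \<noteq> 0" for y
    proof -
      have "SG n E d len y = SG n E ?d ?len (\<lambda>i b. y i (r i b))"
        by (rule SG_reindex[OF E n'[symmetric] r(3) r(2), symmetric]) (use nz in auto)
      also have "\<dots> = Dv ?d ?len (\<lambda>i b. y i (r i b)) * evl (\<lambda>i b. y i (r i b)) H"
        by (rule eq) (use nz in auto)
      also have "Dv ?d ?len (\<lambda>i b. y i (r i b)) = Dv d len y"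
        by (rule Dv_reindex[OF r(3) r(2)])
      finally show ?thesis .
    qed
    moreover have "lfun d (\<lambda>y. evl (\<lambda>i b. y i (r i b)) H)"
      by (rule lfun_rename[OF lfun_evl[OF H(1)] r(1)])
    ultimately show "\<exists>H. lfun d H \<and> (\<forall>y. (\<forall>i a. y i a \<noteq> 0) \<longrightarrow> SG n E d len y = Dv d len y * H y)"
      by (intro exI[of _ "\<lambda>y. evl (\<lambda>i b. y i (r i b)) H"]) auto
  qed
  with E show "E \<in> SL n \<and> Sdiv n E" by simp
next
  assume "E \<in> SL n \<and> Sdiv n E"
  then have E: "E \<in> SL n" and div: "Sdiv n E" by auto
  have "spec_divisible Q t q P E" if P: "\<forall>i. composition (n i) (P i)" for P
  proof -
    let ?d = "\<lambda>i. length (P i)" and ?len = "\<lambda>i a. P i ! (a - 1)"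
    obtain H where H: "lfun ?d H" "\<forall>y. (\<forall>i a. y i a \<noteq> 0) \<longrightarrow> SG n E ?d ?len y = Dv ?d ?len y * H y"
    proof -
      have "tot ?d ?len = n" by (rule tot_composition) (use P in auto)
      from div[unfolded Sdiv_def, rule_format, OF this] that show ?thesis by blast
    qed
    from H(1) obtain F where F: "F \<in> LR ?d" "\<And>p. (\<And>i a. p i a \<noteq> 0) \<Longrightarrow> H p = evl p F"
      by (rule lfunE) blast
    have "spec q P E = spec_divisor Q t q P * to_fract F"
      using H(2) F(2)[of rvar] P by (simp add: spec_SG[OF E] spec_divisor_Dv lsubst_rvar)
    then show ?thesis using F(1) unfolding spec_divisible_def by blast
  qed
  with E show "E \<in> Sn n" by (simp add: Sn_def)
qed

end

section \<open>The integral shuffle algebra is closed under the product\<close>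

lemma prod_Sigma2:
  assumes "finite S" "finite S'" "\<And>a. finite (K a)" "\<And>b. finite (K' b)"
  shows "(\<Prod>x\<in>Sigma S K. \<Prod>z\<in>Sigma S' K'. f x z) =
    (\<Prod>a\<in>S. \<Prod>b\<in>S'. \<Prod>u\<in>K a. \<Prod>v\<in>K' b. f (a, u) (b, v) :: 'c::comm_monoid_mult)"
proof -
  have "(\<Prod>x\<in>Sigma S K. \<Prod>z\<in>Sigma S' K'. f x z) = (\<Prod>x\<in>Sigma S K. \<Prod>b\<in>S'. \<Prod>v\<in>K' b. f x (b, v))"
    using assms by (simp add: prod.Sigma split_def)
  also have "\<dots> = (\<Prod>a\<in>S. \<Prod>u\<in>K a. \<Prod>b\<in>S'. \<Prod>v\<in>K' b. f (a, u) (b, v))"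
    using assms by (subst prod.Sigma) (simp_all add: split_def)
  also have "\<dots> = (\<Prod>a\<in>S. \<Prod>b\<in>S'. \<Prod>u\<in>K a. \<Prod>v\<in>K' b. f (a, u) (b, v))"
    by (intro prod.cong refl prod.swap)
  finally show ?thesis .
qed

context quiver_shuffle
begin

definition qz :: "int \<Rightarrow> ('i, 'k) ratfun"
  where "qz e = 1 - rconst (q powi (- e))"

lemma qz_nz: "e \<noteq> 0 \<Longrightarrow> qz e \<noteq> 0"
  using q_powi_eq_1_iff[of "- e"] rconst_eq_iff[of "q powi (- e)" 1] by (auto simp: qz_def)

lemma Kc_Suc: "Kc (Suc n) = Kc n * qz (int (Suc n))"
proof -
  have "q powi (- int (Suc n)) = inverse q ^ Suc n"
    by (simp only: power_int_minus power_int_of_nat power_inverse)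
  then show ?thesis by (simp add: Kc_def qz_def)
qed

lemma qz_telescope:
  assumes "k \<le> v"
  shows "(\<Prod>u<k. qz (int v - int u + 1) / qz (int v - int u)) = qz (int v + 1) / qz (int v - int k + 1)"
  using assms
proof (induction k)
  case 0
  then show ?case using qz_nz[of "int v + 1"] by simp
next
  case (Suc k)
  have "qz (int v - int k + 1) \<noteq> 0" using Suc.prems by (intro qz_nz) auto
  then show ?case using Suc by (simp add: algebra_simps)
qed

text \<open>The product is the Gaussian binomial coefficient in 1/q. It consists of the zeta factors
  between the two parts of one cut segment, so these supply exactly what the constants of the parts
  lack.\<close>

lemma Kc_split:
  "Kc k * Kc m * (\<Prod>u<k. \<Prod>v\<in>{k..<k + m}. qz (int v - int u + 1) / qz (int v - int u)) = Kc (k + m)"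
proof (induction m)
  case (Suc m)
  have "(\<Prod>u<k. \<Prod>v\<in>{k..<k + Suc m}. qz (int v - int u + 1) / qz (int v - int u)) =
    (\<Prod>u<k. \<Prod>v\<in>{k..<k + m}. qz (int v - int u + 1) / qz (int v - int u)) *
    (\<Prod>u<k. qz (int (k + m) - int u + 1) / qz (int (k + m) - int u))"
    by (simp flip: prod.distrib)
  also have "(\<Prod>u<k. qz (int (k + m) - int u + 1) / qz (int (k + m) - int u)) = qz (int (Suc (k + m))) / qz (int (Suc m))"
    by (subst qz_telescope) (simp_all add: algebra_simps)
  finally show ?case
    using Suc.IH qz_nz[of "int (Suc m)"] by (simp only: Kc_Suc add_Suc_right) (simp add: field_simps)
qed (simp add: Kc_def)

lemma shuf_term_eq_0:
  assumes "i \<in> V" "(a, Suc u) \<in> A i" "(a, u) \<in> B i" "finite (A i)" "finite (B i)" "\<And>i a. y i a \<noteq> 0"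
  shows "shuf_term n n' E E' A B (sp y) = 0"
proof -
  have "1 - sp y i (a, Suc u) / sp y i (a, u) * rconst (inverse q) = 0"
    using assms(6) q_nz by (simp add: sp_div rconst_inverse)
  then have "(\<Prod>i\<in>V. \<Prod>a\<in>A i. \<Prod>b\<in>B i. (1 - sp y i a / sp y i b * rconst (inverse q)) / (1 - sp y i a / sp y i b)) = 0"
    by (intro prod_zero[OF finV] bexI[OF _ assms(1)] prod_zero[OF assms(4)] bexI[OF _ assms(2)]
        prod_zero[OF assms(5)] bexI[OF _ assms(3)]) simp
  then show ?thesis by (simp add: shuf_term_def zeta_prod)
qed

text \<open>For the points (a, u) and (b, v) with x = (u, v): \<open>ell\<close> vanishes where they
  coincide, \<open>kap\<close> is the factor (1 - z/q)/(1 - z) of zeta at their quotient z, and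
  \<open>nu\<close> is the product of the two with the denominator cancelled.\<close>

definition ell :: "'i \<Rightarrow> nat \<Rightarrow> nat \<Rightarrow> nat \<times> nat \<Rightarrow> ('i \<Rightarrow> nat \<Rightarrow> ('i, 'k) ratfun) \<Rightarrow> ('i, 'k) ratfun"
  where "ell i a b x y = y i a - rconst (q powi (int (snd x) - int (fst x))) * y i b"

definition kap :: "'i \<Rightarrow> nat \<Rightarrow> nat \<Rightarrow> nat \<times> nat \<Rightarrow> ('i \<Rightarrow> nat \<Rightarrow> ('i, 'k) ratfun) \<Rightarrow> ('i, 'k) ratfun"
  where "kap i a b x y = (1 - sp y i (a, fst x) / sp y i (b, snd x) * rconst (inverse q)) /
    (1 - sp y i (a, fst x) / sp y i (b, snd x))"

definition nu :: "'i \<Rightarrow> nat \<Rightarrow> nat \<Rightarrow> nat \<times> nat \<Rightarrow> ('i \<Rightarrow> nat \<Rightarrow> ('i, 'k) ratfun) \<Rightarrow> ('i, 'k) ratfun"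
  where "nu i a b x y = (1 - rconst (q powi (int (fst x) - int (snd x) - 1)) * y i a / y i b) *
     - (rconst (q powi (int (snd x) - int (fst x))) * y i b)"

lemma ell_kap:
  assumes "\<And>i a. y i a \<noteq> 0" "ell i a b x y \<noteq> 0"
  shows "ell i a b x y * kap i a b x y = nu i a b x y"
proof -
  let ?c = "rconst (q powi (int (snd x) - int (fst x))) :: ('i, 'k) ratfun" and ?e = "int (fst x) - int (snd x)"
  have c: "?c * rconst (q powi ?e) = 1"
    by (simp flip: rconst_simps(6) power_int_add add: q_nz)
  have q1: "rconst (q powi (?e - 1)) = (rconst (q powi ?e) * rconst (inverse q) :: ('i, 'k) ratfun)"
    using q_nz by (simp add: power_int_diff rconst_divide rconst_inverse divide_inverse)
  have den: "ell i a b x y = - (?c * y i b) * (1 - sp y i (a, fst x) / sp y i (b, snd x))"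
    using assms(1)[of i b] c by (simp add: ell_def sp_div algebra_simps)
  then have "1 - sp y i (a, fst x) / sp y i (b, snd x) \<noteq> 0" using assms(2) by auto
  then show ?thesis
    unfolding den kap_def nu_def q1 using assms(1) by (simp add: sp_div mult_ac)
qed

lemma lfun_ell: "i \<in> V \<Longrightarrow> a \<in> {1..d i} \<Longrightarrow> b \<in> {1..d i} \<Longrightarrow> lfun d (ell i a b x)"
  unfolding ell_def[abs_def] by (intro lfun_diff lfun_mult lfun_var lfun_q_powi)

lemma lfun_nu: "i \<in> V \<Longrightarrow> a \<in> {1..d i} \<Longrightarrow> b \<in> {1..d i} \<Longrightarrow> lfun d (nu i a b x)"
  unfolding nu_def[abs_def]
  by (intro lfun_diff lfun_mult lfun_var lfun_q_powi lfun_uminus lfun_divide_var lfun_1)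

lemma kap_self:
  assumes "\<And>i a. y i a \<noteq> 0"
  shows "kap i a a x y = qz (int (snd x) - int (fst x) + 1) / qz (int (snd x) - int (fst x))"
proof -
  have "q powi (- (int (snd x) - int (fst x) + 1)) = q powi (int (fst x) - int (snd x)) * inverse q"
    using q_nz by (simp add: power_int_diff divide_inverse)
  then show ?thesis using assms by (simp add: kap_def sp_div qz_def)
qed

lemma aw_sp:
  assumes "i = tail Q \<alpha>" "j = head Q \<alpha>"
  shows "1 - sp y i (a, u) / sp y j (b, v) * rconst (t \<alpha>) = aw \<alpha> y a b (int v - int u)"
    and "1 - rconst (t \<alpha>) / (sp y j (b, v) / sp y i (a, u) * rconst q) = aw \<alpha> y a b (int v - int u + 1)"
proof -
  have "rconst (q powi (int u - int v)) = (inverse (rconst (q powi (int v - int u))) :: ('i, 'k) ratfun)"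
    by (simp flip: rconst_inverse power_int_minus)
  then show "1 - sp y i (a, u) / sp y j (b, v) * rconst (t \<alpha>) = aw \<alpha> y a b (int v - int u)"
    unfolding sp_div aw_def assms by (simp add: divide_inverse mult_ac)
  have "rconst (q powi (int v - int u + 1)) = (rconst (q powi (int v - int u)) * rconst q :: ('i, 'k) ratfun)"
    using q_nz by (simp add: power_int_add)
  then show "1 - rconst (t \<alpha>) / (sp y j (b, v) / sp y i (a, u) * rconst q) = aw \<alpha> y a b (int v - int u + 1)"
    unfolding sp_div aw_def assms by (simp add: divide_inverse mult_ac)
qed

lemma aw_shift: "aw \<alpha> (\<lambda>i a. rconst (q ^ k i a) * y i a) a b c =
  aw \<alpha> y a b (c + int (k (head Q \<alpha>) b) - int (k (tail Q \<alpha>) a))"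
proof -
  have "rconst (q powi (c + int (k (head Q \<alpha>) b) - int (k (tail Q \<alpha>) a))) =
    (rconst (q powi c) * rconst (q ^ k (head Q \<alpha>) b) / rconst (q ^ k (tail Q \<alpha>) a) :: ('i, 'k) ratfun)"
    using q_nz by (simp add: power_int_diff power_int_add rconst_divide)
  then show ?thesis using q_nz by (simp add: aw_def mult_ac)
qed

text \<open>All pairs of points from different segments of one colour, whether or not they are
  separated by the cut. So \<open>Den\<close> is a common denominator for all summands. Pairs within
  one segment are left out since their quotients are constants.\<close>

definition den :: "('i \<Rightarrow> nat) \<Rightarrow> ('i \<Rightarrow> nat \<Rightarrow> nat) \<Rightarrow> ('i \<times> nat \<times> nat \<times> nat \<times> nat) set"
  where "den d len = (SIGMA i:V. SIGMA a:{1..d i}. SIGMA b:{1..d i} - {a}. {..<len i a} \<times> {..<len i b})"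

definition Den :: "('i \<Rightarrow> nat) \<Rightarrow> ('i \<Rightarrow> nat \<Rightarrow> nat) \<Rightarrow> ('i \<Rightarrow> nat \<Rightarrow> ('i, 'k) ratfun) \<Rightarrow> ('i, 'k) ratfun"
  where "Den d len y = (\<Prod>(i, a, b, x)\<in>den d len. ell i a b x y)"

lemma finite_den: "finite (den d len)"
  unfolding den_def using finV by (intro finite_SigmaI) auto

lemma Den_eq: "Den d len y =
  (\<Prod>i\<in>V. \<Prod>a\<in>{1..d i}. \<Prod>b\<in>{1..d i} - {a}. \<Prod>x\<in>{..<len i a} \<times> {..<len i b}. ell i a b x y)"
  unfolding Den_def den_def using finV by (simp add: prod.Sigma split_def)

lemma Den_rvar_nz: "Den d len rvar \<noteq> 0"
  unfolding Den_def using finite_den[of d len] linear_form_nz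
  by (subst prod_zero_iff) (auto simp: ell_def den_def)

lemma Diff_seg:
  assumes "\<And>a. a \<in> {1..d i} \<Longrightarrow> k i a \<le> len i a"
  shows "seg d len i - seg d k i = (SIGMA a:{1..d i}. {k i a..<len i a})"
  using assms by (auto simp: seg_def not_less)

lemma tot_diff:
  assumes "\<And>a. a \<in> {1..d i} \<Longrightarrow> k i a \<le> len i a"
  shows "tot d k i + tot d (\<lambda>i a. len i a - k i a) i = tot d len i"
  unfolding tot_def sum.distrib[symmetric] by (rule sum.cong) (use assms in auto)

lemma evJ_Diff_seg:
  assumes E': "E' \<in> SL n'" and k: "\<And>i a. a \<in> {1..d i} \<Longrightarrow> k i a \<le> len i a"
    and m: "tot d (\<lambda>i a. len i a - k i a) = n'" and y: "\<And>i a. y i a \<noteq> 0"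
  shows "evJ n' E' (\<lambda>i. seg d len i - seg d k i) (sp y) =
    SG n' E' d (\<lambda>i a. len i a - k i a) (\<lambda>i a. rconst (q ^ k i a) * y i a)"
proof -
  let ?m = "\<lambda>i a. len i a - k i a" and ?y' = "\<lambda>i a. rconst (q ^ k i a) * y i a"
  have B: "seg d len i - seg d k i = (SIGMA a:{1..d i}. {k i a..<len i a})" for i by (rule Diff_seg) (rule k)
  show ?thesis
    unfolding SG_def
  proof (rule evJ_reindex[OF E', where h = "\<lambda>i (a, u). (a, u + k i a)", symmetric])
    show "idx n' (seg d ?m)" using idx_seg[of d ?m] m by simp
    show "bij_betw (\<lambda>(a, u). (a, u + k i a)) (seg d ?m i) (seg d len i - seg d k i)" for i
      unfolding B
      by (rule bij_betwI[where g = "\<lambda>(a, u). (a, u - k i a)"]) (auto simp: seg_def)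
    show "sp ?y' i x = sp y i (case x of (a, u) \<Rightarrow> (a, u + k i a))" for i x
      by (auto simp: sp_def power_add split_def)
    show "sp y i x \<noteq> 0" for i x by (rule sp_nz) (rule y)
    show "sp ?y' i x \<noteq> 0" for i x by (rule sp_nz) (use y q_nz in auto)
  qed
qed

text \<open>If (a, u + 1) goes to the first factor and (a, u) to the second, their quotient is q, a
  zero of zeta. So each fibre of \<open>A\<close> is closed downwards. For colours outside
  \<open>V\<close> there is no zeta factor, but there the degree is 0.\<close>

lemma shuf_term_nonzero:
  assumes n: "n \<in> degrees Q" and A: "A \<in> Subs n (seg d len)" and y: "\<And>i a. y i a \<noteq> 0"
    and nz: "shuf_term n n' E E' A (\<lambda>i. seg d len i - A i) (sp y) \<noteq> 0"
  obtains k where "A = seg d k" "\<And>i a. k i a \<le> len i a" "tot d k = n"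
proof -
  have sub: "A i \<subseteq> seg d len i" and card: "card (A i) = n i" for i using A by (auto simp: Subs_def)
  have down: "(a, u) \<in> A i" if "i \<in> V" "(a, Suc u) \<in> A i" for i a u
  proof (rule ccontr)
    assume "(a, u) \<notin> A i"
    moreover have "(a, u) \<in> seg d len i" using sub[of i] that by (auto simp: seg_def)
    ultimately have "shuf_term n n' E E' A (\<lambda>i. seg d len i - A i) (sp y) = 0"
      using that finite_subset[OF sub[of i]] y by (intro shuf_term_eq_0[of i a u]) auto
    with nz show False by simp
  qed
  define k where "k i a = card {u. (a, u) \<in> A i}" for i a
  have lek: "{u. (a, u) \<in> A i} \<subseteq> {..<len i a}" for i a
    using sub[of i] by (auto simp: seg_def)
  then have fin: "finite {u. (a, u) \<in> A i}" for i a using finite_subset by blast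
  have eq: "{u. (a, u) \<in> A i} = {..<k i a}" for i a
  proof (cases "i \<in> V")
    case True
    then show ?thesis unfolding k_def using down by (intro down_closed_eq_lessThan fin) auto
  next
    case False
    then have "n i = 0" using degrees_D n by blast
    then have "A i = {}" using card[of i] finite_subset[OF sub[of i]] by simp
    then show ?thesis by (simp add: k_def)
  qed
  have A: "A = seg d k"
  proof -
    have "(a, u) \<in> A i \<longleftrightarrow> (a, u) \<in> seg d k i" for i a u
    proof -
      have "(a, u) \<in> A i \<longleftrightarrow> u < k i a"
        using eq by blast
      moreover have "a \<in> {1..d i}" if "(a, u) \<in> A i"
        using sub[of i] that by (auto simp: seg_def)
      ultimately show ?thesis by (auto simp: seg_def)
    qed
    then show ?thesis by auto
  qed
  have "k i a \<le> len i a" for i a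
    using card_mono[OF _ lek[of a i]] by (simp add: k_def)
  moreover have "tot d k = n"
  proof
    fix i show "tot d k i = n i" using idx_seg[of d k] card[of i] A by (simp add: idx_def)
  qed
  ultimately show thesis using A that by blast
qed

text \<open>The factors are collected by origin. The constants of the two parts and zeta inside one
  segment give the constants of the whole; zeta between different segments of one colour, times
  \<open>Den\<close>, gives the polynomials \<open>M\<close>; the arrow products of the parts and
  the arrow factors of zeta give those of the whole times the surplus \<open>W\<close>. The claim is
  made at the generic point only, where no denominator vanishes.\<close>

lemma shuf_term_split:
  assumes E: "E \<in> SL n" "E' \<in> SL n'" and S: "Sdiv n E" "Sdiv n' E'"
    and N: "tot d len = (\<lambda>i. n i + n' i)" and k: "\<And>i a. a \<in> {1..d i} \<Longrightarrow> k i a \<le> len i a" and n: "tot d k = n"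
  shows "\<exists>G. lfun d G \<and> Den d len rvar * shuf_term n n' E E' (seg d k) (\<lambda>i. seg d len i - seg d k i) (sp rvar) = Dv d len rvar * G rvar"
proof -
  let ?A = "seg d k" and ?B = "\<lambda>i. seg d len i - seg d k i"
  let ?m = "\<lambda>i a. len i a - k i a"
  let ?y' = "\<lambda>y i a. rconst (q ^ k i a) * y i a"
  let ?r = "rvar :: 'i \<Rightarrow> nat \<Rightarrow> ('i, 'k) ratfun"
  have B: "?B i = (SIGMA a:{1..d i}. {k i a..<len i a})" for i by (rule Diff_seg) (rule k)
  have m: "tot d ?m = n'"
  proof
    fix i show "tot d ?m i = n' i" using tot_diff[of d i k len] k n N by simp
  qed
  obtain H where H: "lfun d H" "\<And>y. \<forall>i a. y i a \<noteq> 0 \<Longrightarrow> SG n E d k y = Dv d k y * H y"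
    using S(1)[unfolded Sdiv_def, rule_format, OF n] by blast
  obtain H' where H': "lfun d H'" "\<And>y. \<forall>i a. y i a \<noteq> 0 \<Longrightarrow> SG n' E' d ?m y = Dv d ?m y * H' y"
    using S(2)[unfolded Sdiv_def, rule_format, OF m] by blast
  have ev: "evJ n E ?A (sp ?r) = Dv d k ?r * H ?r"
    using H(2)[of ?r] by (simp add: SG_def)
  have ev': "evJ n' E' ?B (sp ?r) = Dv d ?m (?y' ?r) * H' (?y' ?r)"
    using evJ_Diff_seg[OF E(2) k m, of ?r] H'(2)[of "?y' ?r"] q_nz by simp
  \<comment> \<open>A choice function: the surplus exponents may depend on both lengths and both
    cuts, but must not depend on the point.\<close>
  define \<delta> where "\<delta> k n k' n' = (SOME \<delta>. \<forall>w :: int \<Rightarrow> ('i, 'k) ratfun.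
    Dw k k' w * Dw (n - k) (n' - k') (\<lambda>c. w (c + int k' - int k)) *
    (\<Prod>u<k. \<Prod>v\<in>{k'..<n'}. w (int v - int u)) * (\<Prod>v<k'. \<Prod>u\<in>{k..<n}. w (int v - int u + 1)) =
    Dw n n' w * (\<Prod>c\<in>{- int (n + n')..int (n + n')}. w c ^ \<delta> c))" for k n k' n'
  have \<delta>: "Dw k k' w * Dw (n - k) (n' - k') (\<lambda>c. w (c + int k' - int k)) *
    (\<Prod>u<k. \<Prod>v\<in>{k'..<n'}. w (int v - int u)) * (\<Prod>v<k'. \<Prod>u\<in>{k..<n}. w (int v - int u + 1)) =
    Dw n n' w * (\<Prod>c\<in>{- int (n + n')..int (n + n')}. w c ^ \<delta> k n k' n' c)"
    if "k \<le> n" "k' \<le> n'" for k n k' n' and w :: "int \<Rightarrow> ('i, 'k) ratfun"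
    using someI_ex[OF Dw_split[OF that, where 'c = "('i, 'k) ratfun"]] unfolding \<delta>_def by blast
  define W where "W \<alpha> a b y = (\<Prod>c\<in>{- int (len (tail Q \<alpha>) a + len (head Q \<alpha>) b)..int (len (tail Q \<alpha>) a + len (head Q \<alpha>) b)}.
     aw \<alpha> y a b c ^ \<delta> (k (tail Q \<alpha>) a) (len (tail Q \<alpha>) a) (k (head Q \<alpha>) b) (len (head Q \<alpha>) b) c)" for \<alpha> a b y
  have arr1: "(\<Prod>x\<in>?A i. \<Prod>z\<in>?B j. 1 - sp ?r i x / sp ?r j z * rconst (t \<alpha>)) =
     (\<Prod>a\<in>{1..d i}. \<Prod>b\<in>{1..d j}. \<Prod>u<k i a. \<Prod>v\<in>{k j b..<len j b}. aw \<alpha> ?r a b (int v - int u))"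
    if "i = tail Q \<alpha>" "j = head Q \<alpha>" for i j \<alpha>
    unfolding B unfolding seg_def[of d k] by (subst prod_Sigma2) (simp_all only: aw_sp[OF that] finite_atLeastAtMost finite_lessThan finite_atLeastLessThan)
  have arr2: "(\<Prod>x\<in>?A j. \<Prod>z\<in>?B i. 1 - rconst (t \<alpha>) / (sp ?r j x / sp ?r i z * rconst q)) =
     (\<Prod>a\<in>{1..d i}. \<Prod>b\<in>{1..d j}. \<Prod>v<k j b. \<Prod>u\<in>{k i a..<len i a}. aw \<alpha> ?r a b (int v - int u + 1))"
    if "i = tail Q \<alpha>" "j = head Q \<alpha>" for i j \<alpha>
    unfolding B unfolding seg_def[of d k]
    by (subst prod_Sigma2[OF finite_atLeastAtMost finite_atLeastAtMost finite_lessThan finite_atLeastLessThan],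
        subst prod.swap) (simp only: aw_sp[OF that])
  have arrows: "(\<Prod>a\<in>{1..d (tail Q \<alpha>)}. \<Prod>b\<in>{1..d (head Q \<alpha>)}. Dw (k (tail Q \<alpha>) a) (k (head Q \<alpha>) b) (aw \<alpha> ?r a b)) *
     (\<Prod>a\<in>{1..d (tail Q \<alpha>)}. \<Prod>b\<in>{1..d (head Q \<alpha>)}. Dw (?m (tail Q \<alpha>) a) (?m (head Q \<alpha>) b) (aw \<alpha> (?y' ?r) a b)) *
     arrow_part ?A ?B (sp ?r) \<alpha> =
     (\<Prod>a\<in>{1..d (tail Q \<alpha>)}. \<Prod>b\<in>{1..d (head Q \<alpha>)}. Dw (len (tail Q \<alpha>) a) (len (head Q \<alpha>) b) (aw \<alpha> ?r a b)) *
     (\<Prod>a\<in>{1..d (tail Q \<alpha>)}. \<Prod>b\<in>{1..d (head Q \<alpha>)}. W \<alpha> a b ?r)" for \<alpha>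
    unfolding arrow_part_def arr1[OF refl refl] arr2[OF refl refl] prod.distrib[symmetric] W_def mult.assoc[symmetric]
  proof (intro prod.cong refl)
    fix a b assume "a \<in> {1..d (tail Q \<alpha>)}" "b \<in> {1..d (head Q \<alpha>)}"
    then have le: "k (tail Q \<alpha>) a \<le> len (tail Q \<alpha>) a" "k (head Q \<alpha>) b \<le> len (head Q \<alpha>) b" using k by auto
    have sh: "aw \<alpha> (?y' ?r) a b = (\<lambda>c. aw \<alpha> ?r a b (c + int (k (head Q \<alpha>) b) - int (k (tail Q \<alpha>) a)))"
      by (rule ext) (rule aw_shift)
    show "Dw (k (tail Q \<alpha>) a) (k (head Q \<alpha>) b) (aw \<alpha> ?r a b) *
       Dw (?m (tail Q \<alpha>) a) (?m (head Q \<alpha>) b) (aw \<alpha> (?y' ?r) a b) *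
       (\<Prod>u<k (tail Q \<alpha>) a. \<Prod>v\<in>{k (head Q \<alpha>) b..<len (head Q \<alpha>) b}. aw \<alpha> ?r a b (int v - int u)) *
       (\<Prod>v<k (head Q \<alpha>) b. \<Prod>u\<in>{k (tail Q \<alpha>) a..<len (tail Q \<alpha>) a}. aw \<alpha> ?r a b (int v - int u + 1)) =
       Dw (len (tail Q \<alpha>) a) (len (head Q \<alpha>) b) (aw \<alpha> ?r a b) *
       (\<Prod>c\<in>{- int (len (tail Q \<alpha>) a + len (head Q \<alpha>) b)..int (len (tail Q \<alpha>) a + len (head Q \<alpha>) b)}.
         aw \<alpha> ?r a b c ^ \<delta> (k (tail Q \<alpha>) a) (len (tail Q \<alpha>) a) (k (head Q \<alpha>) b) (len (head Q \<alpha>) b) c)"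
      unfolding sh by (rule \<delta>[OF le])
  qed
  let ?K = "\<lambda>i a b. {..<k i a} \<times> {k i b..<len i b}" and ?L = "\<lambda>i a b. {..<len i a} \<times> {..<len i b}"
  \<comment> \<open>Pairs separated by the cut have their denominator cancelled; the other factors
    of \<open>Den\<close> remain.\<close>
  define M where "M i a b y = (\<Prod>x\<in>?K i a b. nu i a b x y) * (\<Prod>x\<in>?L i a b - ?K i a b. ell i a b x y)" for i a b y
  have diff: "(\<Prod>x\<in>?L i a b. ell i a b x ?r) * (\<Prod>x\<in>?K i a b. kap i a b x ?r) = M i a b ?r"
    if "a \<in> {1..d i}" "b \<in> {1..d i} - {a}" for i a b
  proof -
    have "?K i a b \<subseteq> ?L i a b" using k[of a i] that by auto
    then have "(\<Prod>x\<in>?L i a b. ell i a b x ?r) = (\<Prod>x\<in>?L i a b - ?K i a b. ell i a b x ?r) * (\<Prod>x\<in>?K i a b. ell i a b x ?r)"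
      by (intro prod.subset_diff) auto
    moreover have "(\<Prod>x\<in>?K i a b. ell i a b x ?r) * (\<Prod>x\<in>?K i a b. kap i a b x ?r) = (\<Prod>x\<in>?K i a b. nu i a b x ?r)"
      unfolding prod.distrib[symmetric]
      by (intro prod.cong refl ell_kap) (use that linear_form_nz in \<open>auto simp: ell_def\<close>)
    ultimately show ?thesis by (simp add: M_def mult_ac)
  qed
  have self: "Kc (k i a) * Kc (?m i a) * (\<Prod>x\<in>?K i a a. kap i a a x ?r) = Kc (len i a)" if "a \<in> {1..d i}" for i a
    using Kc_split[of "k i a" "?m i a"] k[OF that] kap_self[of ?r]
    by (simp add: prod.cartesian_product split_def)
  have diag: "(\<Prod>i\<in>V. \<Prod>a\<in>{1..d i}. Kc (k i a)) * (\<Prod>i\<in>V. \<Prod>a\<in>{1..d i}. Kc (?m i a)) * Den d len ?r *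
    (\<Prod>i\<in>V. \<Prod>x\<in>?A i. \<Prod>z\<in>?B i. (1 - sp ?r i x / sp ?r i z * rconst (inverse q)) / (1 - sp ?r i x / sp ?r i z)) =
    (\<Prod>i\<in>V. \<Prod>a\<in>{1..d i}. Kc (len i a)) * (\<Prod>i\<in>V. \<Prod>a\<in>{1..d i}. \<Prod>b\<in>{1..d i} - {a}. M i a b ?r)"
  proof -
    have "(\<Prod>x\<in>?A i. \<Prod>z\<in>?B i. (1 - sp ?r i x / sp ?r i z * rconst (inverse q)) / (1 - sp ?r i x / sp ?r i z)) =
      (\<Prod>a\<in>{1..d i}. (\<Prod>x\<in>?K i a a. kap i a a x ?r) * (\<Prod>b\<in>{1..d i} - {a}. \<Prod>x\<in>?K i a b. kap i a b x ?r))" for i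
    proof -
      have "(\<Prod>x\<in>?A i. \<Prod>z\<in>?B i. (1 - sp ?r i x / sp ?r i z * rconst (inverse q)) / (1 - sp ?r i x / sp ?r i z)) =
        (\<Prod>a\<in>{1..d i}. \<Prod>b\<in>{1..d i}. \<Prod>x\<in>?K i a b. kap i a b x ?r)"
        unfolding B unfolding seg_def[of d k] by (subst prod_Sigma2) (simp_all add: kap_def prod.cartesian_product split_def)
      also have "\<dots> = (\<Prod>a\<in>{1..d i}. (\<Prod>x\<in>?K i a a. kap i a a x ?r) * (\<Prod>b\<in>{1..d i} - {a}. \<Prod>x\<in>?K i a b. kap i a b x ?r))"
        by (intro prod.cong refl prod.remove) auto
      finally show ?thesis .
    qed
    then show ?thesis
      unfolding Den_eq prod.distrib[symmetric]
      by (simp only:, intro prod.cong refl) (simp add: self[symmetric] diff[symmetric] prod.distrib mult_ac)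
  qed
  let ?G = "\<lambda>y. H y * H' (?y' y) * (\<Prod>i\<in>V. \<Prod>a\<in>{1..d i}. \<Prod>b\<in>{1..d i} - {a}. M i a b y) *
    (\<Prod>\<alpha>\<in>arcs Q. \<Prod>a\<in>{1..d (tail Q \<alpha>)}. \<Prod>b\<in>{1..d (head Q \<alpha>)}. W \<alpha> a b y)"
  have "lfun d (\<lambda>y. H' (?y' y))"
    using lfun_subst[OF H'(1), of "\<lambda>i a. a" d "\<lambda>i a. int (k i a)"] by simp
  then have "lfun d ?G"
    unfolding M_def W_def
    by (intro lfun_mult H(1) lfun_prod lfun_power lfun_nu lfun_ell lfun_aw) auto
  moreover have "Den d len ?r * shuf_term n n' E E' ?A ?B (sp ?r) = Dv d len ?r * ?G ?r"
  proof -
    have arrows': "(\<Prod>\<alpha>\<in>arcs Q. \<Prod>a\<in>{1..d (tail Q \<alpha>)}. \<Prod>b\<in>{1..d (head Q \<alpha>)}. Dw (k (tail Q \<alpha>) a) (k (head Q \<alpha>) b) (aw \<alpha> ?r a b)) *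
     (\<Prod>\<alpha>\<in>arcs Q. \<Prod>a\<in>{1..d (tail Q \<alpha>)}. \<Prod>b\<in>{1..d (head Q \<alpha>)}. Dw (?m (tail Q \<alpha>) a) (?m (head Q \<alpha>) b) (aw \<alpha> (?y' ?r) a b)) *
     (\<Prod>\<alpha>\<in>arcs Q. arrow_part ?A ?B (sp ?r) \<alpha>) =
     (\<Prod>\<alpha>\<in>arcs Q. \<Prod>a\<in>{1..d (tail Q \<alpha>)}. \<Prod>b\<in>{1..d (head Q \<alpha>)}. Dw (len (tail Q \<alpha>) a) (len (head Q \<alpha>) b) (aw \<alpha> ?r a b)) *
     (\<Prod>\<alpha>\<in>arcs Q. \<Prod>a\<in>{1..d (tail Q \<alpha>)}. \<Prod>b\<in>{1..d (head Q \<alpha>)}. W \<alpha> a b ?r)" (is "?a1 * ?a2 * ?a3 = ?a4 * ?a5")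
      unfolding prod.distrib[symmetric, where A = "arcs Q"] arrows ..
    let ?k1 = "\<Prod>i\<in>V. \<Prod>a\<in>{1..d i}. Kc (k i a)" and ?k2 = "\<Prod>i\<in>V. \<Prod>a\<in>{1..d i}. Kc (?m i a)"
    let ?k3 = "\<Prod>i\<in>V. \<Prod>x\<in>?A i. \<Prod>z\<in>?B i. (1 - sp ?r i x / sp ?r i z * rconst (inverse q)) / (1 - sp ?r i x / sp ?r i z)"
    have "Den d len ?r * shuf_term n n' E E' ?A ?B (sp ?r) =
      (?k1 * ?k2 * Den d len ?r * ?k3) * (?a1 * ?a2 * ?a3) * (H ?r * H' (?y' ?r))"
      unfolding shuf_term_def zeta_prod ev ev' Dv_def by (simp only: mult_ac)
    then show ?thesis
      unfolding diag arrows' unfolding Dv_def by (simp only: mult_ac)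
  qed
  ultimately show ?thesis by (intro exI[of _ ?G]) blast
qed

text \<open>Summing over \<open>A\<close> shows that the specialization times \<open>Den\<close> is
  the divisor times a Laurent polynomial. The divisor does not vanish identically on any hyperplane
  of \<open>Den\<close>, so \<open>Den\<close> divides that Laurent polynomial over \<open>R\<close>
  and cancels.\<close>

theorem Sdiv_homog:
  assumes n: "n \<in> degrees Q" "n' \<in> degrees Q" and E: "E \<in> SL n" "E' \<in> SL n'" and S: "Sdiv n E" "Sdiv n' E'"
  shows "Sdiv (\<lambda>i. n i + n' i) (shuffle_homog Q t q n n' E E')"
  unfolding Sdiv_def
proof (intro allI impI)
  let ?N = "\<lambda>i. n i + n' i" and ?P = "shuffle_homog Q t q n n' E E'"
  let ?r = "rvar :: 'i \<Rightarrow> nat \<Rightarrow> ('i, 'k) ratfun"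
  fix d len assume tot: "tot d len = ?N"
  have idx: "idx ?N (seg d len)" using idx_seg[of d len] tot by simp
  have P: "?P \<in> SL ?N" by (rule shuffle_homog_props(1)[OF n E])
  have SGr: "SG ?N ?P d len ?r = (\<Sum>A\<in>Subs n (seg d len). shuf_term n n' E E' A (\<lambda>i. seg d len i - A i) (sp ?r))"
    unfolding SG_def shuf_def[symmetric]
    by (rule shuffle_homog_props(2)[OF n E idx]) (simp_all add: sp_nz sp_rvar_inj)
  have "\<exists>G. lfun d G \<and> Den d len ?r * shuf_term n n' E E' A (\<lambda>i. seg d len i - A i) (sp ?r) = Dv d len ?r * G ?r"
    if A: "A \<in> Subs n (seg d len)" for A
  proof (cases "shuf_term n n' E E' A (\<lambda>i. seg d len i - A i) (sp ?r) = 0")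
    case True
    then show ?thesis using lfun_0[of d] by (intro exI[of _ "\<lambda>_. 0"]) simp
  next
    case False
    obtain k where k: "A = seg d k" "\<And>i a. k i a \<le> len i a" "tot d k = n"
      by (rule shuf_term_nonzero[OF n(1) A _ False]) auto
    then show ?thesis unfolding k(1) by (intro shuf_term_split[OF E S tot]) auto
  qed
  then have "\<forall>A\<in>Subs n (seg d len). \<exists>G. lfun d G \<and>
      Den d len ?r * shuf_term n n' E E' A (\<lambda>i. seg d len i - A i) (sp ?r) = Dv d len ?r * G ?r"
    by (rule ballI)
  from bchoice[OF this] obtain G where G': "\<forall>A\<in>Subs n (seg d len). lfun d (G A) \<and>
      Den d len ?r * shuf_term n n' E E' A (\<lambda>i. seg d len i - A i) (sp ?r) = Dv d len ?r * G A ?r"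
    by (rule exE)
  have G: "lfun d (G A)"
    "Den d len ?r * shuf_term n n' E E' A (\<lambda>i. seg d len i - A i) (sp ?r) = Dv d len ?r * G A ?r"
    if "A \<in> Subs n (seg d len)" for A
    using bspec[OF G' that] by (rule conjunct1, rule conjunct2)
  let ?G = "\<lambda>y. \<Sum>A\<in>Subs n (seg d len). G A y"
  have lG: "lfun d ?G" by (intro lfun_sum G)
  have lSG: "lfun d (SG ?N ?P d len)" using lfun_SG[of ?P d len] P tot by simp
  have lDen: "lfun d (Den d len)"
    unfolding Den_def[abs_def] split_def by (intro lfun_prod lfun_ell) (auto simp: den_def)
  have eq: "SG ?N ?P d len y * Den d len y = Dv d len y * ?G y" if "\<And>i a. y i a \<noteq> 0" for y
  proof (rule lfun_eqI[of d "\<lambda>y. SG ?N ?P d len y * Den d len y" d "\<lambda>y. Dv d len y * ?G y"])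
    show "SG ?N ?P d len ?r * Den d len ?r = Dv d len ?r * ?G ?r"
      using G(2) by (simp add: SGr sum_distrib_left mult.commute[of _ "Den d len ?r"])
  qed (intro lfun_mult lSG lDen lfun_Dv lG that)+
  have "\<exists>H. lfun d H \<and> (\<forall>p. (\<forall>i a. p i a \<noteq> 0) \<longrightarrow> ?G p = (\<Prod>x\<in>den d len. p (fst x) (fst (snd x)) -
      rconst (q powi (int (snd (snd (snd (snd x)))) - int (fst (snd (snd (snd x)))))) * p (fst x) (fst (snd (snd x)))) * H p)"
  proof (rule lfun_dvd_linear_prod[where C = "Dv d len" and F = "SG ?N ?P d len", OF finite_den])
    show "SG ?N ?P d len p * (\<Prod>x\<in>den d len. p (fst x) (fst (snd x)) -
      rconst (q powi (int (snd (snd (snd (snd x)))) - int (fst (snd (snd (snd x)))))) * p (fst x) (fst (snd (snd x)))) = Dv d len p * ?G p"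
      if "\<And>i a. p i a \<noteq> 0" for p
      by (subst eq[symmetric]) (simp_all add: that Den_def ell_def split_def)
  qed (use lSG lG lfun_Dv Dv_generic_nz in \<open>auto simp: den_def\<close>)
  then obtain H where H: "lfun d H" "\<And>p. \<forall>i a. p i a \<noteq> 0 \<Longrightarrow> ?G p = Den d len p * H p"
    by (auto simp: Den_def ell_def split_def)
  have "SG ?N ?P d len y = Dv d len y * H y" if nz: "\<forall>i a. y i a \<noteq> 0" for y
  proof (rule lfun_cancel[of d "Den d len" "SG ?N ?P d len" "\<lambda>y. Dv d len y * H y"])
    show "Den d len p * SG ?N ?P d len p = Den d len p * (Dv d len p * H p)" if nz: "\<And>i a. p i a \<noteq> 0" for p
    proof -
      have "SG ?N ?P d len p * Den d len p = Dv d len p * ?G p" by (rule eq) (rule nz)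
      then show ?thesis using H(2)[of p] nz by (simp add: mult_ac)
    qed
  qed (use nz lDen lSG Den_rvar_nz in \<open>auto intro!: lfun_mult lfun_Dv H\<close>)
  then show "\<exists>H. lfun d H \<and> (\<forall>y. (\<forall>i a. y i a \<noteq> 0) \<longrightarrow> SG ?N ?P d len y = Dv d len y * H y)"
    using H(1) by blast
qed

end

section \<open>The generators and their products\<close>

text \<open>A case of equality in \<open>chi_split\<close>: one point is cut off from either
  segment, and \<open>chi 1 1\<close> is zero. It makes the leading specializations exact.\<close>

lemma chi_step:
  assumes "n \<ge> 1" "n' \<ge> 1"
  shows "chi n n' c = chi (n - 1) (n' - 1) c + of_bool (1 \<le> c \<and> c \<le> int n' - 1) + of_bool (2 - int n \<le> c \<and> c \<le> 0)"
proof -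
  have "int (chi n n' c) = int (chi (n - 1) (n' - 1) c) + of_bool (1 \<le> c \<and> c \<le> int n' - 1) + of_bool (2 - int n \<le> c \<and> c \<le> 0)"
  proof (cases "c \<ge> 1")
    case True
    then show ?thesis unfolding chi_pos[OF True] using assms by (auto simp: of_nat_diff min_def max_def)
  next
    case False
    then have "c \<le> 0" by simp
    then show ?thesis unfolding chi_neg[OF \<open>c \<le> 0\<close>] using assms by (auto simp: of_nat_diff min_def max_def)
  qed
  then show ?thesis by (auto simp: of_bool_def split: if_splits)
qed

lemma Dw_step:
  assumes "n \<ge> 1" "n' \<ge> 1"
  shows "Dw n n' w = Dw (n - 1) (n' - 1) w * (\<Prod>v\<in>{1..<n'}. w (int v)) * (\<Prod>u\<in>{1..<n}. w (1 - int u))"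
proof -
  let ?C = "{- int n..int n'}"
  have "(\<Prod>v\<in>{1..<n'}. w (int v)) = (\<Prod>c\<in>?C. w c ^ card {v \<in> {1..<n'}. int v = c})"
    by (rule prod_pairs_diff) auto
  also have "\<dots> = (\<Prod>c\<in>?C. w c ^ of_bool (1 \<le> c \<and> c \<le> int n' - 1))"
  proof (intro prod.cong refl arg_cong2[where f = "(^)"])
    fix c
    have "{v \<in> {1..<n'}. int v = c} = (if 1 \<le> c \<and> c \<le> int n' - 1 then {nat c} else {})" by auto
    then show "card {v \<in> {1..<n'}. int v = c} = of_bool (1 \<le> c \<and> c \<le> int n' - 1)" by simp
  qed
  finally have 1: "(\<Prod>v\<in>{1..<n'}. w (int v)) = (\<Prod>c\<in>?C. w c ^ of_bool (1 \<le> c \<and> c \<le> int n' - 1))" .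
  have "(\<Prod>u\<in>{1..<n}. w (1 - int u)) = (\<Prod>c\<in>?C. w c ^ card {u \<in> {1..<n}. 1 - int u = c})"
    by (rule prod_pairs_diff) auto
  also have "\<dots> = (\<Prod>c\<in>?C. w c ^ of_bool (2 - int n \<le> c \<and> c \<le> 0))"
  proof (intro prod.cong refl arg_cong2[where f = "(^)"])
    fix c
    have "{u \<in> {1..<n}. 1 - int u = c} = (if 2 - int n \<le> c \<and> c \<le> 0 then {nat (1 - c)} else {})" by auto
    then show "card {u \<in> {1..<n}. 1 - int u = c} = of_bool (2 - int n \<le> c \<and> c \<le> 0)" by simp
  qed
  finally have 2: "(\<Prod>u\<in>{1..<n}. w (1 - int u)) = (\<Prod>c\<in>?C. w c ^ of_bool (2 - int n \<le> c \<and> c \<le> 0))" .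
  have 3: "Dw (n - 1) (n' - 1) w = (\<Prod>c\<in>?C. w c ^ chi (n - 1) (n' - 1) c)"
    by (rule Dw_superset) auto
  show ?thesis
    unfolding Dw_def[of n n'] 1 2 3 prod.distrib[symmetric] power_add[symmetric] chi_step[OF assms] ..
qed

context quiver_shuffle
begin

lemma SL_0: "0 \<in> SL n"
  by (rule SL_I[OF LR_0]) simp

lemma SL_add: "E \<in> SL n \<Longrightarrow> E' \<in> SL n \<Longrightarrow> E + E' \<in> SL n"
  by (rule SL_I) (simp_all add: LR_add SL_LR SL_evl)

lemma evl_lconst [simp]: "evl p (lconst c) = rconst c"
  by (simp add: lconst_def)

lemma evl_1 [simp]: "evl p 1 = 1"
  by (simp flip: single_one)

lemma evl_lvar [simp]: "evl p (lvar i a k) = p i a powi k"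
  by (simp add: lvar_def)

lemma LR_lconst: "c \<in> R \<Longrightarrow> lconst c \<in> LR n"
  by (simp add: lconst_def LR_single)

lemma LR_1: "1 \<in> LR n"
  using LR_lconst[OF R_1] by (simp add: lconst_def)

lemma LR_prod: "(\<And>x. x \<in> A \<Longrightarrow> f x \<in> LR n) \<Longrightarrow> prod f A \<in> LR n"
  by (induction A rule: infinite_finite_induct) (auto intro: LR_1 LR_mult)

lemma evl_scale: "(\<And>i a. p i a \<noteq> 0) \<Longrightarrow> evl p (lconst c * E) = rconst c * evl p E"
  by (subst evl_mult) auto

lemma SL_scale: "c \<in> R \<Longrightarrow> E \<in> SL n \<Longrightarrow> lconst c * E \<in> SL n"
  by (rule SL_I) (simp_all add: LR_mult LR_lconst SL_LR SL_evl evl_scale)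

lemma evl_diff: "evl p (E - E') = evl p E - evl p E'"
  using lsubst_add[of "case_var p" "E - E'" E'] by simp

lemma evl_prod: "(\<And>i a. p i a \<noteq> 0) \<Longrightarrow> evl p (\<Prod>x\<in>A. f x) = (\<Prod>x\<in>A. evl p (f x))"
  by (induction A rule: infinite_finite_induct) (simp_all add: evl_mult)

lemma SG_add: "SG n (E + E') d len y = SG n E d len y + SG n E' d len y"
  by (simp add: SG_def evJ_def)

lemma SG_0: "SG n 0 d len y = 0"
  by (simp add: SG_def evJ_def)

lemma SG_scale: "(\<And>i a. y i a \<noteq> 0) \<Longrightarrow> SG n (lconst c * E) d len y = rconst c * SG n E d len y"
  unfolding SG_def by (subst evJ_mult) (auto intro: sp_nz simp: evJ_def sp_nz)

lemma Sn_0: "0 \<in> Sn n"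
  unfolding Sn_iff Sdiv_def using lfun_0 by (auto simp: SL_0 SG_0 intro!: exI[of _ "\<lambda>_. 0"])

lemma Sn_add:
  assumes "E \<in> Sn n" "E' \<in> Sn n"
  shows "E + E' \<in> Sn n"
proof -
  have "Sdiv n (E + E')"
    unfolding Sdiv_def
  proof (intro allI impI)
    fix d len assume t: "tot d len = n"
    obtain H where H: "lfun d H" "\<forall>y. (\<forall>i a. y i a \<noteq> 0) \<longrightarrow> SG n E d len y = Dv d len y * H y"
      using assms(1)[unfolded Sn_iff Sdiv_def] t by blast
    obtain H' where H': "lfun d H'" "\<forall>y. (\<forall>i a. y i a \<noteq> 0) \<longrightarrow> SG n E' d len y = Dv d len y * H' y"
      using assms(2)[unfolded Sn_iff Sdiv_def] t by blast
    show "\<exists>H. lfun d H \<and> (\<forall>y. (\<forall>i a. y i a \<noteq> 0) \<longrightarrow> SG n (E + E') d len y = Dv d len y * H y)"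
      using H H' by (intro exI[of _ "\<lambda>y. H y + H' y"]) (simp add: lfun_add SG_add ring_distribs)
  qed
  then show ?thesis using assms by (simp add: Sn_iff SL_add)
qed

lemma Sn_scale:
  assumes "E \<in> Sn n" "c \<in> R"
  shows "lconst c * E \<in> Sn n"
proof -
  have "Sdiv n (lconst c * E)"
    unfolding Sdiv_def
  proof (intro allI impI)
    fix d len assume t: "tot d len = n"
    obtain H where H: "lfun d H" "\<forall>y. (\<forall>i a. y i a \<noteq> 0) \<longrightarrow> SG n E d len y = Dv d len y * H y"
      using assms(1)[unfolded Sn_iff Sdiv_def] t by blast
    show "\<exists>H. lfun d H \<and> (\<forall>y. (\<forall>i a. y i a \<noteq> 0) \<longrightarrow> SG n (lconst c * E) d len y = Dv d len y * H y)"
      using H by (intro exI[of _ "\<lambda>y. rconst c * H y"]) (simp add: lfun_mult lfun_const assms SG_scale)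
  qed
  then show ?thesis using assms by (simp add: Sn_iff SL_scale)
qed

lemma Sn_homog:
  "n \<in> degrees Q \<Longrightarrow> n' \<in> degrees Q \<Longrightarrow> E \<in> Sn n \<Longrightarrow> E' \<in> Sn n' \<Longrightarrow>
    shuffle_homog Q t q n n' E E' \<in> Sn (\<lambda>i. n i + n' i)"
  using Sdiv_homog shuffle_homog_props(1) by (simp add: Sn_iff)

section \<open>The generators and their integrality\<close>

definition eg :: "('i \<Rightarrow> nat) \<Rightarrow> ('i, 'k) laurent \<Rightarrow> ('i, 'k) laurent"
  where "eg m g = g * (\<Prod>i\<in>V. \<Prod>a\<in>{1..m i}. \<Prod>b\<in>{1..m i}. 1 - lvar i a 1 * lvar i b (-1) * lconst (inverse q))"

definition ef :: "('i \<Rightarrow> 'b \<Rightarrow> ('i, 'k) ratfun) \<Rightarrow> 'i \<Rightarrow> 'b \<Rightarrow> 'b \<Rightarrow> ('i, 'k) ratfun"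
  where "ef p i a b = 1 - p i a / p i b * rconst (inverse q)"

lemma e_gen_eq: "e_gen Q q m g = single m (eg m g)"
  by (simp add: e_gen_def eg_def)

lemma evl_eg:
  assumes "\<And>i a. p i a \<noteq> 0"
  shows "evl p (eg m g) = evl p g * (\<Prod>i\<in>V. \<Prod>a\<in>{1..m i}. \<Prod>b\<in>{1..m i}. ef p i a b)"
  unfolding eg_def using assms
  by (simp add: evl_mult evl_prod evl_diff ef_def power_int_minus divide_inverse)

lemma evJ_eg:
  assumes "idx m J" "\<And>i x. p i x \<noteq> 0"
  shows "evJ m (eg m g) J p = evJ m g J p * (\<Prod>i\<in>V. \<Prod>a\<in>J i. \<Prod>b\<in>J i. ef p i a b)"
proof -
  let ?f = "\<lambda>i. enum_bij (m i) (J i)"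
  have "(\<Prod>a\<in>J i. \<Prod>b\<in>J i. ef p i a b) = (\<Prod>a\<in>{1..m i}. \<Prod>b\<in>{1..m i}. ef p i (?f i a) (?f i b))" for i
    by (simp only: prod.reindex_bij_betw[OF idx_enum[OF assms(1)], symmetric])
  then show ?thesis
    using assms(2) by (simp add: evJ_def evl_eg ef_def)
qed

lemma SL_eg:
  assumes "g \<in> SL m"
  shows "eg m g \<in> SL m"
proof (rule SL_I)
  have lv: "lvar i a k \<in> LR m" if "i \<in> V" "a \<in> {1..m i}" for i a k
    unfolding lvar_def by (rule LR_single[OF R_1]) (use that in \<open>auto simp: lvars_def split: if_splits\<close>)
  have sub: "1 - E \<in> LR m" if "E \<in> LR m" for E
    using LR_add[OF LR_1 LR_mult[OF LR_lconst[OF R_uminus[OF R_1]] that]]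
    by (simp add: lconst_def single_uminus)
  show "eg m g \<in> LR m"
    unfolding eg_def by (intro LR_mult sub lv LR_prod SL_LR[OF assms] LR_lconst R_gens)
next
  fix \<sigma> assume \<sigma>: "\<sigma> \<in> perm_families m"
  then have bij: "bij_betw (\<sigma> i) {1..m i} {1..m i}" for i
    by (simp add: perm_families_def permutes_imp_bij)
  have "(\<Prod>a\<in>{1..m i}. \<Prod>b\<in>{1..m i}. ef rvar i (\<sigma> i a) (\<sigma> i b)) = (\<Prod>a\<in>{1..m i}. \<Prod>b\<in>{1..m i}. ef rvar i a b)" for i
    by (simp only: prod.reindex_bij_betw[OF bij, of "\<lambda>a. \<Prod>b\<in>{1..m i}. ef rvar i a b" for i, symmetric]
        prod.reindex_bij_betw[OF bij, of "ef rvar i a" for i a])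
  then show "evl (\<lambda>i a. rvar i (\<sigma> i a)) (eg m g) = evl rvar (eg m g)"
    using SL_evl[OF assms \<sigma>, of rvar] by (simp add: evl_eg ef_def)
qed

lemma lfun_ef_sp: "i \<in> V \<Longrightarrow> a \<in> {1..d i} \<Longrightarrow> b \<in> {1..d i} \<Longrightarrow> lfun d (\<lambda>y. ef (sp y) i (a, u) (b, v))"
proof -
  assume i: "i \<in> V" "a \<in> {1..d i}" "b \<in> {1..d i}"
  have "(\<lambda>y. ef (sp y) i (a, u) (b, v)) = (\<lambda>y. 1 - rconst (q powi (int u - int v)) * y i a / y i b * rconst (inverse q))"
    by (simp add: fun_eq_iff ef_def sp_div)
  then show ?thesis
    using i by (simp only:) (intro lfun_diff lfun_1 lfun_mult lfun_divide_var lfun_var lfun_q_powi lfun_const R_gens)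
qed

lemma prod_ef_seg:
  "(\<Prod>x\<in>seg d len i. \<Prod>z\<in>seg d len i. f x z) =
    (\<Prod>a\<in>{1..d i}. (\<Prod>u<len i a. \<Prod>v<len i a. f (a, u) (a, v)) *
      (\<Prod>b\<in>{1..d i} - {a}. \<Prod>u<len i a. \<Prod>v<len i b. f (a, u) (b, v) :: ('i, 'k) ratfun))"
proof -
  have "(\<Prod>x\<in>seg d len i. \<Prod>z\<in>seg d len i. f x z) =
    (\<Prod>a\<in>{1..d i}. \<Prod>b\<in>{1..d i}. \<Prod>u<len i a. \<Prod>v<len i b. f (a, u) (b, v))"
    unfolding seg_def by (rule prod_Sigma2) auto
  also have "\<dots> = (\<Prod>a\<in>{1..d i}. (\<Prod>u<len i a. \<Prod>v<len i a. f (a, u) (a, v)) *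
      (\<Prod>b\<in>{1..d i} - {a}. \<Prod>u<len i a. \<Prod>v<len i b. f (a, u) (b, v)))"
    by (intro prod.cong refl prod.remove) auto
  finally show ?thesis .
qed

lemma evJ_eg_eq_0:
  assumes "idx m J" "\<And>i a. y i a \<noteq> 0" "i \<in> V" "(a, Suc u) \<in> J i" "(a, u) \<in> J i"
  shows "evJ m (eg m g) J (sp y) = 0"
proof -
  have fin: "finite (J i)" using assms(1) by (simp add: idx_def)
  have "ef (sp y) i (a, Suc u) (a, u) = 0"
    using assms(2) q_nz by (simp add: ef_def sp_div rconst_inverse)
  then have "(\<Prod>i\<in>V. \<Prod>a\<in>J i. \<Prod>b\<in>J i. ef (sp y) i a b) = 0"
    by (intro prod_zero[OF finV] bexI[OF _ assms(3)] prod_zero[OF fin] bexI[OF _ assms(4)] bexI[OF _ assms(5)])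
  moreover have "sp y i x \<noteq> 0" for i x by (rule sp_nz) (rule assms(2))
  ultimately show ?thesis by (simp add: evJ_eg[OF assms(1)])
qed

text \<open>Two consecutive points in one segment kill the generator. If all segments have length at
  most 1, every \<open>chi\<close> vanishes and the divisor reduces to one constant 1 - 1/q per
  point, which is the diagonal factor a = b of the generator.\<close>

lemma Sn_eg:
  assumes "g \<in> SL m"
  shows "eg m g \<in> Sn m"
proof -
  have "Sdiv m (eg m g)"
    unfolding Sdiv_def
  proof (intro allI impI)
    fix d len assume t: "tot d len = m"
    have idx: "idx m (seg d len)" using idx_seg[of d len] t by simp
    show "\<exists>H. lfun d H \<and> (\<forall>y. (\<forall>i a. y i a \<noteq> 0) \<longrightarrow> SG m (eg m g) d len y = Dv d len y * H y)"
    proof (cases "\<exists>i\<in>V. \<exists>a\<in>{1..d i}. len i a \<ge> 2")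
      case True
      then obtain i a where ia: "i \<in> V" "a \<in> {1..d i}" "len i a \<ge> 2" by blast
      then have "SG m (eg m g) d len y = 0" if "\<forall>i a. y i a \<noteq> 0" for y
        unfolding SG_def using that by (intro evJ_eg_eq_0[OF idx _ ia(1), of _ a 0]) (auto simp: seg_def)
      then show ?thesis using lfun_0[of d] by (intro exI[of _ "\<lambda>_. 0"]) simp
    next
      case False
      then have le1: "len i a \<le> 1" if "i \<in> V" "a \<in> {1..d i}" for i a using that by force
      have Dv: "Dv d len y = (\<Prod>i\<in>V. \<Prod>a\<in>{1..d i}. Kc (len i a))" for y
        unfolding Dv_def Dw_def using le1 tail_V head_V by (simp add: chi_le_1)
      let ?H = "\<lambda>y. evJ m g (seg d len) (sp y) *
        (\<Prod>i\<in>V. \<Prod>a\<in>{1..d i}. \<Prod>b\<in>{1..d i} - {a}. \<Prod>u<len i a. \<Prod>v<len i b. ef (sp y) i (a, u) (b, v))"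
      have "lfun d ?H"
      proof (intro lfun_mult lfun_prod lfun_ef_sp)
        show "lfun d (\<lambda>y. evJ m g (seg d len) (sp y))"
          using lfun_SG[of g d len] assms t by (simp add: SG_def[abs_def])
      qed auto
      moreover have "SG m (eg m g) d len y = Dv d len y * ?H y" if y: "\<forall>i a. y i a \<noteq> 0" for y
      proof -
        have self: "(\<Prod>u<len i a. \<Prod>v<len i a. ef (sp y) i (a, u) (a, v)) = Kc (len i a)"
          if "i \<in> V" "a \<in> {1..d i}" for i a
        proof -
          have "len i a = 0 \<or> len i a = Suc 0" using le1[OF that] by linarith
          then show ?thesis using y by (auto simp: Kc_def ef_def sp_div)
        qed
        have "sp y i x \<noteq> 0" for i x by (rule sp_nz) (use y in blast)
        then have "SG m (eg m g) d len y = evJ m g (seg d len) (sp y) *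
            (\<Prod>i\<in>V. \<Prod>a\<in>seg d len i. \<Prod>b\<in>seg d len i. ef (sp y) i a b)"
          unfolding SG_def by (intro evJ_eg[OF idx]) auto
        then show ?thesis
          by (simp add: prod_ef_seg Dv self prod.distrib mult_ac)
      qed
      ultimately show ?thesis by blast
    qed
  qed
  then show ?thesis using SL_eg[OF assms] by (simp add: Sn_iff)
qed

end

lemma prod_Sigma_diag:
  assumes "\<And>a. finite (K a)" "\<And>b. finite (K' b)"
  shows "(\<Prod>x\<in>Sigma {1..m::nat} K. \<Prod>z\<in>Sigma {1..m} K'. f x z) =
    (\<Prod>a\<in>{1..m}. (\<Prod>u\<in>K a. \<Prod>v\<in>K' a. f (a, u) (a, v)) *
      (\<Prod>b\<in>{1..m} - {a}. \<Prod>u\<in>K a. \<Prod>v\<in>K' b. f (a, u) (b, v) :: 'c::comm_monoid_mult))"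
  by (subst prod_Sigma2[OF _ _ assms]) (auto intro!: prod.cong prod.remove)

section \<open>Leading specializations of products of generators\<close>

context quiver_shuffle
begin

text \<open>\<open>Lin\<close> collects the zeros $x_{ia} = q^l x_{ib}$ that a specialization acquires when all
  specializations of larger weight \<open>Nw\<close> vanish.\<close>

definition Lin :: "('i \<Rightarrow> nat) \<Rightarrow> ('i \<Rightarrow> nat \<Rightarrow> nat) \<Rightarrow> ('i \<Rightarrow> nat \<Rightarrow> ('i, 'k) ratfun) \<Rightarrow> ('i, 'k) ratfun"
  where "Lin d len y = (\<Prod>i\<in>V. \<Prod>a\<in>{1..d i}. \<Prod>b\<in>{1..d i} - {a}.
    \<Prod>l\<in>{len i b - len i a<..len i b}. 1 - rconst (q powi (- int l)) * (y i a / y i b))"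

definition Nw :: "('i \<Rightarrow> nat) \<Rightarrow> ('i \<Rightarrow> nat \<Rightarrow> nat) \<Rightarrow> nat"
  where "Nw d len = (\<Sum>i\<in>V. \<Sum>a\<in>{1..d i}. len i a * (len i a + 1))"

definition sz :: "('i \<Rightarrow> nat) \<Rightarrow> nat"
  where "sz n = (\<Sum>i\<in>V. n i)"

lemma lfun_Lin: "lfun d (Lin d len)"
proof -
  have "Lin d len = (\<lambda>y. \<Prod>i\<in>V. \<Prod>a\<in>{1..d i}. \<Prod>b\<in>{1..d i} - {a}.
    \<Prod>l\<in>{len i b - len i a<..len i b}. 1 - rconst (q powi (- int l)) * y i a / y i b)"
    by (simp add: Lin_def fun_eq_iff)
  then show ?thesis
    by (simp only:) (intro lfun_prod lfun_diff lfun_1 lfun_divide_var lfun_mult lfun_q_powi lfun_var; auto)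
qed

lemma Y_telescope:
  fixes Y :: "('i, 'k) ratfun"
  assumes "\<And>v. v \<ge> 1 \<Longrightarrow> 1 - rconst (q powi (- int v)) * Y \<noteq> 0" "n \<ge> 1"
  shows "(1 - rconst (q powi (-1)) * Y) *
    (\<Prod>v\<in>{1..<n}. (1 - rconst (q powi (- int (v + 1))) * Y) / (1 - rconst (q powi (- int v)) * Y)) =
    1 - rconst (q powi (- int n)) * Y"
  using assms(2)
proof (induction n rule: dec_induct)
  case (step n)
  have "1 - rconst (q powi (- int n)) * Y \<noteq> 0" using assms(1) step.hyps by blast
  then show ?case
    using step by (simp only: prod.atLeastLessThan_Suc mult.assoc[symmetric]) simp
qed simp

lemma rvar_quotient_nz:
  assumes "a \<noteq> b \<or> v \<noteq> 0"
  shows "1 - rconst (q powi v) * (rvar i a / rvar i b) \<noteq> (0 :: ('i, 'k) ratfun)"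
proof
  assume "1 - rconst (q powi v) * (rvar i a / rvar i b) = (0 :: ('i, 'k) ratfun)"
  then have "rconst (q powi v) * rvar i a = (rconst 1 * rvar i b :: ('i, 'k) ratfun)"
    by (simp add: field_simps)
  then have "a = b \<and> q powi v = 1"
    by (subst (asm) rconst_rvar_eq_iff) (use q_nz in auto)
  then show False using assms q_powi_eq_1_iff[of v] q_nz by auto
qed

text \<open>The contribution of the first points of all segments to the leading specialization.\<close>

lemma lead_factor:
  fixes d :: "'i \<Rightarrow> nat" and len :: "'i \<Rightarrow> nat \<Rightarrow> nat"
  defines "k \<equiv> \<lambda>i a. min 1 (len i a)" and "L1 \<equiv> \<lambda>i a. len i a - 1"
  defines "A \<equiv> seg d k" and "r \<equiv> rvar :: 'i \<Rightarrow> nat \<Rightarrow> ('i, 'k) ratfun"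
  defines "B \<equiv> \<lambda>i. seg d len i - seg d k i"
  shows "(\<Prod>i\<in>V. \<Prod>x\<in>A i. \<Prod>z\<in>A i. ef (sp r) i x z) *
    (\<Prod>i\<in>V. \<Prod>x\<in>A i. \<Prod>z\<in>B i. (1 - sp r i x / sp r i z * rconst (inverse q)) / (1 - sp r i x / sp r i z)) *
    (\<Prod>\<alpha>\<in>arcs Q. arrow_part A B (sp r) \<alpha>) * (Dv d L1 r * Lin d L1 r) = Dv d len r * Lin d len r"
proof -
  have B: "B i = (SIGMA a:{1..d i}. {k i a..<len i a})" for i
    unfolding B_def by (rule Diff_seg) (auto simp: k_def)
  have A: "A i = (SIGMA a:{1..d i}. {..<k i a})" for i by (simp add: A_def seg_def)
  let ?kap = "\<lambda>i x z. (1 - sp r i x / sp r i z * rconst (inverse q)) / (1 - sp r i x / sp r i z)"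
  let ?LP = "\<lambda>len i a b. \<Prod>l\<in>{len i b - len i a<..len i b}. 1 - rconst (q powi (- int l)) * (r i a / r i b)"
  \<comment> \<open>What the ordered pair of segments (a, b) contributes: the generator factors
    between their first points, and zeta from the first point of a to the later points of b.\<close>
  define PE where "PE i a b = (\<Prod>u<k i a. \<Prod>v<k i b. ef (sp r) i (a, u) (b, v)) *
     (\<Prod>u<k i a. \<Prod>v\<in>{k i b..<len i b}. ?kap i (a, u) (b, v))" for i a b
  have PE1: "PE i a b = 1 - rconst (q powi (- int (len i b))) * (r i a / r i b)" if "len i a \<ge> 1" "len i b \<ge> 1" for i a b
  proof -
    let ?Y = "r i a / r i b"
    have k: "k i a = 1" "k i b = 1" using that by (auto simp: k_def)
    have "ef (sp r) i (a, 0) (b, 0) = 1 - rconst (q powi (-1)) * ?Y"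
      by (simp add: ef_def sp_div power_int_minus mult.commute)
    moreover have "?kap i (a, 0) (b, v) = (1 - rconst (q powi (- int (v + 1))) * ?Y) / (1 - rconst (q powi (- int v)) * ?Y)" for v
    proof -
      have "q powi (- int (v + 1)) = q powi (- int v) * inverse q"
        by (simp only: power_int_minus power_int_of_nat power_add power_one_right inverse_mult_distrib)
      then show ?thesis by (simp add: sp_div mult_ac)
    qed
    ultimately have "PE i a b = (1 - rconst (q powi (-1)) * ?Y) *
       (\<Prod>v\<in>{1..<len i b}. (1 - rconst (q powi (- int (v + 1))) * ?Y) / (1 - rconst (q powi (- int v)) * ?Y))"
      by (simp add: PE_def k)
    also have "\<dots> = 1 - rconst (q powi (- int (len i b))) * ?Y"
      by (rule Y_telescope) (use that rvar_quotient_nz in \<open>auto simp: r_def\<close>)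
    finally show ?thesis .
  qed
  have self: "PE i a a * Kc (L1 i a) = Kc (len i a)" for i a
  proof (cases "len i a")
    case 0
    then show ?thesis by (simp add: PE_def k_def L1_def Kc_def)
  next
    case (Suc n)
    then have "PE i a a = qz (int (Suc n))" using PE1[of i a a] by (simp add: qz_def r_def)
    then show ?thesis using Kc_Suc[of n] by (simp add: L1_def Suc mult.commute)
  qed
  \<comment> \<open>Shortening both segments by one removes just the top value l = len i b from the
    range in \<open>Lin\<close>, and the telescoped \<open>PE\<close> is precisely the factor of
    that value.\<close>
  have off: "PE i a b * ?LP L1 i a b = ?LP len i a b" for i a b
  proof (cases "len i a = 0 \<or> len i b = 0")
    case True
    then show ?thesis by (auto simp: PE_def k_def L1_def)
  next
    case False
    then have "{len i b - len i a<..len i b} = insert (len i b) {L1 i b - L1 i a<..L1 i b}"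
      by (auto simp: L1_def)
    moreover have "len i b \<notin> {L1 i b - L1 i a<..L1 i b}" using False by (auto simp: L1_def)
    ultimately show ?thesis using False PE1[of i a b] by simp
  qed
  have diag: "(\<Prod>i\<in>V. \<Prod>x\<in>A i. \<Prod>z\<in>A i. ef (sp r) i x z) * (\<Prod>i\<in>V. \<Prod>x\<in>A i. \<Prod>z\<in>B i. ?kap i x z) *
      (\<Prod>i\<in>V. \<Prod>a\<in>{1..d i}. Kc (L1 i a)) * Lin d L1 r = (\<Prod>i\<in>V. \<Prod>a\<in>{1..d i}. Kc (len i a)) * Lin d len r"
  proof -
    have "(\<Prod>x\<in>A i. \<Prod>z\<in>A i. ef (sp r) i x z) * (\<Prod>x\<in>A i. \<Prod>z\<in>B i. ?kap i x z) =
      (\<Prod>a\<in>{1..d i}. PE i a a * (\<Prod>b\<in>{1..d i} - {a}. PE i a b))" for i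
      unfolding A B PE_def
      by (subst (1 2) prod_Sigma_diag) (simp_all add: prod.distrib mult_ac)
    then show ?thesis
      unfolding Lin_def prod.distrib[symmetric]
      by (simp only:, intro prod.cong refl)
        (simp only: self[symmetric] off[symmetric] prod.distrib mult_ac)
  qed
  have arr1: "(\<Prod>x\<in>A i. \<Prod>z\<in>B j. 1 - sp r i x / sp r j z * rconst (t \<alpha>)) =
     (\<Prod>a\<in>{1..d i}. \<Prod>b\<in>{1..d j}. \<Prod>u<k i a. \<Prod>v\<in>{k j b..<len j b}. aw \<alpha> r a b (int v - int u))"
    if "i = tail Q \<alpha>" "j = head Q \<alpha>" for i j \<alpha>
    unfolding A B by (subst prod_Sigma2) (simp_all only: aw_sp[OF that] finite_atLeastAtMost finite_lessThan finite_atLeastLessThan)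
  have arr2: "(\<Prod>x\<in>A j. \<Prod>z\<in>B i. 1 - rconst (t \<alpha>) / (sp r j x / sp r i z * rconst q)) =
     (\<Prod>a\<in>{1..d i}. \<Prod>b\<in>{1..d j}. \<Prod>v<k j b. \<Prod>u\<in>{k i a..<len i a}. aw \<alpha> r a b (int v - int u + 1))"
    if "i = tail Q \<alpha>" "j = head Q \<alpha>" for i j \<alpha>
    unfolding A B
    by (subst prod_Sigma2[OF finite_atLeastAtMost finite_atLeastAtMost finite_lessThan finite_atLeastLessThan],
        subst prod.swap) (simp only: aw_sp[OF that])
  have pair: "Dw (L1 i a) (L1 j b) w * (\<Prod>u<k i a. \<Prod>v\<in>{k j b..<len j b}. w (int v - int u)) *
     (\<Prod>v<k j b. \<Prod>u\<in>{k i a..<len i a}. w (int v - int u + 1)) = Dw (len i a) (len j b) w" for i j a b and w :: "int \<Rightarrow> ('i, 'k) ratfun"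
  proof (cases "len i a = 0 \<or> len j b = 0")
    case True
    then show ?thesis by (auto simp: k_def L1_def)
  next
    case False
    then have k: "k i a = 1" "k j b = 1" by (auto simp: k_def)
    show ?thesis using False Dw_step[of "len i a" "len j b" w] by (simp add: k L1_def add.commute[of _ 1])
  qed
  have arrows: "(\<Prod>a\<in>{1..d (tail Q \<alpha>)}. \<Prod>b\<in>{1..d (head Q \<alpha>)}. Dw (L1 (tail Q \<alpha>) a) (L1 (head Q \<alpha>) b) (aw \<alpha> r a b)) *
     arrow_part A B (sp r) \<alpha> =
     (\<Prod>a\<in>{1..d (tail Q \<alpha>)}. \<Prod>b\<in>{1..d (head Q \<alpha>)}. Dw (len (tail Q \<alpha>) a) (len (head Q \<alpha>) b) (aw \<alpha> r a b))" for \<alpha>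
    unfolding arrow_part_def arr1[OF refl refl] arr2[OF refl refl] prod.distrib[symmetric] mult.assoc[symmetric] pair ..
  have arrows': "(\<Prod>\<alpha>\<in>arcs Q. \<Prod>a\<in>{1..d (tail Q \<alpha>)}. \<Prod>b\<in>{1..d (head Q \<alpha>)}. Dw (L1 (tail Q \<alpha>) a) (L1 (head Q \<alpha>) b) (aw \<alpha> r a b)) *
     (\<Prod>\<alpha>\<in>arcs Q. arrow_part A B (sp r) \<alpha>) =
     (\<Prod>\<alpha>\<in>arcs Q. \<Prod>a\<in>{1..d (tail Q \<alpha>)}. \<Prod>b\<in>{1..d (head Q \<alpha>)}. Dw (len (tail Q \<alpha>) a) (len (head Q \<alpha>) b) (aw \<alpha> r a b))" (is "?a1 * ?a2 = ?a3")
    unfolding prod.distrib[symmetric, where A = "arcs Q"] arrows ..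
  let ?e = "\<Prod>i\<in>V. \<Prod>x\<in>A i. \<Prod>z\<in>A i. ef (sp r) i x z"
  let ?k = "\<Prod>i\<in>V. \<Prod>x\<in>A i. \<Prod>z\<in>B i. ?kap i x z"
  have "?e * ?k * ?a2 * (Dv d L1 r * Lin d L1 r) = (?e * ?k * (\<Prod>i\<in>V. \<Prod>a\<in>{1..d i}. Kc (L1 i a)) * Lin d L1 r) * (?a1 * ?a2)"
    unfolding Dv_def by (simp only: mult_ac)
  then show ?thesis unfolding diag arrows' unfolding Dv_def by (simp only: mult_ac)
qed

lemma Dv_scale: "Dv d len (\<lambda>i a. rconst q * y i a) = Dv d len y"
proof -
  have "aw \<alpha> (\<lambda>i a. rconst q * y i a) a b = aw \<alpha> y a b" for \<alpha> a b
    using aw_shift[of \<alpha> "\<lambda>_ _. 1" y a b] by (simp add: fun_eq_iff)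
  then show ?thesis by (simp add: Dv_def)
qed

lemma Lin_scale: "Lin d len (\<lambda>i a. rconst q * y i a) = Lin d len y"
  using q_nz by (simp add: Lin_def)

primrec edeg :: "(('i \<Rightarrow> nat) \<times> ('i, 'k) laurent) list \<Rightarrow> 'i \<Rightarrow> nat" where
  "edeg [] = (\<lambda>i. 0)"
| "edeg (x # L) = (\<lambda>i. fst x i + edeg L i)"

primrec eprod :: "(('i \<Rightarrow> nat) \<times> ('i, 'k) laurent) list \<Rightarrow> ('i, 'k) laurent" where
  "eprod [] = 1"
| "eprod (x # L) = shuffle_homog Q t q (fst x) (edeg L) (eg (fst x) (snd x)) (eprod L)"

text \<open>An upper bound for the weights at which the product can have a nonzero specialization:
  each step contributes twice the degree of the tail that starts there, which is the largest loss of
  weight caused by cutting off at most one point per segment.\<close>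

primrec wtl :: "(('i \<Rightarrow> nat) \<times> ('i, 'k) laurent) list \<Rightarrow> nat" where
  "wtl [] = 0"
| "wtl (x # L) = wtl L + 2 * sz (edeg (x # L))"

text \<open>\<open>fits L d len\<close> says that the degrees in \<open>L\<close> form the conjugate of the partition \<open>len\<close>,
  in every colour.\<close>

primrec fits :: "(('i \<Rightarrow> nat) \<times> ('i, 'k) laurent) list \<Rightarrow> ('i \<Rightarrow> nat) \<Rightarrow> ('i \<Rightarrow> nat \<Rightarrow> nat) \<Rightarrow> bool" where
  "fits [] d len = (\<forall>i\<in>V. \<forall>a\<in>{1..d i}. len i a = 0)"
| "fits (x # L) d len = ((\<forall>i\<in>V. fst x i = card {a \<in> {1..d i}. 0 < len i a}) \<and> fits L d (\<lambda>i a. len i a - 1))"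

primrec Gp :: "(('i \<Rightarrow> nat) \<times> ('i, 'k) laurent) list \<Rightarrow> ('i \<Rightarrow> nat) \<Rightarrow> ('i \<Rightarrow> nat \<Rightarrow> nat) \<Rightarrow>
    ('i \<Rightarrow> nat \<Rightarrow> ('i, 'k) ratfun) \<Rightarrow> ('i, 'k) ratfun" where
  "Gp [] d len y = 1"
| "Gp (x # L) d len y = evJ (fst x) (snd x) (\<lambda>i. {a \<in> {1..d i}. 0 < len i a}) y *
    Gp L d (\<lambda>i a. len i a - 1) (\<lambda>i a. rconst q * y i a)"

definition egood :: "(('i \<Rightarrow> nat) \<times> ('i, 'k) laurent) list \<Rightarrow> bool"
  where "egood L \<longleftrightarrow> (\<forall>x\<in>set L. fst x \<in> degrees Q \<and> snd x \<in> SL (fst x))"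

lemma edeg_degrees: "egood L \<Longrightarrow> edeg L \<in> degrees Q"
  by (induction L) (auto simp: egood_def degrees_def)

lemma Sn_1: "1 \<in> Sn (\<lambda>i. 0)"
proof -
  have "1 \<in> SL (\<lambda>i. 0)" by (rule SL_I[OF LR_1]) simp
  moreover have "Sdiv (\<lambda>i. 0) 1"
    unfolding Sdiv_def
  proof (intro allI impI)
    fix d and len :: "'i \<Rightarrow> nat \<Rightarrow> nat" assume "tot d len = (\<lambda>i. 0)"
    then have z: "len i a = 0" if "a \<in> {1..d i}" for i a
      using that by (auto simp: tot_def fun_eq_iff)
    have "Dv d len y = 1" for y
      unfolding Dv_def by (simp add: z Kc_def)
    then show "\<exists>H. lfun d H \<and> (\<forall>y. (\<forall>i a. y i a \<noteq> 0) \<longrightarrow> SG (\<lambda>i. 0) 1 d len y = Dv d len y * H y)"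
      using lfun_1 by (intro exI[of _ "\<lambda>_. 1"]) (simp add: SG_def evJ_def)
  qed
  ultimately show ?thesis by (simp add: Sn_iff)
qed

lemma Sn_eprod: "egood L \<Longrightarrow> eprod L \<in> Sn (edeg L)"
proof (induction L)
  case (Cons x L)
  then have "fst x \<in> degrees Q" "snd x \<in> SL (fst x)" "egood L" by (auto simp: egood_def)
  then show ?case using Cons.IH by (auto intro!: Sn_homog edeg_degrees Sn_eg)
qed (simp add: Sn_1)

text \<open>Since n(n + 1) - (n - 1)n = 2n, a segment loses twice its length when it is shortened by
  one.\<close>

lemma Nw_diff:
  assumes "\<And>i a. i \<in> V \<Longrightarrow> a \<in> {1..d i} \<Longrightarrow> k i a \<le> 1 \<and> k i a \<le> len i a"
  shows "Nw d len = Nw d (\<lambda>i a. len i a - k i a) + 2 * (\<Sum>i\<in>V. \<Sum>a\<in>{1..d i}. k i a * len i a)"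
proof -
  have "len i a * (len i a + 1) = (len i a - k i a) * (len i a - k i a + 1) + 2 * (k i a * len i a)"
    if "i \<in> V" "a \<in> {1..d i}" for i a
  proof -
    have "k i a = 0 \<or> k i a = 1 \<and> len i a \<ge> 1" using assms[OF that] by linarith
    then show ?thesis
    proof
      assume "k i a = 1 \<and> len i a \<ge> 1"
      then obtain l where "k i a = 1" "len i a = Suc l" by (metis Suc_le_D One_nat_def)
      then show ?thesis by simp
    qed simp
  qed
  then show ?thesis
    unfolding Nw_def by (simp add: sum.distrib sum_distrib_left)
qed

text \<open>\<open>fits\<close> constrains only the colours in \<open>V\<close>; the third
  assumption makes the index sets of all other colours empty, in accordance with the
  degrees.\<close>

lemma lfun_Gp:
  assumes "egood L" "fits L d len" "\<And>i a. i \<notin> V \<Longrightarrow> a \<in> {1..d i} \<Longrightarrow> len i a = 0"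
  shows "lfun d (Gp L d len)"
  using assms
proof (induction L arbitrary: len)
  case (Cons x L)
  have x: "fst x \<in> degrees Q" "snd x \<in> SL (fst x)" "egood L" using Cons.prems by (auto simp: egood_def)
  have "idx (fst x) (\<lambda>i. {a \<in> {1..d i}. 0 < len i a})"
    unfolding idx_def
  proof (intro allI conjI)
    fix i show "card {a \<in> {1..d i}. 0 < len i a} = fst x i"
    proof (cases "i \<in> V")
      case False
      then have "{a \<in> {1..d i}. 0 < len i a} = {}" using Cons.prems(3) by auto
      then show ?thesis using degrees_D[OF x(1) False] by simp
    qed (use Cons.prems in auto)
  qed simp
  from lfun_evJ[OF x(2) this, of "\<lambda>i a. a" d "\<lambda>_ _. 0"]
  have "lfun d (\<lambda>y. evJ (fst x) (snd x) (\<lambda>i. {a \<in> {1..d i}. 0 < len i a}) y)" by auto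
  moreover have "lfun d (Gp L d (\<lambda>i a. len i a - 1))"
    by (rule Cons.IH) (use x Cons.prems in auto)
  from lfun_subst[OF this, of "\<lambda>i a. a" d "\<lambda>_ _. 1"]
  have "lfun d (\<lambda>y. Gp L d (\<lambda>i a. len i a - 1) (\<lambda>i a. rconst q * y i a))" by simp
  ultimately show ?case unfolding Gp.simps by (rule lfun_mult)
next
  case Nil
  have "Gp [] d len = (\<lambda>y. 1)" by (simp add: fun_eq_iff)
  then show ?case by (simp only: lfun_1)
qed

text \<open>In a nonzero summand the generator takes at most one point from each segment, and the
  rest has weight at most \<open>wtl L\<close> by induction. The loss of weight is at most twice the
  number of points, with equality only if every nonempty segment gives its first point. So at the
  critical weight a single summand can survive, and none does if the number of nonempty segments
  differs from the degree of the generator.\<close>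

lemma eprod_lead:
  assumes "egood L" "tot d len = edeg L"
  shows "(Nw d len > wtl L \<longrightarrow> (\<forall>y. (\<forall>i a. y i a \<noteq> 0) \<longrightarrow> SG (edeg L) (eprod L) d len y = 0)) \<and>
    (Nw d len = wtl L \<longrightarrow> (\<forall>y. (\<forall>i a. y i a \<noteq> 0) \<longrightarrow> SG (edeg L) (eprod L) d len y =
      (if fits L d len then Dv d len y * Lin d len y * Gp L d len y else 0)))"
  using assms
proof (induction L arbitrary: len)
  case Nil
  then have z: "len i a = 0" if "a \<in> {1..d i}" for i a
    using that by (auto simp: tot_def fun_eq_iff)
  have "Dv d len y = 1" "Lin d len y = 1" for y
    unfolding Dv_def Lin_def by (simp_all add: z Kc_def)
  moreover have "Nw d len = 0" by (simp add: Nw_def z)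
  ultimately show ?case by (simp add: SG_def evJ_def z)
next
  case (Cons x L)
  obtain m g where x: "x = (m, g)" by (cases x)
  let ?r = "rvar :: 'i \<Rightarrow> nat \<Rightarrow> ('i, 'k) ratfun"
  have m: "m \<in> degrees Q" and g: "g \<in> SL m" and L: "egood L" using Cons.prems(1) by (auto simp: egood_def x)
  let ?n' = "edeg L" and ?N = "\<lambda>i. m i + edeg L i" and ?P = "shuffle_homog Q t q m (edeg L) (eg m g) (eprod L)"
  have n': "?n' \<in> degrees Q" by (rule edeg_degrees[OF L])
  have E: "eg m g \<in> SL m" "eprod L \<in> SL ?n'" using SL_eg[OF g] Sn_eprod[OF L] by (auto simp: Sn_iff)
  have tot: "tot d len = ?N" using Cons.prems(2) by (simp add: x)
  have idx: "idx ?N (seg d len)" using idx_seg[of d len] tot by simp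
  have z: "len i a = 0" if "i \<notin> V" "a \<in> {1..d i}" for i a
  proof -
    have "tot d len i = 0" using tot degrees_D[OF m that(1)] degrees_D[OF n' that(1)] by simp
    then show ?thesis using that by (auto simp: tot_def)
  qed
  have szl: "sz ?N = (\<Sum>i\<in>V. \<Sum>a\<in>{1..d i}. len i a)"
    using tot by (simp add: sz_def tot_def[abs_def] fun_eq_iff)
  define T where "T A = shuf_term m ?n' (eg m g) (eprod L) A (\<lambda>i. seg d len i - A i) (sp ?r)" for A
  have SGr: "SG ?N ?P d len ?r = (\<Sum>A\<in>Subs m (seg d len). T A)"
    unfolding SG_def T_def shuf_def[symmetric]
    by (rule shuffle_homog_props(2)[OF m n' E idx]) (simp_all add: sp_nz sp_rvar_inj)
  \<comment> \<open>The extremal cut: one point from every nonempty segment.\<close>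
  define k0 where "k0 i a = min 1 (len i a)" for i a
  have T: "Nw d len \<le> wtl (x # L) \<and> (Nw d len = wtl (x # L) \<longrightarrow> A = seg d k0)"
    if A: "A \<in> Subs m (seg d len)" and nz: "T A \<noteq> 0" for A
  proof -
    obtain k where k: "A = seg d k" "\<And>i a. k i a \<le> len i a" "tot d k = m"
      by (rule shuf_term_nonzero[OF m A _ nz[unfolded T_def]]) auto
    have k1: "k i a \<le> 1" if "i \<in> V" "a \<in> {1..d i}" for i a
    proof (rule ccontr)
      assume "\<not> k i a \<le> 1"
      then have "evJ m (eg m g) A (sp ?r) = 0"
        using Subs_idx(1)[OF idx A] that k(1) by (intro evJ_eg_eq_0[of m A _ i a 0]) (auto simp: seg_def)
      with nz show False by (simp add: T_def shuf_term_def)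
    qed
    have tm: "tot d (\<lambda>i a. len i a - k i a) = ?n'"
    proof
      fix i show "tot d (\<lambda>i a. len i a - k i a) i = ?n' i"
        using tot_diff[of d i k len] k tot by simp
    qed
    have "\<not> Nw d (\<lambda>i a. len i a - k i a) > wtl L"
    proof
      assume "Nw d (\<lambda>i a. len i a - k i a) > wtl L"
      then have "SG ?n' (eprod L) d (\<lambda>i a. len i a - k i a) (\<lambda>i a. rconst (q ^ k i a) * ?r i a) = 0"
        using Cons.IH[OF L tm] q_nz by auto
      then have "evJ ?n' (eprod L) (\<lambda>i. seg d len i - A i) (sp ?r) = 0"
        using evJ_Diff_seg[OF E(2) k(2) tm, of ?r] k(1) by simp
      with nz show False by (simp add: T_def shuf_term_def)
    qed
    moreover have Nw: "Nw d len = Nw d (\<lambda>i a. len i a - k i a) + 2 * (\<Sum>i\<in>V. \<Sum>a\<in>{1..d i}. k i a * len i a)"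
      by (rule Nw_diff) (use k1 k(2) in auto)
    moreover have le: "k i a * len i a \<le> len i a" if "i \<in> V" "a \<in> {1..d i}" for i a
      using k1[OF that] by (metis le_antisym le_refl linorder_not_le mult_1 mult_0 less_one zero_le)
    then have "(\<Sum>i\<in>V. \<Sum>a\<in>{1..d i}. k i a * len i a) \<le> sz ?N"
      unfolding szl by (intro sum_mono)
    moreover have "A = seg d k0" if "(\<Sum>i\<in>V. \<Sum>a\<in>{1..d i}. k i a * len i a) = sz ?N"
    proof -
      have kl: "k i a * len i a = len i a" if i: "i \<in> V" and a: "a \<in> {1..d i}" for i a
      proof (rule ccontr)
        assume "k i a * len i a \<noteq> len i a"
        then have "k i a * len i a < len i a" using le[OF i a] by simp
        then have "(\<Sum>a\<in>{1..d i}. k i a * len i a) < (\<Sum>a\<in>{1..d i}. len i a)"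
          by (intro sum_strict_mono_ex1) (use le i a in auto)
        then have "(\<Sum>i\<in>V. \<Sum>a\<in>{1..d i}. k i a * len i a) < (\<Sum>i\<in>V. \<Sum>a\<in>{1..d i}. len i a)"
          by (intro sum_strict_mono_ex1[OF finV] ballI sum_mono bexI[OF _ i]) (use le in auto)
        then show False using \<open>_ = sz ?N\<close> szl by simp
      qed
      have "k i a = k0 i a" if "a \<in> {1..d i}" for i a
      proof (cases "i \<in> V")
        case True
        then show ?thesis using kl[OF True that] k(2)[of i a] k1[OF True that] by (auto simp: k0_def min_def le_Suc_eq)
      qed (use z[of i a] k(2)[of i a] that in \<open>auto simp: k0_def\<close>)
      then show ?thesis unfolding k(1) by (auto simp: seg_def fun_eq_iff)
    qed
    ultimately show ?thesis by (auto simp: x)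
  qed
  have lSG: "lfun d (SG ?N ?P d len)"
    using lfun_SG[of ?P d len] shuffle_homog_props(1)[OF m n' E] tot by simp
  have van: "SG ?N ?P d len y = 0" if "Nw d len > wtl (x # L)" "\<forall>i a. y i a \<noteq> 0" for y
  proof (rule lfun_eqI[OF lSG lfun_0[of d]])
    show "SG ?N ?P d len ?r = 0"
      unfolding SGr by (rule sum.neutral) (use T that in fastforce)
  qed (use that in auto)
  have lead: "SG ?N ?P d len y = (if fits (x # L) d len then Dv d len y * Lin d len y * Gp (x # L) d len y else 0)"
    if eq: "Nw d len = wtl (x # L)" and y: "\<forall>i a. y i a \<noteq> 0" for y
  proof (rule lfun_eqI[OF lSG, where n' = d and g = "\<lambda>y. if fits (x # L) d len then Dv d len y * Lin d len y * Gp (x # L) d len y else 0"])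
    show "lfun d (\<lambda>y. if fits (x # L) d len then Dv d len y * Lin d len y * Gp (x # L) d len y else 0)"
      using lfun_Gp[OF Cons.prems(1) _ z, of d] lfun_Dv lfun_Lin lfun_0
      by (cases "fits (x # L) d len") (auto intro!: lfun_mult simp del: fits.simps Gp.simps)
    let ?L1 = "\<lambda>i a. len i a - 1" and ?J0 = "\<lambda>i. {a \<in> {1..d i}. 0 < len i a}"
    have k0: "len i a - k0 i a = len i a - 1" for i a by (simp add: k0_def)
    have card0: "card (seg d k0 i) = card (?J0 i)" for i
    proof -
      have "bij_betw fst (seg d k0 i) (?J0 i)"
        by (rule bij_betwI[where g = "\<lambda>a. (a, 0)"]) (auto simp: seg_def k0_def)
      then show ?thesis by (rule bij_betw_same_card)
    qed
    have "seg d k0 i \<subseteq> seg d len i" for i by (auto simp: seg_def k0_def)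
    moreover have "card (?J0 i) = m i" if "i \<notin> V" for i
    proof -
      have "?J0 i = {}" using z[OF that] by auto
      then show ?thesis using degrees_D[OF m that] by simp
    qed
    \<comment> \<open>The extremal cut has the degree of the generator only if these counts agree;
      for colours outside \<open>V\<close> both sides are 0.\<close>
    ultimately have A0: "seg d k0 \<in> Subs m (seg d len) \<longleftrightarrow> (\<forall>i\<in>V. m i = card (?J0 i))"
      unfolding Subs_def card0[symmetric] by (auto simp: card0) metis+
    have SG0: "SG ?N ?P d len ?r = (if \<forall>i\<in>V. m i = card (?J0 i) then T (seg d k0) else 0)"
    proof (cases "\<forall>i\<in>V. m i = card (?J0 i)")
      case True
      then have "SG ?N ?P d len ?r = (\<Sum>A\<in>{seg d k0}. T A)"
        unfolding SGr using A0 T eq by (intro sum.mono_neutral_right finite_Subs[OF m n' idx]) auto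
      then show ?thesis using True by simp
    next
      case False
      then have "SG ?N ?P d len ?r = 0"
        unfolding SGr using A0 T eq by (intro sum.neutral) auto
      then show ?thesis by (simp only: if_not_P[OF False])
    qed
    show "SG ?N ?P d len ?r = (if fits (x # L) d len then Dv d len ?r * Lin d len ?r * Gp (x # L) d len ?r else 0)"
    proof (cases "\<forall>i\<in>V. m i = card (?J0 i)")
      case True
      have sub: "seg d k0 \<in> Subs m (seg d len)" using A0 True by simp
      have ik: "idx m (seg d k0)" by (rule Subs_idx(1)[OF idx sub])
      have km: "tot d k0 = m"
      proof
        fix i show "tot d k0 i = m i" using ik idx_seg[of d k0] by (simp add: idx_def)
      qed
      have tm: "tot d ?L1 = ?n'"
      proof
        fix i show "tot d ?L1 i = ?n' i"
          using tot_diff[of d i k0 len] km tot k0 by (simp add: k0_def)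
      qed
      have NwL: "Nw d ?L1 = wtl L"
      proof -
        have "Nw d len = Nw d ?L1 + 2 * (\<Sum>i\<in>V. \<Sum>a\<in>{1..d i}. k0 i a * len i a)"
          using Nw_diff[of d k0 len] unfolding k0 by (simp add: k0_def)
        also have "(\<Sum>i\<in>V. \<Sum>a\<in>{1..d i}. k0 i a * len i a) = sz ?N"
          unfolding szl by (intro sum.cong refl) (auto simp: k0_def min_def)
        finally show ?thesis using eq by (simp add: x)
      qed
      have e1: "evJ m (eg m g) (seg d k0) (sp ?r) = evJ m g ?J0 ?r * (\<Prod>i\<in>V. \<Prod>x\<in>seg d k0 i. \<Prod>z\<in>seg d k0 i. ef (sp ?r) i x z)"
      proof -
        have "evJ m g (seg d k0) (sp ?r) = evJ m g ?J0 ?r"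
        proof (rule evJ_reindex[OF g ik, where h = "\<lambda>i. fst"])
          show "bij_betw fst (seg d k0 i) (?J0 i)" for i
            by (rule bij_betwI[where g = "\<lambda>a. (a, 0)"]) (auto simp: seg_def k0_def)
        qed (auto simp: seg_def k0_def sp_def q_nz)
        then show ?thesis by (simp add: evJ_eg[OF ik] sp_nz)
      qed
      have e2: "evJ ?n' (eprod L) (\<lambda>i. seg d len i - seg d k0 i) (sp ?r) =
        (if fits L d ?L1 then Dv d ?L1 ?r * Lin d ?L1 ?r * Gp L d ?L1 (\<lambda>i a. rconst q * ?r i a) else 0)"
      proof -
        have "evJ ?n' (eprod L) (\<lambda>i. seg d len i - seg d k0 i) (sp ?r) =
          SG ?n' (eprod L) d ?L1 (\<lambda>i a. rconst (q ^ k0 i a) * ?r i a)"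
          using evJ_Diff_seg[OF E(2), of d k0 len ?r] tm unfolding k0 by (simp add: k0_def)
        also have "\<dots> = SG ?n' (eprod L) d ?L1 (\<lambda>i a. rconst q * ?r i a)"
          unfolding SG_def
        proof (rule evJ_cong[OF E(2)])
          show "idx ?n' (seg d ?L1)" using idx_seg[of d ?L1] tm by simp
          show "sp (\<lambda>i a. rconst (q ^ k0 i a) * ?r i a) i x = sp (\<lambda>i a. rconst q * ?r i a) i x"
            if "i \<in> V" "x \<in> seg d ?L1 i" for i x
            using that by (auto simp: sp_def seg_def k0_def min_def)
        qed (use q_nz in \<open>auto simp: sp_def\<close>)
        also have "\<dots> = (if fits L d ?L1 then Dv d ?L1 ?r * Lin d ?L1 ?r * Gp L d ?L1 (\<lambda>i a. rconst q * ?r i a) else 0)"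
        proof -
          have "\<forall>i a. rconst q * ?r i a \<noteq> 0" using q_nz by simp
          then show ?thesis
            using Cons.IH[OF L tm] NwL by (simp add: Dv_scale Lin_scale)
        qed
        finally show ?thesis .
      qed
      have "T (seg d k0) = (if fits L d ?L1 then Dv d len ?r * Lin d len ?r * (evJ m g ?J0 ?r * Gp L d ?L1 (\<lambda>i a. rconst q * ?r i a)) else 0)"
      proof (cases "fits L d ?L1")
        case True
        then show ?thesis
          unfolding T_def shuf_term_def zeta_prod e1 e2 lead_factor[of d len, folded k0_def, symmetric]
          by (simp only: if_True mult_ac)
      next
        case False
        then show ?thesis by (simp add: T_def shuf_term_def e2)
      qed
      then show ?thesis using SG0 True by (simp add: x)
    next
      case False
      then have "\<not> fits (x # L) d len" unfolding x fits.simps fst_conv by (rule contrapos_nn) (rule conjunct1)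
      then show ?thesis unfolding SG0 if_not_P[OF False] by (simp only: if_False)
    qed
  qed (use y in auto)
  have "eprod (x # L) = ?P" "edeg (x # L) = ?N" by (simp_all add: x)
  then show ?case using van lead by (simp del: fits.simps Gp.simps wtl.simps)
qed

end

section \<open>Laurent polynomials symmetric in blocks of variables\<close>

definition vmap :: "('i \<Rightarrow> nat \<Rightarrow> nat) \<Rightarrow> 'i var \<Rightarrow> 'i var"
  where "vmap \<sigma> v = (case v of Var i a \<Rightarrow> Var i (\<sigma> i a))"

lemma vmap_Var [simp]: "vmap \<sigma> (Var i a) = Var i (\<sigma> i a)"
  by (simp add: vmap_def)

lemma inj_vmap:
  assumes "\<sigma> \<in> perm_families n"
  shows "inj (vmap \<sigma>)"
proof (rule injI)
  fix v w assume eq: "vmap \<sigma> v = vmap \<sigma> w"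
  obtain i a j b where vw: "v = Var i a" "w = Var j b" by (metis var.exhaust)
  have "inj (\<sigma> i)" using assms permutes_inj by (auto simp: perm_families_def)
  then show "v = w" using eq by (auto simp: vw dest: injD)
qed

text \<open>The exponent at v becomes that at its image under \<sigma>, so the variables are renamed
  by the inverse of \<sigma>; hence \<open>pinv\<close> in the description of the support.\<close>

definition act :: "('i \<Rightarrow> nat \<Rightarrow> nat) \<Rightarrow> ('i var \<Rightarrow>\<^sub>0 int) \<Rightarrow> ('i var \<Rightarrow>\<^sub>0 int)"
  where "act \<sigma> m = Poly_Mapping.map_key (vmap \<sigma>) m"

lemma lookup_act: "\<sigma> \<in> perm_families n \<Longrightarrow> lookup (act \<sigma> m) v = lookup m (vmap \<sigma> v)"
  unfolding act_def by (subst map_key.rep_eq) (simp_all add: inj_vmap)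

definition pinv :: "('i \<Rightarrow> nat \<Rightarrow> nat) \<Rightarrow> 'i \<Rightarrow> nat \<Rightarrow> nat"
  where "pinv \<sigma> i = inv (\<sigma> i)"

lemma pinv_perm: "\<sigma> \<in> perm_families n \<Longrightarrow> pinv \<sigma> \<in> perm_families n"
  by (simp add: perm_families_def pinv_def permutes_inv)

lemma vmap_pinv:
  assumes "\<sigma> \<in> perm_families n"
  shows "vmap \<sigma> (vmap (pinv \<sigma>) v) = v" "vmap (pinv \<sigma>) (vmap \<sigma> v) = v"
proof -
  obtain i a where v: "v = Var i a" by (cases v)
  have "\<sigma> i permutes {1..n i}" using assms by (simp add: perm_families_def)
  then show "vmap \<sigma> (vmap (pinv \<sigma>) v) = v" "vmap (pinv \<sigma>) (vmap \<sigma> v) = v"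
    by (simp_all add: v pinv_def permutes_inverses)
qed

lemma act_pinv:
  assumes "\<sigma> \<in> perm_families n"
  shows "act \<sigma> (act (pinv \<sigma>) m) = m" "act (pinv \<sigma>) (act \<sigma> m) = m"
  by (rule poly_mapping_eqI,
      simp add: lookup_act[OF assms] lookup_act[OF pinv_perm[OF assms]] vmap_pinv[OF assms])+

lemma keys_act:
  assumes "\<sigma> \<in> perm_families n"
  shows "keys (act \<sigma> m) = vmap (pinv \<sigma>) ` keys m"
proof -
  have "v \<in> keys (act \<sigma> m) \<longleftrightarrow> v \<in> vmap (pinv \<sigma>) ` keys m" for v
  proof
    assume "v \<in> keys (act \<sigma> m)"
    then have "vmap \<sigma> v \<in> keys m" by (simp add: in_keys_iff lookup_act[OF assms])
    then show "v \<in> vmap (pinv \<sigma>) ` keys m"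
      by (rule image_eqI[rotated]) (simp add: vmap_pinv[OF assms])
  next
    assume "v \<in> vmap (pinv \<sigma>) ` keys m"
    then show "v \<in> keys (act \<sigma> m)"
      by (auto simp: in_keys_iff lookup_act[OF assms] vmap_pinv[OF assms])
  qed
  then show ?thesis by blast
qed

lemma card_keys_act: "\<sigma> \<in> perm_families n \<Longrightarrow> card (keys (act \<sigma> m)) = card (keys m)"
  by (simp add: keys_act card_image inj_on_subset[OF inj_vmap[OF pinv_perm]])

lemma mon_act:
  assumes "\<sigma> \<in> perm_families n"
  shows "mon (case_var (\<lambda>i a. p i (\<sigma> i a))) (act \<sigma> m) = mon (case_var p) m"
proof -
  have cv: "case_var (\<lambda>i a. p i (\<sigma> i a)) v = case_var p (vmap \<sigma> v)" for v
    by (cases v) simp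
  have "mon (case_var (\<lambda>i a. p i (\<sigma> i a))) (act \<sigma> m) =
    (\<Prod>v\<in>vmap (pinv \<sigma>) ` keys m. case_var p (vmap \<sigma> v) powi lookup m (vmap \<sigma> v))"
    unfolding mon_def keys_act[OF assms] cv lookup_act[OF assms] ..
  also have "\<dots> = mon (case_var p) m"
    unfolding mon_def
    by (subst prod.reindex) (auto simp: inj_on_subset[OF inj_vmap[OF pinv_perm[OF assms]]] vmap_pinv[OF assms])
  finally show ?thesis .
qed

definition res :: "('i \<Rightarrow> nat \<Rightarrow> nat) \<Rightarrow> nat \<Rightarrow> ('i var \<Rightarrow>\<^sub>0 int) \<Rightarrow> ('i var \<Rightarrow>\<^sub>0 int)"
  where "res lev k m = (\<Sum>v\<in>{v \<in> keys m. case_var lev v = k}. single v (lookup m v))"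

lemma lookup_res: "lookup (res lev k m) v = (if case_var lev v = k then lookup m v else 0)"
  by (auto simp: res_def lookup_sum lookup_single when_def in_keys_iff sum.If_cases intro: sum.neutral)

lemma keys_res: "keys (res lev k m) = {v \<in> keys m. case_var lev v = k}"
  by (auto simp: in_keys_iff lookup_res split: if_splits)

text \<open>In the application the variables stand for the segments of a partition,
  \<open>lev\<close> is the length minus 1, and \<open>mk k\<close> counts the segments of level at
  least k; these come first because each colour is sorted by descending length. The aim is to
  express Laurent polynomials symmetric within each level by products over k of ones symmetric in
  all variables of level at least k.\<close>

locale block_symmetric = quiver_shuffle Q t q
  for Q :: "('i, 'e) pre_digraph" and t :: "'e \<Rightarrow> 'k::field_char_0" and q :: 'k +
  fixes d :: "'i \<Rightarrow> nat" and lev :: "'i \<Rightarrow> nat \<Rightarrow> nat" and K :: nat and mk :: "nat \<Rightarrow> 'i \<Rightarrow> nat"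
  assumes d_deg: "d \<in> degrees Q" and mk_deg: "\<And>k. mk k \<in> degrees Q"
    and lev_less: "\<And>i a. i \<in> V \<Longrightarrow> a \<in> {1..d i} \<Longrightarrow> lev i a < K"
    and mk: "\<And>k i. i \<in> V \<Longrightarrow> {1..mk k i} = {a \<in> {1..d i}. k \<le> lev i a}"
begin

definition G :: "('i \<Rightarrow> nat \<Rightarrow> nat) set"
  where "G = {\<sigma> \<in> perm_families d. \<forall>i a. lev i (\<sigma> i a) = lev i a}"

definition orbit :: "nat \<Rightarrow> ('i var \<Rightarrow>\<^sub>0 int) \<Rightarrow> ('i var \<Rightarrow>\<^sub>0 int) set"
  where "orbit k \<eta> = (\<lambda>\<sigma>. act \<sigma> \<eta>) ` perm_families (mk k)"

definition orb :: "nat \<Rightarrow> ('i var \<Rightarrow>\<^sub>0 int) \<Rightarrow> ('i, 'k) laurent"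
  where "orb k \<eta> = (\<Sum>m\<in>orbit k \<eta>. single m 1)"

text \<open>Only the variables that occur matter, not their exponents. Each one counts less the
  higher its level, and those of level below \<open>K\<close> have positive weight.\<close>

definition weight :: "('i var \<Rightarrow>\<^sub>0 int) \<Rightarrow> nat"
  where "weight m = (\<Sum>v\<in>keys m. K - case_var lev v)"

definition invariant :: "('i, 'k) laurent \<Rightarrow> bool"
  where "invariant H \<longleftrightarrow> H \<in> LR d \<and> (\<forall>\<sigma>\<in>G. evl (\<lambda>i a. rvar i (\<sigma> i a)) H = evl rvar H)"

lemma lvars_mk: "lvars (mk k) = {v \<in> lvars d. k \<le> case_var lev v}"
proof -
  have "a \<in> {1..mk k i} \<longleftrightarrow> a \<in> {1..d i} \<and> k \<le> lev i a" if "i \<in> V" for i a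
    unfolding mk[OF that] by simp
  then show ?thesis by (auto simp: lvars_def simp del: atLeastAtMost_iff)
qed

lemma lev_lvars: "v \<in> lvars d \<Longrightarrow> case_var lev v < K"
  using lev_less by (auto simp: lvars_def)

lemma finite_orbit: "finite (orbit k \<eta>)"
  unfolding orbit_def by (intro finite_imageI finite_perm_families mk_deg)

lemma orbit_act:
  assumes "\<sigma> \<in> perm_families (mk k)" "m \<in> orbit k \<eta>"
  shows "act \<sigma> m \<in> orbit k \<eta>"
proof -
  obtain \<tau> where \<tau>: "\<tau> \<in> perm_families (mk k)" "m = act \<tau> \<eta>" using assms(2) by (auto simp: orbit_def)
  have p: "(\<lambda>i. \<tau> i \<circ> \<sigma> i) \<in> perm_families (mk k)"
    using assms(1) \<tau>(1) by (auto simp: perm_families_def intro: permutes_compose)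
  have "act \<sigma> m = act (\<lambda>i. \<tau> i \<circ> \<sigma> i) \<eta>"
  proof (rule poly_mapping_eqI)
    fix v
    show "lookup (act \<sigma> m) v = lookup (act (\<lambda>i. \<tau> i \<circ> \<sigma> i) \<eta>) v"
      by (cases v) (simp add: lookup_act[OF p] lookup_act[OF assms(1)] \<tau>(2) lookup_act[OF \<tau>(1)])
  qed
  then show ?thesis using p by (auto simp: orbit_def)
qed

lemma keys_orbit:
  assumes "keys \<eta> \<subseteq> lvars (mk k)" "m \<in> orbit k \<eta>"
  shows "keys m \<subseteq> lvars (mk k)"
proof -
  obtain \<tau> where \<tau>: "\<tau> \<in> perm_families (mk k)" "m = act \<tau> \<eta>" using assms(2) by (auto simp: orbit_def)
  have "pinv \<tau> i permutes {1..mk k i}" for i using pinv_perm[OF \<tau>(1)] by (simp add: perm_families_def)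
  then have "vmap (pinv \<tau>) v \<in> lvars (mk k)" if "v \<in> lvars (mk k)" for v
    using that by (auto simp: lvars_def permutes_in_image simp del: atLeastAtMost_iff)
  then show ?thesis using assms(1) by (auto simp: \<tau>(2) keys_act[OF \<tau>(1)])
qed

lemma SL_orb:
  assumes "keys \<eta> \<subseteq> lvars (mk k)"
  shows "orb k \<eta> \<in> SL (mk k)"
proof (rule SL_I)
  show "orb k \<eta> \<in> LR (mk k)"
    unfolding orb_def by (intro LR_sum LR_single R_1 keys_orbit[OF assms])
next
  fix \<sigma> assume \<sigma>: "\<sigma> \<in> perm_families (mk k)"
  let ?s = "case_var (\<lambda>i a. rvar i (\<sigma> i a)) :: 'i var \<Rightarrow> ('i, 'k) ratfun"
  have "evl (\<lambda>i a. rvar i (\<sigma> i a)) (orb k \<eta>) = (\<Sum>m\<in>orbit k \<eta>. mon ?s m)"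
    by (simp add: orb_def lsubst_sum)
  also have "\<dots> = (\<Sum>m\<in>orbit k \<eta>. mon (case_var rvar) m)"
  proof (rule sum.reindex_bij_witness[where i = "act \<sigma>" and j = "act (pinv \<sigma>)"])
    fix m assume m: "m \<in> orbit k \<eta>"
    show "act \<sigma> (act (pinv \<sigma>) m) = m" "act (pinv \<sigma>) (act \<sigma> m) = m" by (rule act_pinv[OF \<sigma>])+
    show "act (pinv \<sigma>) m \<in> orbit k \<eta>" by (rule orbit_act[OF pinv_perm[OF \<sigma>] m])
    show "act \<sigma> m \<in> orbit k \<eta>" by (rule orbit_act[OF \<sigma> m])
    show "mon (case_var rvar) (act (pinv \<sigma>) m) = mon ?s m"
      using mon_act[OF \<sigma>, of rvar "act (pinv \<sigma>) m", symmetric] by (simp only: act_pinv(1)[OF \<sigma>])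
  qed
  also have "\<dots> = evl rvar (orb k \<eta>)"
    by (simp add: orb_def lsubst_sum)
  finally show "evl (\<lambda>i a. rvar i (\<sigma> i a)) (orb k \<eta>) = evl rvar (orb k \<eta>)" .
qed

lemma LR_mono: "E \<in> LR (mk k) \<Longrightarrow> E \<in> LR d"
  using lvars_mk[of k] by (fastforce simp: LR_iff)

text \<open>A permutation preserving levels maps the variables of level at least k among themselves,
  and there it acts as a member of the full symmetric group under which the orbit sum is
  symmetric.\<close>

lemma invariant_orb:
  assumes "keys \<eta> \<subseteq> lvars (mk k)"
  shows "invariant (orb k \<eta>)"
proof -
  have S: "orb k \<eta> \<in> SL (mk k)" by (rule SL_orb[OF assms])
  have "evl (\<lambda>i a. rvar i (\<sigma> i a)) (orb k \<eta>) = evl rvar (orb k \<eta>)" if \<sigma>: "\<sigma> \<in> G" for \<sigma>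
  proof -
    define \<sigma>' where "\<sigma>' i a = (if a \<in> {1..mk k i} then \<sigma> i a else a)" for i a
    have "\<sigma>' i permutes {1..mk k i}" for i
    proof (cases "i \<in> V")
      case True
      have p: "\<sigma> i permutes {1..d i}" and l: "lev i (\<sigma> i a) = lev i a" for a
        using \<sigma> by (auto simp: G_def perm_families_def)
      have "\<sigma> i a \<in> {1..mk k i}" if "a \<in> {1..mk k i}" for a
        using that l permutes_in_image[OF p, of a] unfolding mk[OF True] by simp
      then have "\<sigma>' i ` {1..mk k i} \<subseteq> {1..mk k i}" by (auto simp: \<sigma>'_def)
      moreover have "inj_on (\<sigma>' i) {1..mk k i}"
        by (rule inj_on_cong[THEN iffD1, OF _ permutes_inj_on[OF p]]) (simp add: \<sigma>'_def)
      ultimately have "bij_betw (\<sigma>' i) {1..mk k i} {1..mk k i}"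
        by (simp add: bij_betw_def endo_inj_surj)
      then show ?thesis by (rule bij_imp_permutes) (auto simp: \<sigma>'_def)
    next
      case False
      then have "mk k i = 0" by (rule degrees_D[OF mk_deg])
      then show ?thesis by (auto simp: \<sigma>'_def[abs_def] permutes_def)
    qed
    then have "\<sigma>' \<in> perm_families (mk k)" by (simp add: perm_families_def)
    have "evl (\<lambda>i a. rvar i (\<sigma> i a)) (orb k \<eta>) = evl (\<lambda>i a. rvar i (\<sigma>' i a)) (orb k \<eta>)"
      by (rule lsubst_cong) (use SL_LR[OF S] in \<open>force simp: LR_iff lvars_def \<sigma>'_def\<close>)
    also have "\<dots> = evl rvar (orb k \<eta>)"
      by (rule SL_evl[OF S \<open>\<sigma>' \<in> perm_families (mk k)\<close>]) simp
    finally show ?thesis .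
  qed
  then show ?thesis using LR_mono[OF SL_LR[OF S]] by (simp add: invariant_def)
qed

lemma invariant_add: "invariant E \<Longrightarrow> invariant E' \<Longrightarrow> invariant (E + E')"
  by (simp add: invariant_def LR_add)

lemma invariant_scale: "c \<in> R \<Longrightarrow> invariant E \<Longrightarrow> invariant (lconst c * E)"
  by (simp add: invariant_def LR_mult LR_lconst evl_scale)

lemma invariant_prod: "(\<And>x. x \<in> A \<Longrightarrow> invariant (f x)) \<Longrightarrow> invariant (\<Prod>x\<in>A. f x)"
  by (simp add: invariant_def LR_prod evl_prod)

lemma invariant_lookup:
  assumes "invariant H" "\<sigma> \<in> G"
  shows "lookup H (act \<sigma> m) = lookup H m"
proof -
  have \<sigma>: "\<sigma> \<in> perm_families d" using assms(2) by (simp add: G_def)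
  let ?s = "case_var (\<lambda>i a. rvar i (\<sigma> i a)) :: 'i var \<Rightarrow> ('i, 'k) ratfun"
  let ?H = "\<Sum>m\<in>keys H. single (act (pinv \<sigma>) m) (lookup H m)"
  have "mon ?s m = mon (case_var rvar) (act (pinv \<sigma>) m)" for m
    using mon_act[OF \<sigma>, of rvar "act (pinv \<sigma>) m"] act_pinv[OF \<sigma>] by simp
  then have "lsubst ?s H = lsubst (case_var rvar) ?H"
    by (simp add: lsubst_mon[of _ H] lsubst_sum)
  then have "to_fract H = to_fract ?H"
    using assms by (simp add: invariant_def lsubst_rvar)
  then have "H = ?H" by (simp only: to_fract_eq_iff)
  then have "lookup H m = lookup ?H m" by simp
  also have "\<dots> = (\<Sum>m'\<in>keys H. if m' = act \<sigma> m then lookup H m' else 0)"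
    unfolding lookup_sum lookup_single when_def
    by (intro sum.cong refl) (use act_pinv[OF \<sigma>] in metis)
  also have "\<dots> = lookup H (act \<sigma> m)"
    by (simp add: in_keys_iff)
  finally show ?thesis ..
qed

lemma weight_superset:
  assumes "finite S" "keys m \<subseteq> S"
  shows "weight m \<le> (\<Sum>v\<in>S. K - case_var lev v)"
  unfolding weight_def by (rule sum_mono2) (use assms in auto)

lemma weight_sum: "finite A \<Longrightarrow> weight (\<Sum>x\<in>A. f x) \<le> (\<Sum>x\<in>A. weight (f x))"
proof (induction A rule: finite_induct)
  case (insert x F)
  have "weight (f x + sum f F) \<le> (\<Sum>v\<in>keys (f x) \<union> keys (sum f F). K - case_var lev v)"
    by (rule weight_superset) (auto simp: keys_add)
  also have "\<dots> \<le> weight (f x) + weight (sum f F)"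
    unfolding weight_def by (subst sum.union_inter[symmetric]) auto
  finally show ?case using insert by simp
qed (simp add: weight_def)

lemma sum_res:
  assumes "keys m \<subseteq> lvars d"
  shows "(\<Sum>k<K. res lev k m) = m"
proof (rule poly_mapping_eqI)
  fix v
  have "lookup (\<Sum>k<K. res lev k m) v = (\<Sum>k<K. if case_var lev v = k then lookup m v else 0)"
    by (simp add: lookup_sum lookup_res)
  also have "\<dots> = (if case_var lev v < K then lookup m v else 0)"
    by (subst sum.delta') auto
  also have "\<dots> = lookup m v"
    using assms lev_lvars[of v] by (auto simp: in_keys_iff)
  finally show "lookup (\<Sum>k<K. res lev k m) v = lookup m v" .
qed

lemma sum_weight_res:
  assumes "keys m \<subseteq> lvars d"
  shows "(\<Sum>k<K. weight (res lev k m)) = weight m"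
proof -
  have "(\<Sum>k<K. weight (res lev k m)) = (\<Sum>k\<in>{..<K}. \<Sum>v\<in>{v \<in> keys m. case_var lev v = k}. K - case_var lev v)"
    by (simp add: weight_def keys_res)
  also have "\<dots> = weight m"
    unfolding weight_def by (rule sum.group) (use assms lev_lvars in auto)
  finally show ?thesis .
qed

lemma keys_res_subset: "keys m \<subseteq> lvars d \<Longrightarrow> keys (res lev k m) \<subseteq> lvars (mk k)"
  by (auto simp: keys_res lvars_mk)

text \<open>Moving exponents from their own block to a higher one, or merging them, strictly lowers the weight.\<close>

lemma weight_orbit:
  assumes m: "keys m \<subseteq> lvars d" and \<eta>: "\<eta> \<in> orbit k (res lev k m)"
  shows "weight \<eta> \<le> weight (res lev k m)"
    and "weight \<eta> = weight (res lev k m) \<Longrightarrow> v \<in> keys \<eta> \<Longrightarrow> case_var lev v = k"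
proof -
  have c: "card (keys \<eta>) = card (keys (res lev k m))"
    using \<eta> by (auto simp: orbit_def card_keys_act)
  have sub: "keys \<eta> \<subseteq> lvars (mk k)" by (rule keys_orbit[OF keys_res_subset[OF m] \<eta>])
  have w: "weight (res lev k m) = (\<Sum>v\<in>keys \<eta>. K - k)"
    by (simp add: weight_def keys_res c[unfolded keys_res])
  have le: "K - case_var lev v \<le> K - k" if "v \<in> keys \<eta>" for v
    using sub that by (auto simp: lvars_mk)
  show "weight \<eta> \<le> weight (res lev k m)"
    unfolding w unfolding weight_def by (rule sum_mono) (rule le)
  assume eq: "weight \<eta> = weight (res lev k m)" and v: "v \<in> keys \<eta>"
  have "K - case_var lev v = K - k"
  proof (rule ccontr)
    assume "K - case_var lev v \<noteq> K - k"
    then have "weight \<eta> < (\<Sum>v\<in>keys \<eta>. K - k)"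
      unfolding weight_def using le v by (intro sum_strict_mono_ex1) (auto intro!: bexI[of _ v] simp: le_less)
    then show False using eq w by simp
  qed
  moreover have "case_var lev v < K" "k \<le> case_var lev v" using sub v lev_lvars by (auto simp: lvars_mk)
  ultimately show "case_var lev v = k" by simp
qed

definition Pi_orb :: "('i var \<Rightarrow>\<^sub>0 int) \<Rightarrow> ('i, 'k) laurent"
  where "Pi_orb m = (\<Prod>k<K. orb k (res lev k m))"

lemma Pi_orb_sum:
  "Pi_orb m = (\<Sum>p\<in>PiE {..<K} (\<lambda>k. orbit k (res lev k m)). single (\<Sum>k<K. p k) 1)"
proof -
  have single_prod: "(\<Prod>k\<in>A. single (p k) 1) = (single (\<Sum>k\<in>A. p k) 1 :: ('i, 'k) laurent)"
    for p :: "nat \<Rightarrow> 'i var \<Rightarrow>\<^sub>0 int" and A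
    by (induction A rule: infinite_finite_induct) (simp_all add: mult_single)
  show ?thesis
    unfolding Pi_orb_def orb_def by (subst prod_sum_PiE) (simp_all add: finite_orbit single_prod)
qed

text \<open>Unitriangularity. A monomial of the product is a sum of one \<open>p k\<close> from each
  orbit. If it has full weight, every \<open>p k\<close> is supported in level k and is therefore
  the level k part of the monomial. So the choice is unique and the coefficient is 1, not a larger
  integer that might fail to be invertible in \<open>R\<close>.\<close>

lemma lookup_Pi_orb:
  assumes m: "keys m \<subseteq> lvars d" and nz: "lookup (Pi_orb m) \<mu> \<noteq> 0"
  shows "weight \<mu> \<le> weight m"
    and "weight \<mu> = weight m \<Longrightarrow> lookup (Pi_orb m) \<mu> = 1 \<and> (\<forall>k<K. res lev k \<mu> \<in> orbit k (res lev k m))"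
proof -
  let ?F = "PiE {..<K} (\<lambda>k. orbit k (res lev k m))"
  have finF: "finite ?F" by (intro finite_PiE finite_orbit) auto
  have lk: "lookup (Pi_orb m) \<mu> = (\<Sum>p\<in>?F. if (\<Sum>k<K. p k) = \<mu> then 1 else 0)"
    by (simp add: Pi_orb_sum lookup_sum lookup_single when_def)
  have "\<exists>p\<in>?F. (\<Sum>k<K. p k) = \<mu>"
  proof (rule ccontr)
    assume "\<not> (\<exists>p\<in>?F. (\<Sum>k<K. p k) = \<mu>)"
    then have "lookup (Pi_orb m) \<mu> = 0" unfolding lk by (intro sum.neutral) auto
    with nz show False by simp
  qed
  then obtain p where p: "p \<in> ?F" "(\<Sum>k<K. p k) = \<mu>" by blast
  have le: "weight (p k) \<le> weight (res lev k m)" if "k < K" "p \<in> ?F" for p k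
    using that by (intro weight_orbit(1)[OF m]) auto
  have w: "weight (\<Sum>k<K. p k) \<le> (\<Sum>k<K. weight (p k))" "(\<Sum>k<K. weight (p k)) \<le> weight m" if "p \<in> ?F" for p
  proof -
    show "weight (\<Sum>k<K. p k) \<le> (\<Sum>k<K. weight (p k))" by (rule weight_sum) simp
    show "(\<Sum>k<K. weight (p k)) \<le> weight m"
      unfolding sum_weight_res[OF m, symmetric] by (rule sum_mono) (use le that in auto)
  qed
  show "weight \<mu> \<le> weight m" using w[OF p(1)] p(2) by simp
  assume eq: "weight \<mu> = weight m"
  have uniq: "p k = res lev k \<mu>" if p: "p \<in> ?F" "(\<Sum>k<K. p k) = \<mu>" and k: "k < K" for p k
  proof -
    \<comment> \<open>The weights of the \<open>p j\<close> are bounded one by one and the sum of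
      the bounds is attained, so each bound is attained.\<close>
    have weq: "weight (p j) = weight (res lev j m)" if "j < K" for j
    proof (rule ccontr)
      assume "weight (p j) \<noteq> weight (res lev j m)"
      then have "weight (p j) < weight (res lev j m)" using le[OF that p(1)] by simp
      then have "(\<Sum>k<K. weight (p k)) < (\<Sum>k<K. weight (res lev k m))"
        using le[OF _ p(1)] that by (intro sum_strict_mono_ex1) auto
      then show False using w[OF p(1)] p(2) eq sum_weight_res[OF m] by simp
    qed
    have lev: "case_var lev v = j" if "j < K" "v \<in> keys (p j)" for j v
      using weight_orbit(2)[OF m _ weq[OF that(1)] that(2)] p(1) that(1) by auto
    show ?thesis
    proof (rule poly_mapping_eqI)
      fix v
      have "lookup \<mu> v = (\<Sum>j<K. lookup (p j) v)"
        using p(2) by (simp add: lookup_sum flip: p(2))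
      also have "\<dots> = (\<Sum>j<K. if j = case_var lev v then lookup (p j) v else 0)"
        using lev by (intro sum.cong refl) (auto simp: in_keys_iff)
      finally have "lookup \<mu> v = (if case_var lev v < K then lookup (p (case_var lev v)) v else 0)"
        by simp
      then show "lookup (p k) v = lookup (res lev k \<mu>) v"
        using lev[OF k, of v] k by (auto simp: lookup_res in_keys_iff)
    qed
  qed
  have "{p' \<in> ?F. (\<Sum>k<K. p' k) = \<mu>} = {p}"
  proof -
    have "p' = p" if "p' \<in> ?F" "(\<Sum>k<K. p' k) = \<mu>" for p'
      by (rule PiE_ext[OF that(1) p(1)]) (use uniq[OF that] uniq[OF p] in auto)
    then show ?thesis using p by blast
  qed
  then have "lookup (Pi_orb m) \<mu> = 1"
    unfolding lk using finF by (simp add: sum.If_cases Int_def)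
  moreover have "res lev k \<mu> \<in> orbit k (res lev k m)" if "k < K" for k
    using uniq[OF p that] p(1) that by (metis PiE_mem lessThan_iff)
  ultimately show "lookup (Pi_orb m) \<mu> = 1 \<and> (\<forall>k<K. res lev k \<mu> \<in> orbit k (res lev k m))" by blast
qed

text \<open>The coefficient is a positive count, which is nonzero in characteristic 0;
  \<open>lookup_Pi_orb\<close> then shows that it is 1.\<close>

lemma lookup_Pi_orb_self:
  assumes m: "keys m \<subseteq> lvars d"
  shows "lookup (Pi_orb m) m = 1"
proof -
  let ?F = "PiE {..<K} (\<lambda>k. orbit k (res lev k m))"
  let ?p = "restrict (\<lambda>k. res lev k m) {..<K}"
  have finF: "finite ?F" by (intro finite_PiE finite_orbit) auto
  have "res lev k m \<in> orbit k (res lev k m)" for k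
  proof -
    have id: "(\<lambda>i a. a) \<in> perm_families (mk k)" by (auto simp: perm_families_def permutes_def)
    have "act (\<lambda>i a. a) (res lev k m) = res lev k m"
      by (rule poly_mapping_eqI) (simp add: lookup_act[OF id] vmap_def split: var.split)
    then show ?thesis using id by (force simp: orbit_def)
  qed
  then have p: "?p \<in> ?F" by auto
  have s: "(\<Sum>k<K. ?p k) = m" using sum_res[OF m] by simp
  have "lookup (Pi_orb m) m = of_nat (card {p \<in> ?F. (\<Sum>k<K. p k) = m})"
    using finF by (simp add: Pi_orb_sum lookup_sum lookup_single when_def sum.If_cases Int_def)
  moreover have "card {p \<in> ?F. (\<Sum>k<K. p k) = m} \<noteq> 0"
  proof -
    have "finite {p \<in> ?F. (\<Sum>k<K. p k) = m}" using finF by simp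
    moreover have "?p \<in> {p \<in> ?F. (\<Sum>k<K. p k) = m}" using p s by blast
    ultimately show ?thesis using card_0_eq by blast
  qed
  ultimately have "lookup (Pi_orb m) m \<noteq> 0" by simp
  then show ?thesis using lookup_Pi_orb(2)[OF m, of m] by simp
qed

text \<open>The permutations behind the hypothesis may mix all levels at least k. But the level k
  parts have exponent 0 on higher levels, so after dropping these zeros the multisets of exponents
  on level k agree, and a permutation of that level alone does the same. These permutations are
  glued over all levels and colours.\<close>

lemma orbit_imp_G:
  assumes m: "keys m \<subseteq> lvars d" and orb: "\<And>k. k < K \<Longrightarrow> res lev k \<mu> \<in> orbit k (res lev k m)"
    and \<mu>: "keys \<mu> \<subseteq> lvars d"
  shows "\<exists>\<sigma>\<in>G. \<mu> = act \<sigma> m"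
proof -
  let ?Y = "\<lambda>i k. {a \<in> {1..d i}. lev i a = k}"
  let ?l = "\<lambda>m i a. lookup m (Var i a)"
  have "\<exists>\<tau>. \<tau> permutes ?Y i k \<and> (\<forall>a\<in>?Y i k. ?l \<mu> i a = ?l m i (\<tau> a))" if i: "i \<in> V" for i k
  proof (cases "k < K")
    case True
    obtain \<sigma> where \<sigma>: "\<sigma> \<in> perm_families (mk k)" "res lev k \<mu> = act \<sigma> (res lev k m)"
      using orb[OF True] by (auto simp: orbit_def)
    let ?U = "{1..mk k i}"
    have p: "\<sigma> i permutes ?U" using \<sigma>(1) by (simp add: perm_families_def)
    have "?l (res lev k \<mu>) i a = ?l (res lev k m) i (\<sigma> i a)" for a
      by (simp add: \<sigma>(2) lookup_act[OF \<sigma>(1)])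
    then have "image_mset (?l (res lev k \<mu>) i) (mset_set ?U) = image_mset (\<lambda>a. ?l (res lev k m) i (\<sigma> i a)) (mset_set ?U)"
      by simp
    also have "\<dots> = image_mset (?l (res lev k m) i) (image_mset (\<sigma> i) (mset_set ?U))"
      by (simp add: multiset.map_comp o_def)
    also have "image_mset (\<sigma> i) (mset_set ?U) = mset_set ?U"
      by (simp only: image_mset_mset_set[OF permutes_inj_on[OF p]] permutes_image[OF p])
    finally have U: "image_mset (?l (res lev k \<mu>) i) (mset_set ?U) = image_mset (?l (res lev k m) i) (mset_set ?U)" .
    have "?U = ?Y i k \<union> (?U - ?Y i k)" using mk[OF i] by auto
    then have split: "mset_set ?U = mset_set (?Y i k) + mset_set (?U - ?Y i k)"
      by (metis (no_types, lifting) Diff_disjoint finite_Un finite_atLeastAtMost mset_set_Union)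
    have zero: "image_mset (?l (res lev k m') i) (mset_set (?U - ?Y i k)) = image_mset (\<lambda>_. 0) (mset_set (?U - ?Y i k))" for m'
      using mk[OF i] by (intro image_mset_cong) (auto simp: lookup_res)
    have Y: "image_mset (?l (res lev k m') i) (mset_set (?Y i k)) = image_mset (?l m' i) (mset_set (?Y i k))" for m'
      by (intro image_mset_cong) (auto simp: lookup_res)
    have "image_mset (?l \<mu> i) (mset_set (?Y i k)) = image_mset (?l m i) (mset_set (?Y i k))"
      using U unfolding split image_mset_union zero Y by simp
    then show ?thesis by (rule image_mset_eq_implies_permutes[rotated]) auto
  next
    case False
    then have "?Y i k = {}" using lev_less[OF i] by auto
    then show ?thesis by (intro exI[of _ id]) (simp only: permutes_id, simp)
  qed
  note ex = this
  define \<tau> where "\<tau> i k = (SOME \<tau>. \<tau> permutes ?Y i k \<and> (\<forall>a\<in>?Y i k. ?l \<mu> i a = ?l m i (\<tau> a)))" for i k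
  have \<tau>: "\<tau> i k permutes ?Y i k" "\<And>a. a \<in> ?Y i k \<Longrightarrow> ?l \<mu> i a = ?l m i (\<tau> i k a)" if "i \<in> V" for i k
    using someI_ex[OF ex[OF that, of k]] unfolding \<tau>_def by blast+
  define \<sigma> where "\<sigma> i a = (if i \<in> V \<and> a \<in> {1..d i} then \<tau> i (lev i a) a else a)" for i a
  have mem: "\<sigma> i a \<in> ?Y i (lev i a)" if "i \<in> V" "a \<in> {1..d i}" for i a
    using permutes_in_image[OF \<tau>(1)[OF that(1)], of "lev i a" a] that by (simp add: \<sigma>_def)
  have "\<sigma> i permutes {1..d i}" for i
  proof (cases "i \<in> V")
    case True
    have "inj_on (\<sigma> i) {1..d i}"
    proof (rule inj_onI)
      fix a b assume a: "a \<in> {1..d i}" and b: "b \<in> {1..d i}" and eq: "\<sigma> i a = \<sigma> i b"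
      then have "lev i a = lev i b" using mem[OF True a] mem[OF True b] by simp
      then have "\<tau> i (lev i a) a = \<tau> i (lev i a) b" using eq a b True by (simp add: \<sigma>_def)
      then show "a = b" using permutes_inj[OF \<tau>(1)[OF True]] by (auto dest: injD)
    qed
    moreover have "\<sigma> i ` {1..d i} \<subseteq> {1..d i}" using mem[OF True] by auto
    ultimately have "bij_betw (\<sigma> i) {1..d i} {1..d i}" by (simp add: bij_betw_def endo_inj_surj)
    then show ?thesis by (rule bij_imp_permutes) (auto simp: \<sigma>_def)
  next
    case False
    then have "\<sigma> i = id" by (auto simp: \<sigma>_def)
    then show ?thesis by (simp only: permutes_id)
  qed
  moreover have "lev i (\<sigma> i a) = lev i a" for i a
    using mem[of i a] by (cases "i \<in> V \<and> a \<in> {1..d i}") (auto simp: \<sigma>_def)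
  ultimately have \<sigma>: "\<sigma> \<in> G" "\<sigma> \<in> perm_families d" by (auto simp: G_def perm_families_def)
  have "\<mu> = act \<sigma> m"
  proof (rule poly_mapping_eqI)
    fix v :: "'i var"
    obtain i a where v: "v = Var i a" by (cases v)
    show "lookup \<mu> v = lookup (act \<sigma> m) v"
    proof (cases "i \<in> V \<and> a \<in> {1..d i}")
      case True
      then show ?thesis using \<tau>(2)[of i a "lev i a"] by (simp add: v lookup_act[OF \<sigma>(2)] \<sigma>_def)
    next
      case False
      then have "Var i a \<notin> lvars d" by (auto simp: lvars_def)
      then have "lookup \<mu> (Var i a) = 0" "lookup m (Var i a) = 0"
        using m \<mu> by (auto simp: in_keys_iff)
      then show ?thesis using False by (auto simp: v lookup_act[OF \<sigma>(2)] \<sigma>_def)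
    qed
  qed
  then show ?thesis using \<sigma>(1) by blast
qed

text \<open>Spanning by products of orbit sums, stated as an induction rule. A bound on the weight
  is lowered step by step; for a fixed bound, subtracting a multiple of \<open>Pi_orb m\<close>
  reduces the number of monomials of top weight.\<close>

theorem invariant_induct:
  assumes H: "invariant H"
    and zero: "\<Phi> 0" and add: "\<And>E E'. \<Phi> E \<Longrightarrow> \<Phi> E' \<Longrightarrow> \<Phi> (E + E')"
    and scale: "\<And>c E. c \<in> R \<Longrightarrow> \<Phi> E \<Longrightarrow> \<Phi> (lconst c * E)"
    and orb: "\<And>\<eta>. (\<And>k. k < K \<Longrightarrow> keys (\<eta> k) \<subseteq> lvars (mk k)) \<Longrightarrow> \<Phi> (\<Prod>k<K. orb k (\<eta> k))"
  shows "\<Phi> H"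
proof -
  have main: "\<Phi> H" if "invariant H" "\<forall>m\<in>keys H. weight m < b" for H b
    using that
  proof (induction b arbitrary: H)
    case 0
    then have "keys H = {}" by auto
    then have "H = 0" by simp
    then show ?case using zero by simp
  next
    case (Suc b)
    show ?case
      using Suc.prems
    proof (induction "card {m \<in> keys H. weight m = b}" arbitrary: H rule: less_induct)
      case less
      show ?case
      proof (cases "\<exists>m\<in>keys H. weight m = b")
        case False
        then have "\<forall>m\<in>keys H. weight m < b" using less.prems(2) by (auto simp: less_Suc_eq)
        then show ?thesis by (rule Suc.IH[OF less.prems(1)])
      next
        case True
        then obtain m where m: "m \<in> keys H" "weight m = b" by blast
        let ?c = "lookup H m"
        have LR: "H \<in> LR d" using less.prems(1) by (simp add: invariant_def)
        have c: "- ?c \<in> R" using LR by (intro R_uminus) (simp add: LR_iff)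
        have md: "keys m \<subseteq> lvars d" using LR m by (auto simp: LR_iff)
        let ?H = "H + lconst (- ?c) * Pi_orb m"
        have invP: "invariant (Pi_orb m)"
          unfolding Pi_orb_def by (intro invariant_prod invariant_orb keys_res_subset[OF md])
        have invH: "invariant ?H"
          by (intro invariant_add invariant_scale less.prems(1) c invP)
        have lk: "lookup ?H \<mu> = lookup H \<mu> - ?c * lookup (Pi_orb m) \<mu>" for \<mu>
        proof -
          have "lconst (- ?c) * Pi_orb m = Poly_Mapping.map ((*) (- ?c)) (Pi_orb m)"
            by (simp add: lconst_def mult_map_scale_conv_mult)
          moreover have "lookup (Poly_Mapping.map ((*) (- ?c)) (Pi_orb m)) \<mu> = - ?c * lookup (Pi_orb m) \<mu>"
            by (simp add: map.rep_eq when_def)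
          ultimately show ?thesis by (simp add: lookup_add)
        qed
        \<comment> \<open>No new monomial of top weight appears: those of \<open>Pi_orb m\<close>
          lie in the orbit of m under \<open>G\<close>, where \<open>H\<close> has the same nonzero
          coefficient as at m.\<close>
        have key: "\<mu> \<in> keys H" if \<mu>: "\<mu> \<in> keys ?H" "weight \<mu> = b" for \<mu>
        proof (rule ccontr)
          assume "\<mu> \<notin> keys H"
          then have H0: "lookup H \<mu> = 0" by (simp add: in_keys_iff)
          then have nz: "lookup (Pi_orb m) \<mu> \<noteq> 0" using \<mu>(1) lk[of \<mu>] by (auto simp: in_keys_iff)
          have \<mu>d: "keys \<mu> \<subseteq> lvars d"
            using invP nz by (auto simp: invariant_def LR_iff in_keys_iff)
          have "\<forall>k<K. res lev k \<mu> \<in> orbit k (res lev k m)"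
            using lookup_Pi_orb(2)[OF md nz] \<mu>(2) m(2) by simp
          then obtain \<sigma> where "\<sigma> \<in> G" "\<mu> = act \<sigma> m" using orbit_imp_G[OF md _ \<mu>d] by blast
          then have "lookup H \<mu> = ?c" using invariant_lookup[OF less.prems(1)] by simp
          then show False using H0 m(1) by (simp add: in_keys_iff)
        qed
        have "m \<notin> keys ?H"
          using lookup_Pi_orb_self[OF md] lk[of m] by (simp add: in_keys_iff)
        then have "{\<mu> \<in> keys ?H. weight \<mu> = b} \<subset> {\<mu> \<in> keys H. weight \<mu> = b}"
          using key m by blast
        then have "card {\<mu> \<in> keys ?H. weight \<mu> = b} < card {\<mu> \<in> keys H. weight \<mu> = b}"
          by (intro psubset_card_mono) auto
        moreover have "weight \<mu> < Suc b" if "\<mu> \<in> keys ?H" for \<mu>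
        proof (cases "\<mu> \<in> keys H")
          case False
          then have "lookup (Pi_orb m) \<mu> \<noteq> 0" using that lk[of \<mu>] by (auto simp: in_keys_iff)
          then show ?thesis using lookup_Pi_orb(1)[OF md] m(2) by fastforce
        qed (use less.prems(2) in auto)
        ultimately have "\<Phi> ?H" using less.hyps invH by blast
        moreover have "\<Phi> (lconst ?c * Pi_orb m)"
          unfolding Pi_orb_def using LR by (intro scale orb keys_res_subset[OF md]) (simp add: LR_iff)
        ultimately have "\<Phi> (?H + lconst ?c * Pi_orb m)" by (rule add)
        moreover have "?H + lconst ?c * Pi_orb m = H"
          by (simp add: lconst_def single_uminus)
        ultimately show ?thesis by simp
      qed
    qed
  qed
  have "finite (weight ` keys H)" by simp
  then obtain b where "\<forall>x\<in>weight ` keys H. x < b"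
    using finite_nat_set_iff_bounded by blast
  then show ?thesis using main[OF H, of b] by auto
qed

end

section \<open>Spanning by products of generators\<close>

text \<open>The counts form the conjugate partition, and the multiplicity of the part k + 1 is the
  difference of two consecutive counts.\<close>

lemma desc_list_eqI:
  fixes xs ys :: "nat list"
  assumes "sorted (rev xs)" "sorted (rev ys)" "\<forall>x\<in>set xs. 0 < x" "\<forall>x\<in>set ys. 0 < x"
    and eq: "\<And>k. length (filter (\<lambda>x. k < x) xs) = length (filter (\<lambda>x. k < x) ys)"
  shows "xs = ys"
proof -
  have count: "length (filter (\<lambda>y. x < y) zs) = count (mset zs) (Suc x) + length (filter (\<lambda>y. Suc x < y) zs)" for x and zs :: "nat list"
    by (induction zs) (auto simp: less_Suc_eq)
  have "mset xs = mset ys"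
  proof (rule multiset_eqI)
    fix x show "count (mset xs) x = count (mset ys) x"
    proof (cases x)
      case 0
      then have "x \<notin> set xs" "x \<notin> set ys" using assms(3,4) by auto
      then show ?thesis by (metis count_mset_0_iff)
    next
      case (Suc k)
      show ?thesis using count[of k xs] count[of k ys] eq[of k] eq[of "Suc k"] by (simp add: Suc)
    qed
  qed
  then have "sort xs = rev xs" "sort xs = rev ys"
    using assms(1,2) by (auto intro: properties_for_sort)
  then show ?thesis by (metis rev_rev_ident)
qed

lemma length_filter_nth: "length (filter Pr xs) = card {a \<in> {1..length xs}. Pr (xs ! (a - 1))}"
proof -
  have "bij_betw Suc {i. i < length xs \<and> Pr (xs ! i)} {a \<in> {1..length xs}. Pr (xs ! (a - 1))}"
    by (rule bij_betwI[where g = "\<lambda>a. a - 1"]) auto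
  then show ?thesis unfolding length_filter_conv_card by (rule bij_betw_same_card)
qed

lemma desc_levels:
  fixes xs :: "nat list"
  assumes "sorted (rev xs)"
  shows "{a \<in> {1..length xs}. k < xs ! (a - 1)} = {1..card {a \<in> {1..length xs}. k < xs ! (a - 1)}}"
proof -
  let ?S = "{u. u < length xs \<and> k < xs ! u}"
  have "?S = {..<card ?S}"
  proof (rule down_closed_eq_lessThan)
    fix u assume "Suc u \<in> ?S"
    moreover from this have "xs ! Suc u \<le> xs ! u"
      using sorted_rev_nth_mono[OF assms, of u "Suc u"] by simp
    ultimately show "u \<in> ?S" by auto
  qed simp
  moreover have "{a \<in> {1..length xs}. k < xs ! (a - 1)} = Suc ` ?S"
    by (auto intro!: image_eqI[of _ Suc "_ - 1"])
  moreover have "card (Suc ` ?S) = card ?S" by (simp add: card_image)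
  ultimately show ?thesis by (metis image_Suc_lessThan)
qed

section \<open>Zeros forced on a leading specialization\<close>

context quiver_shuffle
begin

definition vanishes :: "('i \<Rightarrow> nat) \<Rightarrow> nat \<Rightarrow> ('i, 'k) laurent \<Rightarrow> bool"
  where "vanishes n s E \<longleftrightarrow> (\<forall>d len. tot d len = n \<longrightarrow> Nw d len > s \<longrightarrow>
    (\<forall>y. (\<forall>i a. y i a \<noteq> 0) \<longrightarrow> SG n E d len y = 0))"

lemma sum_remove2:
  fixes f :: "'b \<Rightarrow> 'c::comm_monoid_add"
  assumes "finite S" "a \<in> S" "b \<in> S" "a \<noteq> b"
  shows "sum f S = f a + (f b + sum f (S - {a} - {b}))"
  using assms by (simp add: sum.remove[of S a] sum.remove[of "S - {a}" b])

text \<open>Two overlapping or adjacent segments have the same points as their union together with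
  their intersection, which is a configuration of larger weight.\<close>

lemma merge_segments:
  fixes d :: "'i \<Rightarrow> nat" and len :: "'i \<Rightarrow> nat \<Rightarrow> nat"
  assumes E: "E \<in> SL n" and n: "tot d len = n" and van: "vanishes n (Nw d len) E"
    and ab: "i \<in> V" "a \<in> {1..d i}" "b \<in> {1..d i}" "a \<noteq> b" and l: "l \<in> {len i b - len i a<..len i b}"
  shows "SG n E d len (generic_point i a b (int l)) = 0"
proof -
  let ?y = "generic_point i a b (int l)"
  \<comment> \<open>On x_ia = q^l x_ib segment a covers the exponents from l to l + len a - 1
    relative to x_ib. Segment b becomes the union, of length l + len a, and segment a the
    intersection, of length len b - l, which is 0 in the adjacent case.\<close>
  define len2 where "len2 = (\<lambda>j c. if j = i \<and> c = b then l + len i a else if j = i \<and> c = a then len i b - l else len j c)"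
  have l1: "len i b < l + len i a" "l \<le> len i b" "0 < l" using l by auto
  have len2: "len2 i a = len i b - l" "len2 i b = l + len i a" "\<And>c. c \<noteq> a \<Longrightarrow> c \<noteq> b \<Longrightarrow> len2 i c = len i c"
    "\<And>j c. j \<noteq> i \<Longrightarrow> len2 j c = len j c"
    using ab by (auto simp: len2_def)
  have n2: "tot d len2 = n"
  proof
    fix j show "tot d len2 j = n j"
    proof (cases "j = i")
      case True
      have "tot d len2 i = tot d len i"
        unfolding tot_def sum_remove2[OF finite_atLeastAtMost ab(2-4)]
        using l1 by (simp add: len2)
      then show ?thesis using n True by auto
    qed (use n in \<open>auto simp: tot_def len2\<close>)
  qed
  have "Nw d len2 > Nw d len"
  proof -
    obtain C where C: "len i b = C + l" using l1(2) by (metis le_add_diff_inverse2)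
    have "len i a > C" using l1 C by simp
    then have k: "l * C < l * len i a" using l1 by simp
    \<comment> \<open>With \<open>C\<close> = len b - l the weight grows by 2 l (len a - C), which
      is positive because the union is longer than segment b.\<close>
    then have lt: "len i a * (len i a + 1) + len i b * (len i b + 1) < len2 i a * (len2 i a + 1) + len2 i b * (len2 i b + 1)"
      unfolding len2 C using k by (simp only: algebra_simps)
    have "(\<Sum>c\<in>{1..d i}. len i c * (len i c + 1)) < (\<Sum>c\<in>{1..d i}. len2 i c * (len2 i c + 1))"
    proof -
      have "(\<Sum>c\<in>{1..d i} - {a} - {b}. len2 i c * (len2 i c + 1)) = (\<Sum>c\<in>{1..d i} - {a} - {b}. len i c * (len i c + 1))"
        by (rule sum.cong) (auto simp: len2)
      then show ?thesis
        unfolding sum_remove2[OF finite_atLeastAtMost ab(2-4)] using lt by linarith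
    qed
    moreover have "(\<Sum>j\<in>V - {i}. \<Sum>c\<in>{1..d j}. len2 j c * (len2 j c + 1)) = (\<Sum>j\<in>V - {i}. \<Sum>c\<in>{1..d j}. len j c * (len j c + 1))"
      by (intro sum.cong refl) (auto simp: len2)
    ultimately show ?thesis
      unfolding Nw_def sum.remove[OF finV ab(1)] by linarith
  qed
  then have "SG n E d len2 ?y = 0" using van n2 unfolding vanishes_def by auto
  moreover have "SG n E d len ?y = SG n E d len2 ?y"
    unfolding SG_def
  proof (rule evJ_reindex[OF E, where h = "\<lambda>j x. if j = i \<and> fst x = a \<and> len i b - l \<le> snd x then (b, l + snd x) else x"])
    show "idx n (seg d len)" using idx_seg[of d len] n by simp
    show "bij_betw (\<lambda>x. if j = i \<and> fst x = a \<and> len i b - l \<le> snd x then (b, l + snd x) else x) (seg d len j) (seg d len2 j)" for j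
    proof (cases "j = i")
      case True
      show ?thesis
        by (rule bij_betwI[where g = "\<lambda>x. if fst x = b \<and> len i b \<le> snd x then (a, snd x - l) else x"])
          (use ab l1 True in \<open>auto simp: seg_def len2_def split: if_splits\<close>)
    next
      case False
      then have "seg d len2 j = seg d len j" by (auto simp: seg_def len2)
      then show ?thesis using False by (simp add: bij_betw_def)
    qed
    show "sp ?y j x = sp ?y j (if j = i \<and> fst x = a \<and> len i b - l \<le> snd x then (b, l + snd x) else x)"
      if "j \<in> V" "x \<in> seg d len j" for j x
      using ab(4) by (auto simp: sp_def generic_point_def power_add)
  qed (simp_all add: sp_nz)
  ultimately show ?thesis by simp
qed

definition lin_forms :: "('i \<Rightarrow> nat) \<Rightarrow> ('i \<Rightarrow> nat \<Rightarrow> nat) \<Rightarrow> ('i \<times> nat \<times> nat \<times> nat) set"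
  where "lin_forms d len = (SIGMA i:V. SIGMA a:{1..d i}. SIGMA b:{1..d i} - {a}. {len i b - len i a<..len i b})"

text \<open>Integrality first splits off the divisor. It does not vanish at the generic points of
  the forced hyperplanes, so these are zeros of the cofactor \<open>H0\<close>, and their linear
  forms are divided out one at a time.\<close>

lemma Lin_dvd:
  assumes E: "E \<in> Sn n" and n: "tot d len = n" and van: "vanishes n (Nw d len) E"
  shows "\<exists>H. lfun d H \<and> (\<forall>y. (\<forall>i a. y i a \<noteq> 0) \<longrightarrow> SG n E d len y = Dv d len y * Lin d len y * H y)"
proof -
  let ?l = "\<lambda>(i, a, b, l) p. p i a - rconst (q powi int l) * p i b"
  have ES: "E \<in> SL n" "Sdiv n E" using E by (auto simp: Sn_iff)
  obtain H0 where H0: "lfun d H0" "\<And>y. \<forall>i a. y i a \<noteq> 0 \<Longrightarrow> SG n E d len y = Dv d len y * H0 y"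
    using ES(2)[unfolded Sdiv_def, rule_format, OF n] by blast
  have main: "\<exists>G. lfun d G \<and> (\<forall>p. (\<forall>i a. p i a \<noteq> 0) \<longrightarrow> H0 p = (\<Prod>x\<in>X. ?l x p) * G p)"
    if "finite X" "X \<subseteq> lin_forms d len" for X
    using that
  proof (induction X rule: finite_induct)
    case empty
    then show ?case using H0(1) by auto
  next
    case (insert x X)
    then obtain G where G: "lfun d G" "\<And>p. \<forall>i a. p i a \<noteq> 0 \<Longrightarrow> H0 p = (\<Prod>x\<in>X. ?l x p) * G p"
      by auto
    obtain i a b l where x: "x = (i, a, b, l)" by (cases x)
    have ab: "i \<in> V" "a \<in> {1..d i}" "b \<in> {1..d i}" "a \<noteq> b" and l: "l \<in> {len i b - len i a<..len i b}"
      using insert.prems x by (auto simp: lin_forms_def)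
    let ?gp = "generic_point i a b (int l)"
    have "Dv d len ?gp * H0 ?gp = 0"
      using merge_segments[OF ES(1) n van ab l] H0(2)[of ?gp] by simp
    then have "H0 ?gp = 0" using Dv_generic_nz by simp
    from lfun_dvd_linear[OF H0(1) ab this] obtain F
      where F: "lfun d F" "\<And>p. \<forall>i a. p i a \<noteq> 0 \<Longrightarrow> H0 p = (p i a - rconst (q powi int l) * p i b) * F p" by blast
    have 1: "lfun d (\<lambda>p. \<Prod>x\<in>X. ?l x p)"
      unfolding split_def
      by (intro lfun_prod lfun_diff lfun_mult lfun_q_powi lfun_var) (use insert.prems in \<open>auto simp: lin_forms_def\<close>)
    \<comment> \<open>An earlier form could vanish here only by being the same one. The opposite
      form x_ib - q^l' x_ia is no exception, because both exponents are positive.\<close>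
    have 2: "(\<Prod>x\<in>X. ?l x ?gp) \<noteq> 0"
    proof -
      have "?l z ?gp \<noteq> 0" if "z \<in> X" for z
      proof -
        obtain j c e l' where z: "z = (j, c, e, l')" by (cases z)
        have zf: "c \<noteq> e" "0 < l'" and ne: "(j, c, e, l') \<noteq> (i, a, b, l)"
          using that insert.prems insert.hyps x z by (auto simp: lin_forms_def)
        define g where "g j c = (if j = i \<and> c = a then l else 0)" for j c
        define h where "h j c = (if j = i \<and> c = a then b else c)" for j c
        have gp: "?gp j c = rconst (q ^ g j c) * rvar j (h j c)" for j c
          by (simp add: generic_point_def g_def h_def)
        have "\<not> (h j c = h j e \<and> q ^ g j c = q ^ (l' + g j e))"
          unfolding q_power_eq_iff using zf ne ab(4) l by (auto simp: g_def h_def split: if_splits)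
        then have "rconst (q ^ g j c) * rvar j (h j c) \<noteq> (rconst (q ^ (l' + g j e)) * rvar j (h j e) :: ('i, 'k) ratfun)"
          using q_nz by (subst rconst_rvar_eq_iff) auto
        then show ?thesis by (simp add: z gp power_add mult_ac)
      qed
      then show ?thesis using insert.hyps(1) by (subst prod_zero_iff) auto
    qed
    have "\<exists>H. lfun d H \<and> (\<forall>p. (\<forall>i a. p i a \<noteq> 0) \<longrightarrow> G p = (\<Prod>x\<in>{()}. p i a - rconst (q powi int l) * p i b) * H p)"
    proof (rule lfun_dvd_linear_prod[where C = "\<lambda>p. \<Prod>x\<in>X. ?l x p" and F = F and X = "{()}"
          and i = "\<lambda>_. i" and a = "\<lambda>_. a" and b = "\<lambda>_. b" and c = "\<lambda>_. int l"])
      show "F p * (\<Prod>x\<in>{()}. p i a - rconst (q powi int l) * p i b) = (\<Prod>x\<in>X. ?l x p) * G p"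
        if "\<And>i a. p i a \<noteq> 0" for p
        using G(2)[of p] F(2)[of p] that by (simp add: mult.commute)
    qed (use ab 1 2 F(1) G(1) in auto)
    then obtain K where K: "lfun d K" "\<And>p. \<forall>i a. p i a \<noteq> 0 \<Longrightarrow> G p = (p i a - rconst (q powi int l) * p i b) * K p"
      by auto
    show ?case
      using insert.hyps G(2) K x by (intro exI[of _ K]) (simp add: mult_ac)
  qed
  have fin: "finite (lin_forms d len)" unfolding lin_forms_def using finV by (intro finite_SigmaI) auto
  obtain G where G: "lfun d G" "\<And>p. \<forall>i a. p i a \<noteq> 0 \<Longrightarrow> H0 p = (\<Prod>x\<in>lin_forms d len. ?l x p) * G p"
    using main[OF fin subset_refl] by auto
  \<comment> \<open>Each factor of \<open>Lin\<close> becomes the linear form after multiplication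
    by the unit -q^l x_ib; \<open>?u\<close> collects these units.\<close>
  let ?u = "\<lambda>p. \<Prod>(i, a, b, l)\<in>lin_forms d len. - (rconst (q powi int l) * p i b)"
  have Lin: "(\<Prod>x\<in>lin_forms d len. ?l x p) = Lin d len p * ?u p" if p: "\<forall>i a. p i a \<noteq> 0" for p
  proof -
    have "Lin d len p = (\<Prod>(i, a, b, l)\<in>lin_forms d len. 1 - rconst (q powi (- int l)) * (p i a / p i b))"
      unfolding Lin_def lin_forms_def using finV by (simp add: prod.Sigma split_def)
    then have "Lin d len p * ?u p = (\<Prod>x\<in>lin_forms d len. (case x of (i, a, b, l) \<Rightarrow>
        (1 - rconst (q powi (- int l)) * (p i a / p i b)) * - (rconst (q powi int l) * p i b)))"
      by (simp add: prod.distrib[symmetric] split_def)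
    also have "\<dots> = (\<Prod>x\<in>lin_forms d len. ?l x p)"
    proof (rule prod.cong[OF refl], clarify)
      fix i a b l
      have "rconst (q powi (- int l)) * rconst (q powi int l) = (1 :: ('i, 'k) ratfun)"
        using q_nz by (simp add: power_int_minus rconst_inverse)
      then have "(1 - rconst (q powi (- int l)) * (p i a / p i b)) * (rconst (q powi int l) * p i b) =
          rconst (q powi int l) * p i b - p i a"
      proof -
        have "(1 - c * x) * (c' * y) = c' * y - (c * c') * (x * y)" for c c' x y :: "('i, 'k) ratfun"
          by (simp add: algebra_simps)
        then have "(1 - rconst (q powi (- int l)) * (p i a / p i b)) * (rconst (q powi int l) * p i b) =
          rconst (q powi int l) * p i b - (rconst (q powi (- int l)) * rconst (q powi int l)) * (p i a / p i b * p i b)" .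
        also have "\<dots> = rconst (q powi int l) * p i b - p i a"
          unfolding \<open>_ = 1\<close> using p[rule_format, of i b] by simp
        finally show ?thesis .
      qed
      then show "(1 - rconst (q powi (- int l)) * (p i a / p i b)) * - (rconst (q powi int l) * p i b) =
          p i a - rconst (q powi int l) * p i b"
        by (simp only: mult_minus_right minus_diff_eq)
    qed
    finally show ?thesis ..
  qed
  have "lfun d (\<lambda>p. ?u p * G p)"
    unfolding split_def
    by (intro lfun_mult G(1) lfun_prod lfun_uminus lfun_q_powi lfun_var) (auto simp: lin_forms_def)
  moreover have "SG n E d len y = Dv d len y * Lin d len y * (?u y * G y)" if "\<forall>i a. y i a \<noteq> 0" for y
    using H0(2)[OF that] G(2)[OF that] Lin[OF that] by (simp add: mult_ac)
  ultimately show ?thesis by (intro exI[of _ "\<lambda>p. ?u p * G p"]) blast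
qed

lemma Lin_rvar_nz: "Lin d len rvar \<noteq> 0"
  unfolding Lin_def using finV rvar_quotient_nz by (simp add: prod_zero_iff)

lemma Lin_perm:
  assumes "\<And>i. \<sigma> i permutes {1..d i}" "\<And>i a. len i (\<sigma> i a) = len i a"
  shows "Lin d len (\<lambda>i a. y i (\<sigma> i a)) = Lin d len y"
proof -
  have eq: "(\<Prod>a\<in>{1..d i}. \<Prod>b\<in>{1..d i} - {a}. f (\<sigma> i a) (\<sigma> i b)) = (\<Prod>a\<in>{1..d i}. \<Prod>b\<in>{1..d i} - {a}. f a b :: ('i, 'k) ratfun)" for i f
  proof -
    have bij: "bij_betw (\<sigma> i) {1..d i} {1..d i}" by (rule permutes_imp_bij[OF assms(1)])
    have "bij_betw (\<sigma> i) ({1..d i} - {a}) ({1..d i} - {\<sigma> i a})" if "a \<in> {1..d i}" for a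
      using bij_betw_DiffI[OF bij, of "{a}" "{\<sigma> i a}"] that permutes_in_image[OF assms(1), of i a] by (auto simp: bij_betw_def)
    then have "(\<Prod>a\<in>{1..d i}. \<Prod>b\<in>{1..d i} - {a}. f (\<sigma> i a) (\<sigma> i b)) = (\<Prod>a\<in>{1..d i}. \<Prod>b\<in>{1..d i} - {\<sigma> i a}. f (\<sigma> i a) b)"
      by (intro prod.cong refl prod.reindex_bij_betw)
    also have "\<dots> = (\<Prod>a\<in>{1..d i}. \<Prod>b\<in>{1..d i} - {a}. f a b)"
      by (rule prod.reindex_bij_betw[OF bij, of "\<lambda>a. \<Prod>b\<in>{1..d i} - {a}. f a b"])
    finally show ?thesis .
  qed
  show ?thesis
    unfolding Lin_def
  proof (rule prod.cong[OF refl])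
    fix i
    from eq[of "\<lambda>a b. \<Prod>l\<in>{len i b - len i a<..len i b}. 1 - rconst (q powi (- int l)) * (y i a / y i b)" i]
    show "(\<Prod>a\<in>{1..d i}. \<Prod>b\<in>{1..d i} - {a}. \<Prod>l\<in>{len i b - len i a<..len i b}.
        1 - rconst (q powi (- int l)) * (y i (\<sigma> i a) / y i (\<sigma> i b))) =
      (\<Prod>a\<in>{1..d i}. \<Prod>b\<in>{1..d i} - {a}. \<Prod>l\<in>{len i b - len i a<..len i b}.
        1 - rconst (q powi (- int l)) * (y i a / y i b))"
      by (simp only: assms(2))
  qed
qed

end

definition deg :: "('i var \<Rightarrow>\<^sub>0 int) \<Rightarrow> int"
  where "deg m = (\<Sum>v\<in>keys m. lookup m v)"

lemma mon_scale:
  assumes "c \<noteq> 0"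
  shows "mon (case_var (\<lambda>i a. c * y i a)) m = c powi deg m * mon (case_var y) m"
proof -
  have c: "(\<Prod>v\<in>S. c powi f v) = c powi (\<Sum>v\<in>S. f v)" for S :: "'a var set" and f
    by (induction S rule: infinite_finite_induct) (simp_all add: power_int_add assms)
  have "case_var (\<lambda>i a. c * y i a) v = c * case_var y v" for v
    by (cases v) simp
  then show ?thesis
    by (simp add: mon_def deg_def power_int_mult_distrib prod.distrib c)
qed

lemma deg_act:
  assumes "\<sigma> \<in> perm_families n"
  shows "deg (act \<sigma> m) = deg m"
proof -
  have "deg (act \<sigma> m) = (\<Sum>v\<in>vmap (pinv \<sigma>) ` keys m. lookup m (vmap \<sigma> v))"
    unfolding deg_def keys_act[OF assms] lookup_act[OF assms] ..
  also have "\<dots> = deg m"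
    unfolding deg_def
    by (subst sum.reindex) (auto simp: inj_on_subset[OF inj_vmap[OF pinv_perm[OF assms]]] vmap_pinv[OF assms])
  finally show ?thesis .
qed

text \<open>Permuting variables preserves the degree, so an orbit sum is homogeneous. The k-th
  factor of a leading specialization is evaluated at q^k y, and homogeneity turns this shift into a
  unit of \<open>R\<close>.\<close>

lemma (in block_symmetric) orb_scale:
  assumes "\<And>i a. y i a \<noteq> 0"
  shows "evl (\<lambda>i a. rconst (q ^ e) * y i a) (orb k \<eta>) = rconst (q powi (int e * deg \<eta>)) * evl y (orb k \<eta>)"
proof -
  have "deg m = deg \<eta>" if "m \<in> orbit k \<eta>" for m
    using that by (auto simp: orbit_def deg_act)
  moreover have "rconst (q ^ e) powi D = (rconst (q powi (int e * D)) :: ('i, 'k) ratfun)" for D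
    by (simp add: power_int_mult rconst_powi)
  ultimately show ?thesis
    using q_nz by (simp add: orb_def lsubst_sum mon_scale sum_distrib_left)
qed

context quiver_shuffle
begin

section \<open>The products of generators attached to a partition\<close>

definition chain :: "(nat \<Rightarrow> 'i \<Rightarrow> nat) \<Rightarrow> (nat \<Rightarrow> ('i, 'k) laurent) \<Rightarrow> nat \<Rightarrow> nat \<Rightarrow> (('i \<Rightarrow> nat) \<times> ('i, 'k) laurent) list"
  where "chain mk g K j = map (\<lambda>k. (mk k, g k)) [j..<K]"

lemma chain_simps:
  "chain mk g K K = []" "j < K \<Longrightarrow> chain mk g K j = (mk j, g j) # chain mk g K (Suc j)"
  by (simp_all add: chain_def upt_conv_Cons)

lemma edeg_chain:
  assumes mk: "\<And>k i. mk k i = card {a \<in> {1..d i}. k < len i a}"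
    and K: "\<And>i a. a \<in> {1..d i} \<Longrightarrow> len i a \<le> K" and "j \<le> K"
  shows "edeg (chain mk g K j) = tot d (\<lambda>i a. len i a - j)"
  using assms(3)
proof (induction rule: inc_induct)
  case base
  then show ?case using K by (simp add: chain_simps tot_def fun_eq_iff)
next
  case (step j)
  have "mk j i + tot d (\<lambda>i a. len i a - Suc j) i = tot d (\<lambda>i a. len i a - j) i" for i
  proof -
    have "mk j i = (\<Sum>a\<in>{1..d i}. if j < len i a then 1 else 0)"
      unfolding mk card_eq_sum by (rule sum.inter_filter) simp
    then show ?thesis
      unfolding tot_def by (simp only: sum.distrib[symmetric]) (rule sum.cong, auto)
  qed
  then show ?case using step by (simp add: chain_simps)
qed

lemma Nw_decrement: "Nw d len = Nw d (\<lambda>i a. len i a - 1) + 2 * sz (tot d len)"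
proof -
  have "l * (l + 1) = (l - 1) * (l - 1 + 1) + 2 * l" for l :: nat
    by (cases l) auto
  then show ?thesis
    unfolding Nw_def sz_def tot_def sum_distrib_left sum.distrib[symmetric]
    by (intro sum.cong refl) blast
qed

text \<open>For the conjugate partition the bound \<open>wtl\<close> is the weight of the partition
  itself: each level lowers the weight by twice the number of points still present.\<close>

lemma wtl_chain:
  assumes mk: "\<And>k i. mk k i = card {a \<in> {1..d i}. k < len i a}"
    and K: "\<And>i a. a \<in> {1..d i} \<Longrightarrow> len i a \<le> K" and "j \<le> K"
  shows "wtl (chain mk g K j) = Nw d (\<lambda>i a. len i a - j)"
  using assms(3)
proof (induction rule: inc_induct)
  case base
  then show ?case using K by (simp add: chain_simps Nw_def)
next
  case (step j)
  have "wtl (chain mk g K j) = wtl (chain mk g K (Suc j)) + 2 * sz (edeg (chain mk g K j))"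
    using step.hyps by (simp add: chain_simps)
  also have "edeg (chain mk g K j) = tot d (\<lambda>i a. len i a - j)"
    by (rule edeg_chain[OF mk K]) (use step.hyps in auto)
  also have "wtl (chain mk g K (Suc j)) = Nw d (\<lambda>i a. len i a - j - 1)"
    using step.IH by simp
  finally show ?case by (simp add: Nw_decrement[of d "\<lambda>i a. len i a - j"])
qed

lemma fits_chain:
  assumes "j \<le> K"
  shows "fits (chain mk g K j) d (\<lambda>i a. len i a - j) \<longleftrightarrow>
    (\<forall>k\<in>{j..<K}. \<forall>i\<in>V. mk k i = card {a \<in> {1..d i}. k < len i a}) \<and> (\<forall>i\<in>V. \<forall>a\<in>{1..d i}. len i a \<le> K)"
  using assms
proof (induction rule: inc_induct)
  case base
  then show ?case by (simp add: chain_simps)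
next
  case (step j)
  have "{j..<K} = insert j {Suc j..<K}" using step.hyps by auto
  then show ?case using step by (simp add: chain_simps conj_assoc)
qed

lemma Gp_chain:
  assumes "j \<le> K"
  shows "Gp (chain mk g K j) d (\<lambda>i a. len i a - j) y =
    (\<Prod>k\<in>{j..<K}. evJ (mk k) (g k) (\<lambda>i. {a \<in> {1..d i}. k < len i a}) (\<lambda>i a. rconst (q ^ (k - j)) * y i a))"
  using assms
proof (induction arbitrary: y rule: inc_induct)
  case base
  then show ?case by (simp add: chain_simps)
next
  case (step j)
  have split: "(\<Prod>k\<in>{j..<K}. f k) = f j * (\<Prod>k\<in>{Suc j..<K}. f k)" for f :: "nat \<Rightarrow> ('i, 'k) ratfun"
    by (rule prod.atLeast_Suc_lessThan) (use step.hyps in simp)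
  have sh: "rconst (q ^ (k - Suc j)) * (rconst q * y i a) = rconst (q ^ (k - j)) * y i a" if "k \<in> {Suc j..<K}" for k i a
  proof -
    have "k - j = Suc (k - Suc j)" using that by auto
    then show ?thesis by simp
  qed
  have "Gp (chain mk g K j) d (\<lambda>i a. len i a - j) y = evJ (mk j) (g j) (\<lambda>i. {a \<in> {1..d i}. j < len i a}) y *
    Gp (chain mk g K (Suc j)) d (\<lambda>i a. len i a - Suc j) (\<lambda>i a. rconst q * y i a)"
    using step.hyps by (simp add: chain_simps)
  also have "\<dots> = evJ (mk j) (g j) (\<lambda>i. {a \<in> {1..d i}. j < len i a}) y *
    (\<Prod>k\<in>{Suc j..<K}. evJ (mk k) (g k) (\<lambda>i. {a \<in> {1..d i}. k < len i a}) (\<lambda>i a. rconst (q ^ (k - j)) * y i a))"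
    unfolding step.IH by (intro arg_cong2[where f = "(*)"] prod.cong refl) (simp only: sh)
  finally show ?case by (simp add: split)
qed

lemma shuffle_homog_0: "shuffle_homog Q t q n n' 0 E' = 0" "shuffle_homog Q t q n n' E 0 = 0"
  by (simp_all add: shuffle_homog_def shuffle_sym_def)

lemma shuffle_mult_single:
  "shuffle_mult Q t q (single n E) (single n' E') =
    single (\<lambda>i. n i + n' i) (shuffle_homog Q t q n n' E E')"
  by (simp add: shuffle_mult_def shuffle_homog_0)

lemma gscale_single: "gscale c (single n E) = single n (lconst c * E)"
  by (simp add: gscale_def)

text \<open>\<open>A\<close> will be an arbitrary subalgebra containing the generators; once the
  integral elements are known to lie in each of these, they lie in the hull. Elements of
  \<open>An\<close> are kept integral as well, so that they can be subtracted from integral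
  elements.\<close>

definition An :: "('i, 'k) graded set \<Rightarrow> ('i \<Rightarrow> nat) \<Rightarrow> ('i, 'k) laurent set"
  where "An A n = {F \<in> Sn n. single n F \<in> A}"

context
  fixes A :: "('i, 'k) graded set"
  assumes A: "is_subalgebra Q t q A"
    and gens: "{e_gen Q q n g | n g. n \<in> degrees Q \<and> g \<in> SL n} \<subseteq> A"
begin

lemma An_0: "0 \<in> An A n"
  using A by (simp add: An_def Sn_0 is_subalgebra_def is_submodule_def)

lemma An_add: "E \<in> An A n \<Longrightarrow> E' \<in> An A n \<Longrightarrow> E + E' \<in> An A n"
  using A by (simp add: An_def Sn_add is_subalgebra_def is_submodule_def single_add)

lemma An_scale:
  assumes "c \<in> R" "E \<in> An A n"
  shows "lconst c * E \<in> An A n"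
proof -
  have "gscale c (single n E) \<in> A"
    using A assms by (auto simp: An_def is_subalgebra_def is_submodule_def)
  then show ?thesis using assms by (simp add: An_def Sn_scale gscale_single)
qed

lemma An_eprod: "egood L \<Longrightarrow> eprod L \<in> An A (edeg L)"
proof (induction L)
  case Nil
  then show ?case using A Sn_1 by (simp add: An_def is_subalgebra_def shuffle_one_def)
next
  case (Cons x L)
  then have x: "fst x \<in> degrees Q" "snd x \<in> SL (fst x)" "egood L" by (auto simp: egood_def)
  have "single (fst x) (eg (fst x) (snd x)) \<in> A"
    using gens x by (auto simp: e_gen_eq)
  moreover have "single (edeg L) (eprod L) \<in> A" using Cons.IH[OF x(3)] by (simp add: An_def)
  ultimately have "shuffle_mult Q t q (single (fst x) (eg (fst x) (snd x))) (single (edeg L) (eprod L)) \<in> A"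
    using A unfolding is_subalgebra_def by blast
  then show ?case using Sn_eprod[OF Cons.prems] by (simp add: An_def shuffle_mult_single)
qed

definition plen :: "('i \<Rightarrow> nat list) \<Rightarrow> 'i \<Rightarrow> nat \<Rightarrow> nat"
  where "plen P i a = P i ! (a - 1)"

text \<open>One sorted representative for each family of partitions; the induction counts these
  representatives.\<close>

definition desc :: "('i \<Rightarrow> nat) \<Rightarrow> ('i \<Rightarrow> nat list) \<Rightarrow> bool"
  where "desc n P \<longleftrightarrow> (\<forall>i. composition (n i) (P i) \<and> sorted (rev (P i)))"

lemma desc_tot: "desc n P \<Longrightarrow> tot (\<lambda>i. length (P i)) (plen P) = n"
  using tot_composition[of n P] by (simp add: desc_def plen_def[abs_def])

lemma desc_off: "n \<in> degrees Q \<Longrightarrow> desc n P \<Longrightarrow> i \<notin> V \<Longrightarrow> P i = []"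
  using degrees_D[of n i] by (auto simp: desc_def composition_def) (metis gr_zeroI list.set_intros(1) list.exhaust sum_list_eq_0_iff not_less_zero)

text \<open>\<open>F\<close> must also vanish at the other partitions of weight s, so that
  subtracting it from \<open>E\<close> removes P without restoring a partition treated before. It
  comes from the cofactor of \<open>E\<close> left after the divisor and the forced zeros: this is
  expanded in products of orbit sums, and each of those is realized by one product of
  generators.\<close>

lemma lead_span:
  assumes n: "n \<in> degrees Q" and P: "desc n P" and E: "E \<in> Sn n"
    and van: "vanishes n s E" and s: "Nw (\<lambda>i. length (P i)) (plen P) = s"
  shows "\<exists>F\<in>An A n. vanishes n s F \<and>
    (\<forall>P'. desc n P' \<longrightarrow> Nw (\<lambda>i. length (P' i)) (plen P') = s \<longrightarrow> P' \<noteq> P \<longrightarrow>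
      SG n F (\<lambda>i. length (P' i)) (plen P') rvar = 0) \<and>
    (\<forall>y. (\<forall>i a. y i a \<noteq> 0) \<longrightarrow> SG n F (\<lambda>i. length (P i)) (plen P) y = SG n E (\<lambda>i. length (P i)) (plen P) y)"
proof -
  let ?d = "\<lambda>i. length (P i)" and ?len = "plen P"
  \<comment> \<open>The total degree bounds all segment lengths. A crude bound is harmless: beyond
    the longest segment the degrees \<open>mk k\<close> are 0.\<close>
  define K where "K = sz n"
  define mk where "mk k i = card {a \<in> {1..?d i}. k < ?len i a}" for k i
  define lev where "lev i a = ?len i a - 1" for i a
  have tot: "tot ?d ?len = n" by (rule desc_tot[OF P])
  have off: "?d i = 0" if "i \<notin> V" for i using desc_off[OF n P that] by simp
  have len_pos: "0 < ?len i a" if "a \<in> {1..?d i}" for i a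
  proof -
    have "?len i a \<in> set (P i)" unfolding plen_def using that by (intro nth_mem) auto
    then show ?thesis using P by (auto simp: desc_def composition_def)
  qed
  have len_K: "?len i a \<le> K" if "a \<in> {1..?d i}" for i a
  proof -
    have i: "i \<in> V" using off that by force
    have "?len i a \<le> tot ?d ?len i" unfolding tot_def by (rule member_le_sum) (use that in auto)
    also have "\<dots> \<le> K" unfolding tot K_def sz_def by (rule member_le_sum) (use i finV in auto)
    finally show ?thesis .
  qed
  have mk_set: "{a \<in> {1..?d i}. k < ?len i a} = {1..mk k i}" for k i
    using desc_levels[of "P i" k] P by (simp add: desc_def mk_def plen_def)
  have mk_deg: "mk k \<in> degrees Q" for k
    using off by (auto simp: degrees_def mk_def)
  interpret B: block_symmetric Q t q ?d lev K mk
  proof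
    show "?d \<in> degrees Q" using off by (auto simp: degrees_def)
    show "mk k \<in> degrees Q" for k by (rule mk_deg)
    show "lev i a < K" if "i \<in> V" "a \<in> {1..?d i}" for i a
      using len_pos[OF that(2)] len_K[OF that(2)] by (simp add: lev_def)
    show "{1..mk k i} = {a \<in> {1..?d i}. k \<le> lev i a}" if "i \<in> V" for k i
      unfolding mk_set[symmetric] lev_def using len_pos[of _ i] by force
  qed
  obtain H where H: "lfun ?d H" "\<And>y. \<forall>i a. y i a \<noteq> 0 \<Longrightarrow> SG n E ?d ?len y = Dv ?d ?len y * Lin ?d ?len y * H y"
    using Lin_dvd[OF E tot] van s by auto
  from H(1) obtain Hp where Hp: "Hp \<in> LR ?d" "\<And>p. (\<And>i a. p i a \<noteq> 0) \<Longrightarrow> H p = evl p Hp"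
    by (rule lfunE) blast
  \<comment> \<open>Specialization, divisor and forced zeros are unchanged when segments of equal
    length are permuted, and the last two do not vanish at the generic point, so the cofactor
    inherits the symmetry.\<close>
  have inv: "B.invariant Hp"
    unfolding B.invariant_def
  proof (intro conjI ballI Hp(1))
    fix \<sigma> assume \<sigma>: "\<sigma> \<in> B.G"
    then have p: "\<sigma> i permutes {1..?d i}" and l: "lev i (\<sigma> i a) = lev i a" for i a
      by (auto simp: B.G_def perm_families_def)
    have len: "?len i (\<sigma> i a) = ?len i a" for i a
    proof (cases "a \<in> {1..?d i}")
      case True
      then have "\<sigma> i a \<in> {1..?d i}" using permutes_in_image[OF p] by blast
      then show ?thesis using l[of i a] len_pos[OF True] len_pos[of "\<sigma> i a" i] by (simp add: lev_def)
    next
      case False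
      then show ?thesis using permutes_not_in[OF p] by metis
    qed
    let ?r = "rvar :: 'i \<Rightarrow> nat \<Rightarrow> ('i, 'k) ratfun" and ?y = "\<lambda>i a. rvar i (\<sigma> i a) :: ('i, 'k) ratfun"
    have bij: "bij_betw (\<sigma> i) {b \<in> {1..?d i}. 0 < ?len i b} {a \<in> {1..?d i}. 0 < ?len i a}" for i
    proof -
      have "{b \<in> {1..?d i}. 0 < ?len i b} = {1..?d i}" using len_pos by blast
      then show ?thesis using permutes_imp_bij[OF p] by simp
    qed
    have "SG n E ?d ?len ?y = SG n E ?d ?len ?r"
      by (rule SG_reindex[OF _ tot[symmetric] bij]) (use E len in \<open>auto simp: Sn_iff\<close>)
    moreover have "Dv ?d ?len ?y = Dv ?d ?len ?r"
      by (rule Dv_reindex[OF bij]) (simp add: len)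
    moreover have "Lin ?d ?len ?y = Lin ?d ?len ?r"
      by (rule Lin_perm[where \<sigma> = \<sigma> and d = ?d and len = ?len and y = ?r, OF p len])
    ultimately have "Dv ?d ?len ?r * Lin ?d ?len ?r * H ?y = Dv ?d ?len ?r * Lin ?d ?len ?r * H ?r"
      using H(2)[of ?y] H(2)[of ?r] by simp
    then have "H ?y = H ?r" using Dv_rvar_nz Lin_rvar_nz by simp
    then show "evl ?y Hp = evl ?r Hp" using Hp(2)[of ?y] Hp(2)[of ?r] by simp
  qed
  define \<Phi> where "\<Phi> Hq \<longleftrightarrow> (\<exists>F\<in>An A n. vanishes n s F \<and>
    (\<forall>P'. desc n P' \<longrightarrow> Nw (\<lambda>i. length (P' i)) (plen P') = s \<longrightarrow> P' \<noteq> P \<longrightarrow>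
      SG n F (\<lambda>i. length (P' i)) (plen P') rvar = 0) \<and>
    (\<forall>y. (\<forall>i a. y i a \<noteq> 0) \<longrightarrow> SG n F ?d ?len y = Dv ?d ?len y * Lin ?d ?len y * evl y Hq))" for Hq
  have scale: "\<Phi> (lconst c * Hq)" if c: "c \<in> R" and H: "\<Phi> Hq" for c Hq
  proof -
    obtain F where F: "F \<in> An A n" "vanishes n s F"
      "\<And>P'. desc n P' \<Longrightarrow> Nw (\<lambda>i. length (P' i)) (plen P') = s \<Longrightarrow> P' \<noteq> P \<Longrightarrow> SG n F (\<lambda>i. length (P' i)) (plen P') rvar = 0"
      "\<And>y. \<forall>i a. y i a \<noteq> 0 \<Longrightarrow> SG n F ?d ?len y = Dv ?d ?len y * Lin ?d ?len y * evl y Hq"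
      using H unfolding \<Phi>_def by blast
    show ?thesis
      unfolding \<Phi>_def
    proof (intro bexI[of _ "lconst c * F"] conjI allI impI)
      show "lconst c * F \<in> An A n" by (rule An_scale[OF c F(1)])
      show "vanishes n s (lconst c * F)" using F(2) by (simp add: vanishes_def SG_scale)
    qed (use F(3,4) in \<open>simp_all add: SG_scale evl_scale\<close>)
  qed
  have "\<Phi> Hp"
  proof (rule B.invariant_induct[OF inv])
    show "\<Phi> 0"
      unfolding \<Phi>_def by (rule bexI[OF _ An_0]) (simp add: vanishes_def SG_0)
    show "\<Phi> (Ha + Hb)" if Ha: "\<Phi> Ha" and Hb: "\<Phi> Hb" for Ha Hb
    proof -
      obtain F where F: "F \<in> An A n" "vanishes n s F"
        "\<And>P'. desc n P' \<Longrightarrow> Nw (\<lambda>i. length (P' i)) (plen P') = s \<Longrightarrow> P' \<noteq> P \<Longrightarrow> SG n F (\<lambda>i. length (P' i)) (plen P') rvar = 0"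
        "\<And>y. \<forall>i a. y i a \<noteq> 0 \<Longrightarrow> SG n F ?d ?len y = Dv ?d ?len y * Lin ?d ?len y * evl y Ha"
        using Ha unfolding \<Phi>_def by blast
      obtain F' where F': "F' \<in> An A n" "vanishes n s F'"
        "\<And>P'. desc n P' \<Longrightarrow> Nw (\<lambda>i. length (P' i)) (plen P') = s \<Longrightarrow> P' \<noteq> P \<Longrightarrow> SG n F' (\<lambda>i. length (P' i)) (plen P') rvar = 0"
        "\<And>y. \<forall>i a. y i a \<noteq> 0 \<Longrightarrow> SG n F' ?d ?len y = Dv ?d ?len y * Lin ?d ?len y * evl y Hb"
        using Hb unfolding \<Phi>_def by blast
      show ?thesis
        unfolding \<Phi>_def
      proof (intro bexI[of _ "F + F'"] conjI allI impI)
        show "F + F' \<in> An A n" by (rule An_add[OF F(1) F'(1)])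
        show "vanishes n s (F + F')" using F(2) F'(2) by (simp add: vanishes_def SG_add)
      qed (use F(3,4) F'(3,4) in \<open>simp_all add: SG_add ring_distribs\<close>)
    qed
    show "\<Phi> (lconst c * Hq)" if "c \<in> R" "\<Phi> Hq" for c Hq by (rule scale[OF that])
    fix \<eta> :: "nat \<Rightarrow> 'i var \<Rightarrow>\<^sub>0 int"
    assume \<eta>: "\<And>k. k < K \<Longrightarrow> keys (\<eta> k) \<subseteq> lvars (mk k)"
    define g where "g k = B.orb k (\<eta> k)" for k
    have gS: "g k \<in> SL (mk k)" if "k < K" for k unfolding g_def by (rule B.SL_orb[OF \<eta>[OF that]])
    let ?L = "chain mk g K 0"
    have good: "egood ?L" using gS mk_deg by (auto simp: egood_def chain_def)
    have ed: "edeg ?L = n"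
      using edeg_chain[of mk ?d ?len K 0 g] len_K tot by (simp add: mk_def)
    have wt: "wtl ?L = s"
      using wtl_chain[of mk ?d ?len K 0 g] len_K s by (simp add: mk_def)
    have lead: "(Nw d len > s \<longrightarrow> (\<forall>y. (\<forall>i a. y i a \<noteq> 0) \<longrightarrow> SG n (eprod ?L) d len y = 0)) \<and>
      (Nw d len = s \<longrightarrow> (\<forall>y. (\<forall>i a. y i a \<noteq> 0) \<longrightarrow> SG n (eprod ?L) d len y =
        (if fits ?L d len then Dv d len y * Lin d len y * Gp ?L d len y else 0)))" if "tot d len = n" for d len
      using eprod_lead[OF good, of d len] that ed wt by simp
    have fits0: "fits ?L d len \<longleftrightarrow> (\<forall>k\<in>{0..<K}. \<forall>i\<in>V. mk k i = card {a \<in> {1..d i}. k < len i a}) \<and> (\<forall>i\<in>V. \<forall>a\<in>{1..d i}. len i a \<le> K)" for d len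
      using fits_chain[of 0 K mk g d len] by simp
    have fitsP: "fits ?L ?d ?len"
      unfolding fits0 using len_K by (auto simp: mk_def)
    \<comment> \<open>The degrees of the factors record the conjugate partition, so the product fits
      no other partition than P.\<close>
    have other: "\<not> fits ?L (\<lambda>i. length (P' i)) (plen P')" if P': "desc n P'" "P' \<noteq> P" for P'
    proof
      assume f: "fits ?L (\<lambda>i. length (P' i)) (plen P')"
      have "P' i = P i" for i
      proof (cases "i \<in> V")
        case False
        then show ?thesis using desc_off[OF n P'(1) False] desc_off[OF n P False] by simp
      next
        case True
        show ?thesis
        proof (rule desc_list_eqI)
          fix k
          have "card {a \<in> {1..length (P' i)}. k < P' i ! (a - 1)} = card {a \<in> {1..length (P i)}. k < P i ! (a - 1)}"
          proof (cases "k < K")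
            case True
            then show ?thesis using f \<open>i \<in> V\<close> unfolding fits0 by (simp add: mk_def plen_def)
          next
            case False
            have "{a \<in> {1..length (P' i)}. k < P' i ! (a - 1)} = {}"
              using f \<open>i \<in> V\<close> False unfolding fits0 plen_def by fastforce
            moreover have "{a \<in> {1..length (P i)}. k < P i ! (a - 1)} = {}"
              using len_K[of _ i] False unfolding plen_def by fastforce
            ultimately show ?thesis by (simp only:)
          qed
          then show "length (filter (\<lambda>x. k < x) (P' i)) = length (filter (\<lambda>x. k < x) (P i))"
            by (simp only: length_filter_nth)
        qed (use P P'(1) in \<open>auto simp: desc_def composition_def\<close>)
      qed
      then show False using P'(2) by (auto simp: fun_eq_iff)
    qed
    \<comment> \<open>The total exponent of q produced by evaluating the k-th orbit sum at q^k y. As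
      q is a unit of \<open>R\<close>, it is removed at the end by scaling with q^(-D).\<close>
    define D where "D = (\<Sum>k\<in>{0..<K}. int k * deg (\<eta> k))"
    have Gp: "Gp ?L ?d ?len y = rconst (q powi D) * evl y (\<Prod>k<K. B.orb k (\<eta> k))" if y: "\<forall>i a. y i a \<noteq> 0" for y
    proof -
      have "Gp ?L ?d ?len y = (\<Prod>k\<in>{0..<K}. evJ (mk k) (g k) (\<lambda>i. {1..mk k i}) (\<lambda>i a. rconst (q ^ k) * y i a))"
        using Gp_chain[of 0 K mk g ?d ?len y] by (simp only: mk_set diff_zero)
      also have "\<dots> = (\<Prod>k\<in>{0..<K}. rconst (q powi (int k * deg (\<eta> k))) * evl y (B.orb k (\<eta> k)))"
      proof (rule prod.cong[OF refl])
        fix k assume "k \<in> {0..<K}"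
        then have "evJ (mk k) (g k) (\<lambda>i. {1..mk k i}) (\<lambda>i a. rconst (q ^ k) * y i a) = evl (\<lambda>i a. rconst (q ^ k) * y i a) (g k)"
          by (intro evJ_id gS) (use y q_nz in auto)
        then show "evJ (mk k) (g k) (\<lambda>i. {1..mk k i}) (\<lambda>i a. rconst (q ^ k) * y i a) =
           rconst (q powi (int k * deg (\<eta> k))) * evl y (B.orb k (\<eta> k))"
          unfolding g_def using y by (subst (asm) B.orb_scale) auto
      qed
      also have "\<dots> = (\<Prod>k\<in>{0..<K}. rconst (q powi (int k * deg (\<eta> k)))) * (\<Prod>k\<in>{0..<K}. evl y (B.orb k (\<eta> k)))"
        by (rule prod.distrib)
      also have "(\<Prod>k\<in>{0..<K}. evl y (B.orb k (\<eta> k))) = evl y (\<Prod>k<K. B.orb k (\<eta> k))"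
        using y by (simp add: evl_prod atLeast0LessThan)
      also have "(\<Prod>k\<in>S. rconst (q powi (int k * deg (\<eta> k)))) = (rconst (q powi (\<Sum>k\<in>S. int k * deg (\<eta> k))) :: ('i, 'k) ratfun)" for S
        by (induction S rule: infinite_finite_induct) (simp_all add: power_int_add q_nz)
      finally show ?thesis by (simp add: D_def)
    qed
    have "\<Phi> (lconst (q powi D) * (\<Prod>k<K. B.orb k (\<eta> k)))"
      unfolding \<Phi>_def
    proof (intro bexI[of _ "eprod ?L"] conjI allI impI)
      show "eprod ?L \<in> An A n" using An_eprod[OF good] ed by simp
      show "vanishes n s (eprod ?L)" unfolding vanishes_def using lead by blast
      show "SG n (eprod ?L) (\<lambda>i. length (P' i)) (plen P') rvar = 0"
        if "desc n P'" "Nw (\<lambda>i. length (P' i)) (plen P') = s" "P' \<noteq> P" for P'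
        using lead[OF desc_tot[OF that(1)]] that(2) other[OF that(1,3)] by simp
      fix y :: "'i \<Rightarrow> nat \<Rightarrow> ('i, 'k) ratfun" assume y: "\<forall>i a. y i a \<noteq> 0"
      have "SG n (eprod ?L) ?d ?len y = Dv ?d ?len y * Lin ?d ?len y * Gp ?L ?d ?len y"
        using lead[OF tot] s fitsP y by simp
      also have "Gp ?L ?d ?len y = evl y (lconst (q powi D) * (\<Prod>k<K. B.orb k (\<eta> k)))"
        using Gp[OF y] y by (simp add: evl_scale)
      finally show "SG n (eprod ?L) ?d ?len y = Dv ?d ?len y * Lin ?d ?len y * evl y (lconst (q powi D) * (\<Prod>k<K. B.orb k (\<eta> k)))" .
    qed
    from scale[OF R_q_powi[of "- D"] this]
    have "\<Phi> (lconst (q powi (- D)) * lconst (q powi D) * (\<Prod>k<K. B.orb k (\<eta> k)))" by (simp only: mult.assoc)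
    moreover have "lconst (q powi (- D)) * lconst (q powi D) = (1 :: ('i, 'k) laurent)"
      using q_nz by (simp add: lconst_def mult_single power_int_minus)
    ultimately show "\<Phi> (\<Prod>k<K. B.orb k (\<eta> k))" by simp
  qed
  then obtain F where F: "F \<in> An A n" "vanishes n s F"
    "\<And>P'. desc n P' \<Longrightarrow> Nw (\<lambda>i. length (P' i)) (plen P') = s \<Longrightarrow> P' \<noteq> P \<Longrightarrow> SG n F (\<lambda>i. length (P' i)) (plen P') rvar = 0"
    "\<And>y. \<forall>i a. y i a \<noteq> 0 \<Longrightarrow> SG n F ?d ?len y = Dv ?d ?len y * Lin ?d ?len y * evl y Hp"
    unfolding \<Phi>_def by blast
  have "SG n F ?d ?len y = SG n E ?d ?len y" if "\<forall>i a. y i a \<noteq> 0" for y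
    using F(4)[OF that] H(2)[OF that] Hp(2)[of y] that by simp
  then show ?thesis using F by blast
qed

lemma Nw_reindex:
  assumes r: "\<And>i. bij_betw (r i) {b \<in> {1..d' i}. 0 < len' i b} {a \<in> {1..d i}. 0 < len i a}"
    and len: "\<And>i b. b \<in> {1..d' i} \<Longrightarrow> 0 < len' i b \<Longrightarrow> len' i b = len i (r i b)"
  shows "Nw d' len' = Nw d len"
  unfolding Nw_def
proof (rule sum.cong[OF refl])
  fix i
  have "(\<Sum>a\<in>{1..d' i}. len' i a * (len' i a + 1)) = (\<Sum>a\<in>{a \<in> {1..d' i}. 0 < len' i a}. len' i a * (len' i a + 1))"
    by (rule sum.mono_neutral_right) auto
  also have "\<dots> = (\<Sum>a\<in>{a \<in> {1..d' i}. 0 < len' i a}. len i (r i a) * (len i (r i a) + 1))"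
  proof (rule sum.cong[OF refl])
    fix a assume "a \<in> {a \<in> {1..d' i}. 0 < len' i a}"
    then have "len' i a = len i (r i a)" using len[of a i] by simp
    then show "len' i a * (len' i a + 1) = len i (r i a) * (len i (r i a) + 1)" by simp
  qed
  also have "\<dots> = (\<Sum>a\<in>{a \<in> {1..d i}. 0 < len i a}. len i a * (len i a + 1))"
    by (rule sum.reindex_bij_betw[OF r])
  also have "\<dots> = (\<Sum>a\<in>{1..d i}. len i a * (len i a + 1))"
    by (rule sum.mono_neutral_left) auto
  finally show "(\<Sum>a\<in>{1..d' i}. len' i a * (len' i a + 1)) = (\<Sum>a\<in>{1..d i}. len i a * (len i a + 1))" .
qed

lemma finite_desc:
  assumes n: "n \<in> degrees Q"
  shows "finite {P. desc n P}"
proof (rule finite_subset)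
  let ?B = "{xs :: nat list. set xs \<subseteq> {..sz n} \<and> length xs \<le> sz n}"
  show "{P. desc n P} \<subseteq> {P. \<forall>i. (i \<in> V \<longrightarrow> P i \<in> ?B) \<and> (i \<notin> V \<longrightarrow> P i = [])}"
  proof
    fix P assume "P \<in> {P. desc n P}"
    then have P: "desc n P" by simp
    have "P i \<in> ?B" if i: "i \<in> V" for i
    proof -
      have pos: "\<forall>x\<in>set (P i). 0 < x" and sum: "sum_list (P i) = n i"
        using P by (auto simp: desc_def composition_def)
      have "n i \<le> sz n" unfolding sz_def by (rule member_le_sum) (use i finV in auto)
      moreover have "length xs \<le> sum_list xs" if "\<forall>x\<in>set xs. 0 < x" for xs :: "nat list"
        using that by (induction xs) force+
      note this[OF pos]
      ultimately show ?thesis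
        using pos sum member_le_sum_list[of _ "P i"] by (auto intro: order.trans)
    qed
    then show "P \<in> {P. \<forall>i. (i \<in> V \<longrightarrow> P i \<in> ?B) \<and> (i \<notin> V \<longrightarrow> P i = [])}"
      using desc_off[OF n P] by blast
  qed
  show "finite {P. \<forall>i. (i \<in> V \<longrightarrow> P i \<in> ?B) \<and> (i \<notin> V \<longrightarrow> P i = [])}"
    by (intro finite_set_of_finite_funs finV finite_lists_length_le) simp
qed

section \<open>Descent on the weight\<close>

definition vanishes_from :: "('i \<Rightarrow> nat) \<Rightarrow> nat \<Rightarrow> ('i, 'k) laurent \<Rightarrow> bool"
  where "vanishes_from n s E \<longleftrightarrow> (\<forall>d len. tot d len = n \<longrightarrow> s \<le> Nw d len \<longrightarrow>
    (\<forall>y. (\<forall>i a. y i a \<noteq> 0) \<longrightarrow> SG n E d len y = 0))"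

text \<open>With all segments of length 1 the specialization is \<open>E\<close> itself.\<close>

lemma vanishes_from_0:
  assumes E: "E \<in> SL n" and van: "vanishes_from n 0 E"
  shows "E = 0"
proof -
  let ?len = "\<lambda>i a. 1 :: nat"
  have tot: "tot n ?len = n" by (simp add: tot_def fun_eq_iff)
  have "SG n E n ?len rvar = evJ n E (\<lambda>i. {1..n i}) rvar"
    unfolding SG_def
  proof (rule evJ_reindex[OF E, where h = "\<lambda>i. fst"])
    show "idx n (seg n ?len)" using idx_seg[of n ?len] tot by simp
    show "bij_betw fst (seg n ?len i) {1..n i}" for i
      by (rule bij_betwI[where g = "\<lambda>a. (a, 0)"]) (auto simp: seg_def)
  qed (auto simp: seg_def sp_def q_nz)
  also have "\<dots> = to_fract E" using evJ_id[OF E, of rvar] by (simp add: lsubst_rvar)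
  finally have "to_fract E = 0" using van tot by (simp add: vanishes_from_def)
  then show ?thesis by simp
qed

text \<open>The bound from which all specializations vanish is lowered to 0. Within one weight the
  finite set \<open>T\<close> of partitions with nonzero specialization shrinks each time an element
  from \<open>lead_span\<close> is subtracted. The start is the crude bound N(N + 1) on the weight
  of N points.\<close>

theorem single_in_subalgebra:
  assumes n: "n \<in> degrees Q" and E: "E \<in> Sn n"
  shows "single n E \<in> A"
proof -
  define T where "T s E = {P. desc n P \<and> Nw (\<lambda>i. length (P i)) (plen P) = s \<and> SG n E (\<lambda>i. length (P i)) (plen P) rvar \<noteq> 0}" for s E
  have finT: "finite (T s E)" for s E
    by (rule finite_subset[OF _ finite_desc[OF n]]) (auto simp: T_def)
  have main: "single n E \<in> A" if "E \<in> Sn n" "vanishes_from n s E" for s E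
    using that
  proof (induction s arbitrary: E)
    case 0
    then have "E = 0" by (intro vanishes_from_0) (auto simp: Sn_iff)
    then show ?case using An_0[of n] by (simp add: An_def)
  next
    case (Suc s)
    show ?case
      using Suc.prems
    proof (induction "card (T s E)" arbitrary: E rule: less_induct)
      case less
      have ES: "E \<in> SL n" using less.prems(1) by (simp add: Sn_iff)
      have van: "vanishes n s E" using less.prems(2) by (simp add: vanishes_from_def vanishes_def Suc_le_eq)
      show ?case
      proof (cases "T s E = {}")
        case True
        \<comment> \<open>A configuration of weight s reduces to a sorted partition of the same
          weight, where the specialization vanishes because \<open>T\<close> is empty.\<close>
        have "SG n E d len y = 0" if t: "tot d len = n" and s: "s \<le> Nw d len" and y: "\<forall>i a. y i a \<noteq> 0" for d len y
        proof (cases "Nw d len = s")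
          case False
          then show ?thesis using van t s y unfolding vanishes_def by auto
        next
          case Nws: True
          obtain P r where P: "\<And>i. composition (tot d len i) (P i)" "\<And>i. sorted (rev (P i))"
            and r: "\<And>i b. b \<in> {1..length (P i)} \<Longrightarrow> r i b \<in> {1..d i}"
              "\<And>i b. b \<in> {1..length (P i)} \<Longrightarrow> P i ! (b - 1) = len i (r i b)"
              "\<And>i. bij_betw (r i) {b \<in> {1..length (P i)}. 0 < P i ! (b - 1)} {a \<in> {1..d i}. 0 < len i a}"
            by (rule drop_empty_segments[of d len]) blast
          let ?d = "\<lambda>i. length (P i)"
          have desc: "desc n P" using P t by (simp add: desc_def)
          have tP: "tot ?d (plen P) = n" by (rule desc_tot[OF desc])
          have Nw: "Nw ?d (plen P) = s"
            using Nw_reindex[of r ?d "plen P" d len] r Nws by (simp add: plen_def)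
          have z0: "SG n E ?d (plen P) rvar = 0" using True desc Nw by (auto simp: T_def)
          have l: "lfun ?d (SG n E ?d (plen P))" using lfun_SG[of E ?d "plen P"] ES tP by simp
          have z: "SG n E ?d (plen P) y' = 0" if nz: "\<And>i a. y' i a \<noteq> 0" for y'
            by (rule lfun_eqI[OF l lfun_0[of ?d] z0]) (rule nz)
          have "SG n E ?d (plen P) (\<lambda>i b. y i (r i b)) = SG n E d len y"
            by (rule SG_reindex[OF ES tP[symmetric]]) (use r y in \<open>simp_all add: plen_def\<close>)
          then show ?thesis using z[of "\<lambda>i b. y i (r i b)"] y by simp
        qed
        then have "vanishes_from n s E" unfolding vanishes_from_def by blast
        then show ?thesis by (rule Suc.IH[OF less.prems(1)])
      next
        case False
        then obtain P where P: "P \<in> T s E" by blast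
        then have Pd: "desc n P" "Nw (\<lambda>i. length (P i)) (plen P) = s" by (auto simp: T_def)
        obtain F where F: "F \<in> An A n" "vanishes n s F"
          "\<And>P'. desc n P' \<Longrightarrow> Nw (\<lambda>i. length (P' i)) (plen P') = s \<Longrightarrow> P' \<noteq> P \<Longrightarrow> SG n F (\<lambda>i. length (P' i)) (plen P') rvar = 0"
          "\<And>y. \<forall>i a. y i a \<noteq> 0 \<Longrightarrow> SG n F (\<lambda>i. length (P i)) (plen P) y = SG n E (\<lambda>i. length (P i)) (plen P) y"
          using lead_span[OF n Pd(1) less.prems(1) van Pd(2)] by blast
        let ?E = "E + lconst (- 1) * F"
        have SE: "?E \<in> Sn n"
          using F(1) by (intro Sn_add less.prems(1) Sn_scale R_uminus R_1) (simp add: An_def)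
        have sg: "SG n ?E d len y = SG n E d len y - SG n F d len y" if "\<And>i a. y i a \<noteq> 0" for d len y
          using that by (simp add: SG_add SG_scale)
        have "T s ?E \<subset> T s E"
        proof
          show "T s ?E \<subseteq> T s E"
          proof
            fix P' assume P': "P' \<in> T s ?E"
            then have "P' \<noteq> P" using F(4)[of rvar] by (auto simp: T_def sg)
            then show "P' \<in> T s E" using P' F(3)[of P'] by (auto simp: T_def sg)
          qed
          have "P \<notin> T s ?E" using F(4)[of rvar] by (simp add: T_def sg)
          then show "T s ?E \<noteq> T s E" using P by blast
        qed
        then have "card (T s ?E) < card (T s E)" by (rule psubset_card_mono[OF finT])
        moreover have "vanishes_from n (Suc s) ?E"
          using less.prems(2) F(2) unfolding vanishes_from_def vanishes_def by (auto simp: sg Suc_le_eq)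
        ultimately have "single n ?E \<in> A" using less.hyps SE by blast
        then have "?E + F \<in> An A n" using SE by (intro An_add[OF _ F(1)]) (simp add: An_def)
        moreover have "?E + F = E" by (simp add: lconst_def single_uminus)
        ultimately show ?thesis by (simp add: An_def)
      qed
    qed
  qed
  have "vanishes_from n (Suc (sz n * (sz n + 1))) E"
  proof -
    have "Nw d len \<le> sz n * (sz n + 1)" if t: "tot d len = n" for d len
    proof -
      have "len i a \<le> sz n" if i: "i \<in> V" and a: "a \<in> {1..d i}" for i a
      proof -
        have "len i a \<le> tot d len i" unfolding tot_def by (rule member_le_sum) (use a in auto)
        also have "\<dots> \<le> sz n" unfolding t sz_def by (rule member_le_sum) (use i finV in auto)
        finally show ?thesis .
      qed
      then have "Nw d len \<le> (\<Sum>i\<in>V. \<Sum>a\<in>{1..d i}. len i a * (sz n + 1))"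
        unfolding Nw_def by (intro sum_mono mult_le_mono2) auto
      also have "\<dots> = sz n * (sz n + 1)"
        by (simp only: sum_distrib_right[symmetric] tot_def[symmetric] t sz_def)
      finally show ?thesis .
    qed
    then show ?thesis unfolding vanishes_from_def by fastforce
  qed
  then show ?thesis by (rule main[OF E])
qed

end

section \<open>Passage from homogeneous elements to the graded algebra\<close>

definition IS :: "('i, 'k) graded set"
  where "IS = {F. keys F \<subseteq> degrees Q \<and> (\<forall>n. lookup F n \<in> Sn n)}"

lemma IS_single: "n \<in> degrees Q \<Longrightarrow> E \<in> Sn n \<Longrightarrow> single n E \<in> IS"
  by (auto simp: IS_def lookup_single when_def Sn_0)

lemma IS_0: "0 \<in> IS"
  by (simp add: IS_def Sn_0)

lemma IS_add: "F \<in> IS \<Longrightarrow> F' \<in> IS \<Longrightarrow> F + F' \<in> IS"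
  using keys_add[of F F'] by (auto simp: IS_def lookup_add Sn_add)

lemma IS_sum: "(\<And>x. x \<in> S \<Longrightarrow> f x \<in> IS) \<Longrightarrow> sum f S \<in> IS"
  by (induction S rule: infinite_finite_induct) (auto intro: IS_0 IS_add)

lemma IS_decompose:
  assumes "F \<in> IS"
  shows "F = (\<Sum>n\<in>keys F. single n (lookup F n))"
    "\<And>n. n \<in> keys F \<Longrightarrow> n \<in> degrees Q \<and> lookup F n \<in> Sn n"
  using assms by (auto simp: poly_mapping_sum_single IS_def)

lemma submodule_sum:
  assumes "is_submodule Q t q M" "\<And>x. x \<in> S \<Longrightarrow> f x \<in> M"
  shows "sum f S \<in> M"
  using assms(2)
  by (induction S rule: infinite_finite_induct) (use assms(1) in \<open>auto simp: is_submodule_def\<close>)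

lemma submodule_IS: "is_submodule Q t q IS"
  unfolding is_submodule_def
proof (intro conjI ballI)
  show "IS \<subseteq> big_shuffle Q t q"
    by (auto simp: IS_def big_shuffle_def Sn_iff)
  show "gscale c F \<in> IS" if c: "c \<in> R" and F: "F \<in> IS" for c F
  proof -
    have "lookup (gscale c F) n = lconst c * lookup F n" for n
      by (simp add: gscale_def map.rep_eq when_def)
    moreover from this have "keys (gscale c F) \<subseteq> keys F"
      by (auto simp: in_keys_iff)
    ultimately show ?thesis using F c by (auto simp: IS_def Sn_scale)
  qed
qed (simp_all add: IS_0 IS_add)

lemma subalgebra_IS: "is_subalgebra Q t q IS"
  unfolding is_subalgebra_def
proof (intro conjI ballI submodule_IS)
  show "shuffle_one \<in> IS"
    unfolding shuffle_one_def by (intro IS_single Sn_1) (simp add: degrees_def)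
  show "shuffle_mult Q t q F F' \<in> IS" if "F \<in> IS" "F' \<in> IS" for F F'
    unfolding shuffle_mult_def
    by (intro IS_sum IS_single degrees_add Sn_homog)
      (use IS_decompose(2)[OF that(1)] IS_decompose(2)[OF that(2)] in auto)
qed

text \<open>\<open>IS\<close> is itself a submodule, and an element of it is the finite sum of its
  homogeneous components, which lies in every submodule containing them.\<close>

lemma integral_shuffle_IS: "integral_shuffle Q t q = IS"
proof -
  let ?S = "{single n E | n E. n \<in> degrees Q \<and> E \<in> Sn n}"
  have eq: "integral_shuffle Q t q = is_submodule Q t q hull ?S"
    unfolding integral_shuffle_def Sn_def by (rule arg_cong[where f = "\<lambda>S. is_submodule Q t q hull S"]) blast
  have "is_submodule Q t q hull ?S \<subseteq> IS"
    by (rule hull_minimal) (auto intro: IS_single submodule_IS)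
  moreover have "F \<in> is_submodule Q t q hull ?S" if F: "F \<in> IS" for F
    unfolding hull_def
  proof (rule InterI, clarify)
    fix M assume M: "is_submodule Q t q M" "?S \<subseteq> M"
    have "(\<Sum>n\<in>keys F. single n (lookup F n)) \<in> M"
      using IS_decompose(2)[OF F] M(2) by (intro submodule_sum[OF M(1)]) auto
    then show "F \<in> M" using IS_decompose(1)[OF F] by simp
  qed
  ultimately show ?thesis using eq by blast
qed

text \<open>\<open>IS\<close> is a subalgebra containing the generators; conversely
  \<open>single_in_subalgebra\<close> puts every homogeneous component into each subalgebra that
  contains them.\<close>

lemma hull_generators_IS:
  "is_subalgebra Q t q hull {e_gen Q q n g | n g. n \<in> degrees Q \<and> g \<in> SL n} = IS"
proof -
  let ?S = "{e_gen Q q n g | n g. n \<in> degrees Q \<and> g \<in> SL n}"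
  have "is_subalgebra Q t q hull ?S \<subseteq> IS"
    by (rule hull_minimal) (auto intro!: IS_single Sn_eg subalgebra_IS simp: e_gen_eq)
  moreover have "F \<in> is_subalgebra Q t q hull ?S" if F: "F \<in> IS" for F
    unfolding hull_def
  proof (rule InterI, clarify)
    fix A assume A: "is_subalgebra Q t q A" "?S \<subseteq> A"
    have "is_submodule Q t q A" using A(1) by (simp add: is_subalgebra_def)
    then have "(\<Sum>n\<in>keys F. single n (lookup F n)) \<in> A"
      using IS_decompose(2)[OF F] single_in_subalgebra[OF A] by (intro submodule_sum) auto
    then show "F \<in> A" using IS_decompose(1)[OF F] by simp
  qed
  ultimately show ?thesis by blast
qed

end

theorem theorem2p6:
  fixes Q :: "('i, 'e) pre_digraph"
    and t :: "'e \<Rightarrow> 'k::field_char_0"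
    and q :: 'k
  assumes "fin_digraph Q"
    and "\<And>\<alpha>. \<alpha> \<in> arcs Q \<Longrightarrow> t \<alpha> \<noteq> 0"
    and "q \<noteq> 0"
    and "\<And>n::nat. n > 0 \<Longrightarrow> q ^ n \<noteq> 1"
    and "\<And>\<alpha>. \<alpha> \<in> arcs Q \<Longrightarrow> tail Q \<alpha> = head Q \<alpha> \<Longrightarrow> t \<alpha> \<notin> range (\<lambda>k::int. q powi k)"
  shows "integral_shuffle Q t q =
    is_subalgebra Q t q hull {e_gen Q q n g | n g. n \<in> degrees Q \<and> g \<in> sym_laurent Q t q n}"
proof -
  interpret quiver_shuffle Q t q
    by (rule quiver_shuffle.intro) (use assms in auto)
  show ?thesis by (simp only: integral_shuffle_IS hull_generators_IS)
qed

end
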